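(* For $n\ge2$ let $0=\lambda_0^{(n)}<\lambda_1^{(n)}<\lambda_2^{(n)}<\cdots$ be the distinct eigenvalues of the Neumann Laplacian on the Vicsek set $\mathcal{VS}_n$. As $n\to\infty$ the spectrum converges, up to the constant factor $4/3$, to the spectrum of the Neumann Laplacian on the cross: for each fixed $j\ge1$, $$\lim_{n\to\infty}\rho_n\psi_n(\phi_{2j-1}(0))=\frac{4\pi^2}{3}(j-1)^2,\qquad \lim_{n\to\infty}\rho_n\psi_n(\phi_{2j-1}(4/3))=\frac{4\pi^2}{3}\Big(j-\frac12\Big)^2,$$ so that for every fixed $l\ge0$, $\lim_{n\to\infty}\lambda_l^{(n)}=\frac43\left(\frac{l\pi}{2}\right)^2$.
   Context: Vicsek set. For $n\ge2$, $\mathcal{VS}_n$ is the self-similar set in the unit square generated by the $4n-3$ orientation-preserving homotheties $F_i$ of ratio $1/(2n-1)$ that map the unit square onto the $4n-3$ subsquares lying along the two diagonals of the $(2n-1)\times(2n-1)$ grid of subsquares. $V_0$ is the set of the four corners, $\Gamma_0$ the complete graph on $V_0$; $V_m=\bigcup_iF_i(V_{m-1})$, and $\Gamma_m$ is the graph on $V_m$ in which two vertices are adjacent iff both are corners of a common $m$-cell. The graph Laplacian is $\Delta_mu(x)=\frac1{\deg x}\sum_{y\sim x}(u(y)-u(x))$ for all $x\in V_m$ (Neumann boundary conditions). Put $\rho_n=(4n-3)(2n-1)$. The Neumann Laplacian on $\mathcal{VS}_n$ is $\Delta u=\lim_m\rho_n^m\Delta_mu$; eigenvalues are those of $-\Delta$.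 Spectral decimation (known description of the spectrum). Let $U_k$ be the Chebyshev polynomials of the second kind, $g_n(\lambda)=U_{n-1}(3\lambda-1)-U_{n-2}(3\lambda-1)$, $h_n(\lambda)=U_{n-1}(3\lambda-1)-3U_{n-2}(3\lambda-1)$ and $R(\lambda)=\lambda g_n(\lambda)h_n(\lambda)$. Let $\phi_1<\cdots<\phi_{2n-1}$ be the inverse branches of $R$ on $[0,4/3]$ (they depend on $n$), and $\psi_n(t)=\lim_{m\to\infty}\rho_n^m\phi_1^{(m)}(t)$, where $\phi_1^{(m)}$ is the $m$-fold composition. The eigenvalues are exactly the numbers of the forms: (a) ($0$-series) $\lim_{m\to\infty}\rho_n^m\phi_{w_m}\circ\cdots\circ\phi_{w_1}(0)$, where all but finitely many $w_j$ equal $1$, and the first $w_j\ne1$ (if any) is odd; (b) ($4/3$-series, born on level $k\ge0$) $\lim_{m\to\infty}\rho_n^{m+k}\phi_{w_m}\circ\cdots\circ\phi_{w_1}(4/3)$, where all but finitely many $w_j$ equal $1$, $w_1$ is odd and $w_1\ne2n-1$. In increasing order the lowest eigenvalues are $\lambda_{2(j-1)}^{(n)}=\rho_n\psi_n(\phi_{2j-1}(0))$ for $1\le j\le n$ and $\lambda_{2j-1}^{(n)}=\rho_n\psi_n(\phi_{2j-1}(4/3))$ for $1\le j\le n-1$. The cross is the union of four unit segments joined at a common endpoint; its Neumann Laplacian is the second derivative on each segment with continuity and vanishing sum of outgoing derivatives at the center and Neumann conditions at the four ends; its eigenvalues are $\pi^2k^2$ and $\pi^2(k+\frac12)^2$,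 $k=0,1,2,\dots$. *)

theory Defs
  imports "HOL-Analysis.Analysis"
begin

section \<open>The Vicsek set and its graph approximations\<close>

definition diag_cells :: "nat \<Rightarrow> (nat \<times> nat) set" where
  "diag_cells n = {(i, j). i < 2 * n - 1 \<and> j < 2 * n - 1 \<and> (i = j \<or> i + j = 2 * n - 2)}"

definition cell_map :: "nat \<Rightarrow> nat \<times> nat \<Rightarrow> real \<times> real \<Rightarrow> real \<times> real" where
  "cell_map n c p =
     ((real (fst c) + fst p) / (2 * real n - 1), (real (snd c) + snd p) / (2 * real n - 1))"

definition vicsek_set :: "nat \<Rightarrow> (real \<times> real) set" where
  "vicsek_set n =
     (THE K. compact K \<and> K \<noteq> {} \<and> K = (\<Union>c\<in>diag_cells n. cell_map n c ` K))"

definition unit_corners :: "(real \<times> real) set" where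
  "unit_corners = {0, 1} \<times> {0, 1}"

primrec vicsek_V :: "nat \<Rightarrow> nat \<Rightarrow> (real \<times> real) set" where
  "vicsek_V n 0 = unit_corners"
| "vicsek_V n (Suc m) = (\<Union>c\<in>diag_cells n. cell_map n c ` vicsek_V n m)"

text \<open>An \<open>m\<close>-cell is represented by the set of its four corners.\<close>

primrec cell_corners :: "nat \<Rightarrow> nat \<Rightarrow> (real \<times> real) set set" where
  "cell_corners n 0 = {unit_corners}"
| "cell_corners n (Suc m) = {cell_map n c ` A | c A. c \<in> diag_cells n \<and> A \<in> cell_corners n m}"

definition vicsek_nbrs :: "nat \<Rightarrow> nat \<Rightarrow> real \<times> real \<Rightarrow> (real \<times> real) set" where
  "vicsek_nbrs n m x =
     {y \<in> vicsek_V n m. y \<noteq> x \<and> (\<exists>A\<in>cell_corners n m. x \<in> A \<and> y \<in> A)}"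

definition graph_laplacian ::
  "nat \<Rightarrow> nat \<Rightarrow> (real \<times> real \<Rightarrow> real) \<Rightarrow> real \<times> real \<Rightarrow> real" where
  "graph_laplacian n m u x =
     (\<Sum>y\<in>vicsek_nbrs n m x. u y - u x) / real (card (vicsek_nbrs n m x))"

section \<open>The Neumann Laplacian on the Vicsek set\<close>

definition rho :: "nat \<Rightarrow> real" where
  "rho n = (4 * real n - 3) * (2 * real n - 1)"

text \<open>
  \<open>vicsek_laplacian n u f\<close>: \<open>u\<close> is in the domain of the Neumann Laplacian and its Laplacian
  is \<open>f\<close>.  The limit is uniform over the vertices, as usual for Laplacians on fractals.  The
  vertices include the four corners of the unit square; this is the Neumann boundary condition.
\<close>

definition vicsek_laplacian ::
  "nat \<Rightarrow> (real \<times> real \<Rightarrow> real) \<Rightarrow> (real \<times> real \<Rightarrow> real) \<Rightarrow> bool" where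
  "vicsek_laplacian n u f \<longleftrightarrow>
     continuous_on (vicsek_set n) u \<and> continuous_on (vicsek_set n) f \<and>
     (\<forall>e>0. \<forall>\<^sub>F m in sequentially. \<forall>x\<in>vicsek_V n m.
        \<bar>rho n ^ m * graph_laplacian n m u x - f x\<bar> < e)"

text \<open>The set of eigenvalues of minus the Neumann Laplacian.\<close>

definition vicsek_spectrum :: "nat \<Rightarrow> real set" where
  "vicsek_spectrum n =
     {\<mu>. \<exists>u. vicsek_laplacian n u (\<lambda>x. - \<mu> * u x) \<and> (\<exists>x\<in>vicsek_set n. u x \<noteq> 0)}"

section \<open>The spectral decimation function and its inverse branches\<close>

fun chebyshev_U :: "nat \<Rightarrow> real \<Rightarrow> real" where
  "chebyshev_U 0 x = 1"
| "chebyshev_U (Suc 0) x = 2 * x"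
| "chebyshev_U (Suc (Suc k)) x = 2 * x * chebyshev_U (Suc k) x - chebyshev_U k x"

definition g_fun :: "nat \<Rightarrow> real \<Rightarrow> real" where
  "g_fun n x = chebyshev_U (n - 1) (3 * x - 1) - chebyshev_U (n - 2) (3 * x - 1)"

definition h_fun :: "nat \<Rightarrow> real \<Rightarrow> real" where
  "h_fun n x = chebyshev_U (n - 1) (3 * x - 1) - 3 * chebyshev_U (n - 2) (3 * x - 1)"

definition R_fun :: "nat \<Rightarrow> real \<Rightarrow> real" where
  "R_fun n x = x * g_fun n x * h_fun n x"

text \<open>
  For \<open>n \<ge> 2\<close> and \<open>0 \<le> t \<le> 4/3\<close> the equation \<open>R_fun n x = t\<close> has exactly \<open>2 n - 1\<close> solutions
  \<open>x\<close> in \<open>[0, 4/3]\<close>; the branch with index \<open>i\<close> (counted from 1) takes the \<open>i\<close>-th smallest.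
\<close>

definition phi :: "nat \<Rightarrow> nat \<Rightarrow> real \<Rightarrow> real" where
  "phi n i t = sorted_list_of_set {x \<in> {0..4/3}. R_fun n x = t} ! (i - 1)"

definition psi :: "nat \<Rightarrow> real \<Rightarrow> real" where
  "psi n t = lim (\<lambda>m. rho n ^ m * (phi n 1 ^^ m) t)"

section \<open>The Neumann Laplacian on the cross\<close>

text \<open>
  A function on the cross is a family \<open>u i\<close>, \<open>i < 4\<close>, of functions on the segments, each
  parametrized by the distance in \<open>[0, 1]\<close> from the center.
  \<open>cross_laplacian u f\<close>: \<open>u\<close> is in the domain and its Laplacian is \<open>f\<close>.
\<close>

definition cross_laplacian :: "(nat \<Rightarrow> real \<Rightarrow> real) \<Rightarrow> (nat \<Rightarrow> real \<Rightarrow> real) \<Rightarrow> bool" where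
  "cross_laplacian u f \<longleftrightarrow>
     (\<exists>u'. (\<forall>i<4. \<forall>t\<in>{0..1}.
              (u i has_real_derivative u' i t) (at t within {0..1}) \<and>
              (u' i has_real_derivative f i t) (at t within {0..1})) \<and>
           (\<forall>i<4. u i 0 = u 0 0) \<and>
           (\<Sum>i<4. u' i 0) = 0 \<and>
           (\<forall>i<4. u' i 1 = 0))"

definition cross_spectrum :: "real set" where
  "cross_spectrum =
     {\<kappa>. \<exists>u. cross_laplacian u (\<lambda>i t. - \<kappa> * u i t) \<and> (\<exists>i<4. \<exists>t\<in>{0..1}. u i t \<noteq> 0)}"

end

theory Submission
  imports Defs "HOL-Real_Asymp.Real_Asymp"
begin

text \<open>
  Write an argument of \<open>R_fun n\<close> as \<open>X a = 2/3 sin\<^sup>2 (a / N)\<close> with \<open>N = 2 n - 1\<close>, let \<open>delta a\<close> be the angle with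
  \<open>tan (delta a) = tan (a / N) / 2\<close>, and put \<open>gam a = a - delta a\<close>.  Then
  \<open>R_fun n (X a) = 4/3 sin a sin (gam a) / cos (delta a)\<close> and
  \<open>4/3 - R_fun n (X a) = 4/3 cos a cos (gam a) / cos (delta a)\<close>.
  Since \<open>delta\<close> is Lipschitz with constant \<open>2 / N\<close>, the preimages of \<open>0\<close> and \<open>4/3\<close> lie at
  angles \<open>a = l pi / 2 + O(1 / N)\<close>, and \<open>rho n * X a\<close> tends to \<open>4/3 (l pi / 2)\<^sup>2\<close>.  As
  \<open>t \<le> psi n t \<le> t / (1 - 3 t)\<close> for \<open>t \<le> 1/4\<close>, the function \<open>psi n\<close> does not affect the limit.

  For the spectrum, side vertices of the cells on a diagonal can be eliminated, which leaves the
  recurrence \<open>p (l - 1) + p (l + 1) = 2 cos (2 a / N) p l\<close> along the diagonal.  Solving it gives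
  an explicit extension operator from one level to the next that intertwines the equation for
  \<open>R_fun n (X a)\<close> with the one for \<open>X a\<close>.  Iterating it produces eigenfunctions, uniformly
  continuous because their energy equals eigenvalue times mass and hence decays geometrically per
  edge.  Conversely, pairing an approximate eigenfunction with the extension of a unit mass bounds
  the error on the coarser level by \<open>rho n\<close> times the error on the finer one; so a function whose
  rescaled errors tend to \<open>0\<close> is an exact eigenfunction on every level, and its eigenvalue is read
  off on the first level.
\<close>

section \<open>The decimation function in the angle coordinate\<close>

text \<open>The positive angles where \<open>R_fun n (X a)\<close> is 0 or 4/3 form two kinds. Those
  with \<open>sin a = 0\<close> or \<open>cos (gam a) = 0\<close> are resonances: a subdivided cell
  then carries a nonzero solution vanishing at its four corners, and the extension operator has a
  zero denominator. Those with \<open>cos a = 0\<close> or \<open>sin (gam a) = 0\<close> are the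
  ones that survive. The two kinds alternate, which is why odd branches appear in the limits. No
  list of the whole spectrum is established. For fixed \<open>l\<close> and large \<open>n\<close>
  the candidates \<open>low l\<close> are separated by gaps independent of \<open>n\<close>, and
  every eigenvalue below a fixed cutoff is one of them; counting then identifies the
  \<open>l\<close>-th eigenvalue. The obstacle to exhaustion is that
  \<open>\<mu> / rho n ^ J\<close> is only nearly an eigenvalue of the graph of level
  \<open>J\<close>. It is carried down by \<open>R_fun n\<close> to a fixed level, and then
  \<open>J\<close> tends to infinity. This uses nonnegative extension weights, hence angles at most
  \<open>pi / 2\<close>. For eigenvalues up to \<open>rho n / 4\<close> such angles are guaranteed
  from level 2 on, so level 1 is the one level where another branch than the first can
  enter.\<close>

lemma sorted_list_of_set_nth_card:
  fixes S :: "'a::linorder set"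
  assumes "finite S" "x \<in> S"
  shows "sorted_list_of_set S ! card {y \<in> S. y < x} = x"
proof -
  let ?xs = "sorted_list_of_set S"
  have s: "sorted_wrt (<) ?xs" "set ?xs = S" "distinct ?xs"
    using assms by auto
  obtain i where i: "i < length ?xs" "?xs ! i = x"
    using assms s(2) by (metis in_set_conv_nth)
  have "{y \<in> S. y < x} = (!) ?xs ` {..<i}"
  proof (intro set_eqI iffI)
    fix y assume y: "y \<in> {y \<in> S. y < x}"
    then obtain j where j: "j < length ?xs" "?xs ! j = y"
      using s(2) by (metis (mono_tags, lifting) in_set_conv_nth mem_Collect_eq)
    have "j < i"
    proof (rule ccontr)
      assume "\<not> j < i"
      then have "x \<le> y" using sorted_wrt_nth_less[OF s(1), of i j] i j
        by (cases "i = j") (auto simp: less_imp_le)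
      then show False using y by auto
    qed
    then show "y \<in> (!) ?xs ` {..<i}" using j by auto
  next
    fix y assume "y \<in> (!) ?xs ` {..<i}"
    then obtain j where j: "j < i" "y = ?xs ! j" by auto
    then have "y \<in> S" using i s(2) by (metis nth_mem order_less_trans)
    then show "y \<in> {y \<in> S. y < x}"
      using j i sorted_wrt_nth_less[OF s(1), of j i] by auto
  qed
  moreover have "inj_on ((!) ?xs) {..<i}"
    using s(3) i by (auto simp: inj_on_def nth_eq_iff_index_eq)
  ultimately have "card {y \<in> S. y < x} = i" by (simp add: card_image)
  then show ?thesis using i by simp
qed

lemma chebyshev_U_poly: "\<exists>p. \<forall>x. chebyshev_U k (3 * x - 1) = poly p x"
proof (induction k rule: induct_nat_012)
  case 0
  then show ?case by (intro exI[of _ 1]) simp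
next
  case 1
  then show ?case by (intro exI[of _ "[:-2, 6:]"]) simp
next
  case (ge2 k)
  then obtain p q where "\<forall>x. chebyshev_U (Suc k) (3 * x - 1) = poly p x"
    "\<forall>x. chebyshev_U k (3 * x - 1) = poly q x" by auto
  then show ?case
    by (intro exI[of _ "[:-2, 6:] * p - q"]) (simp add: algebra_simps)
qed

text \<open>The classical
  \<open>sin \<theta> * U_k (cos \<theta>) = sin ((k + 1) * \<theta>)\<close> combined with the
  parity of \<open>U_k\<close>. The argument is \<open>- cos \<theta>\<close> because
  \<open>3 * X a - 1 = - cos (2 * a / Nr)\<close>.\<close>

lemma sin_chebyshev_U:
  "sin \<theta> * chebyshev_U k (- cos \<theta>) = (-1) ^ k * sin ((real k + 1) * \<theta>)"
proof (induction k rule: induct_nat_012)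
  case 0
  then show ?case by simp
next
  case 1
  then show ?case using sin_double[of \<theta>] by simp
next
  case (ge2 k)
  have a: "sin ((real (Suc (Suc k)) + 1) * \<theta>) = 2 * cos \<theta> * sin ((real (Suc k) + 1) * \<theta>) - sin ((real k + 1) * \<theta>)"
  proof -
    have "(real (Suc (Suc k)) + 1) * \<theta> = (real (Suc k) + 1) * \<theta> + \<theta>"
      "(real k + 1) * \<theta> = (real (Suc k) + 1) * \<theta> - \<theta>" by (simp_all add: algebra_simps)
    then show ?thesis by (simp only: sin_add sin_diff) (simp add: algebra_simps)
  qed
  have "sin \<theta> * chebyshev_U (Suc (Suc k)) (- cos \<theta>)
      = - 2 * cos \<theta> * (sin \<theta> * chebyshev_U (Suc k) (- cos \<theta>)) - sin \<theta> * chebyshev_U k (- cos \<theta>)"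
    by (simp add: algebra_simps)
  also have "\<dots> = (-1) ^ Suc (Suc k) * sin ((real (Suc (Suc k)) + 1) * \<theta>)"
    unfolding ge2 a by (simp add: algebra_simps)
  finally show ?case .
qed

lemma cos_ge_quadratic: "1 - y\<^sup>2 / 2 \<le> cos y" for y :: real
proof -
  have "cos y = 1 - 2 * (sin (y / 2))\<^sup>2" using cos_double_sin[of "y/2"] by simp
  moreover have "(sin (y/2))\<^sup>2 \<le> (y/2)\<^sup>2"
    using abs_sin_x_le_abs_x[of "y/2"] by (simp only: abs_le_square_iff)
  ultimately show ?thesis by (simp add: power2_eq_square)
qed

lemma sin_ge_cubic:
  fixes x :: real assumes "0 \<le> x" shows "x - x ^ 3 / 6 \<le> sin x"
proof -
  have "(\<lambda>x. sin x - x + x ^ 3 / 6) 0 \<le> (\<lambda>x. sin x - x + x ^ 3 / 6) x"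
  proof (rule DERIV_nonneg_imp_nondecreasing[OF assms])
    fix y :: real
    have "((\<lambda>x. sin x - x + x ^ 3 / 6) has_real_derivative (cos y - 1 + y\<^sup>2 / 2)) (at y)"
      by (auto intro!: derivative_eq_intros simp: power2_eq_square)
    moreover have "0 \<le> cos y - 1 + y\<^sup>2 / 2" using cos_ge_quadratic[of y] by simp
    ultimately show "\<exists>d. ((\<lambda>x. sin x - x + x ^ 3 / 6) has_real_derivative d) (at y) \<and> 0 \<le> d" by blast
  qed
  then show ?thesis by simp
qed

locale vicsek =
  fixes n :: nat
  assumes n_ge: "n \<ge> 2"
begin

definition Nr :: real where "Nr = 2 * real n - 1"

text \<open>Chosen so that \<open>1 - 3 * X a\<close> is the cosine of \<open>2 * a / Nr\<close>;
  the angles in \<open>[0, Nr * pi / 2)\<close> sweep the values in \<open>[0, 2/3)\<close>.\<close>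

definition X :: "real \<Rightarrow> real" where "X a = 2/3 * (sin (a / Nr))\<^sup>2"

definition delta :: "real \<Rightarrow> real" where "delta a = arctan (tan (a / Nr) / 2)"

definition gam :: "real \<Rightarrow> real" where "gam a = a - delta a"

lemma Nr_ge: "Nr \<ge> 3" using n_ge unfolding Nr_def by simp
lemma Nr_pos: "Nr > 0" using Nr_ge by simp

lemma rho_Nr: "rho n = Nr * (2 * Nr - 1)"
  unfolding rho_def Nr_def by (simp add: algebra_simps)

lemma rho_ge: "rho n \<ge> 15"
proof -
  have "3 * 5 \<le> Nr * (2 * Nr - 1)" using Nr_ge by (intro mult_mono) auto
  then show ?thesis by (simp add: rho_Nr)
qed

lemma half_angle:
  assumes "0 \<le> a" "a < Nr * pi / 2"
  shows "0 \<le> a / Nr" "a / Nr < pi / 2"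
  using assms Nr_pos by (auto simp: field_simps)

lemma delta_bounds:
  assumes "0 \<le> a" "a < Nr * pi / 2"
  shows "0 \<le> delta a" "delta a < pi / 2" "0 < cos (delta a)"
proof -
  have "tan (a / Nr) \<ge> 0"
    using half_angle[OF assms] tan_gt_zero[of "a / Nr"] by (cases "a / Nr = 0") auto
  then show "0 \<le> delta a" unfolding delta_def by simp
  show "delta a < pi/2" unfolding delta_def using arctan_ubound[of "tan (a / Nr) / 2"] by simp
  show "0 < cos (delta a)" unfolding delta_def by (rule cos_gt_zero_pi) (rule arctan_lbound arctan_ubound)+
qed

lemma delta_pos:
  assumes "0 < a" "a < Nr * pi / 2" shows "0 < delta a"
proof -
  have "tan (a / Nr) > 0" using half_angle[of a] assms Nr_pos by (intro tan_gt_zero) auto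
  then show ?thesis unfolding delta_def by simp
qed

lemma delta_0 [simp]: "delta 0 = 0" and gam_0 [simp]: "gam 0 = 0" and X_0 [simp]: "X 0 = 0"
  by (simp_all add: delta_def gam_def X_def)

lemma tan_delta: "tan (delta a) = tan (a / Nr) / 2" unfolding delta_def by (rule tan_arctan)

text \<open>With \<open>T = (tan (z / Nr))\<^sup>2\<close> the derivative of \<open>delta\<close> at
  \<open>z\<close> is \<open>2 * (1 + T) / (4 + T) / Nr\<close>, and
  \<open>(1 + T) / (4 + T)\<close> stays between 0 and 1.\<close>

lemma delta_lipschitz:
  assumes "0 \<le> a" "a < b" "b < Nr * pi / 2"
  shows "delta a < delta b" "delta b - delta a \<le> 2 / Nr * (b - a)"
proof -
  define D where "D x = inverse (1 + (tan (x / Nr) / 2)\<^sup>2) * (inverse ((cos (x / Nr))\<^sup>2) * (1 / Nr) / 2)" for x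
  have der: "(delta has_real_derivative D x) (at x)" if "a \<le> x" "x \<le> b" for x
  proof -
    have h: "0 \<le> x / Nr" "x / Nr < pi / 2" using half_angle[of x] that assms by auto
    have "cos (x / Nr) \<noteq> 0" using cos_gt_zero_pi[of "x/Nr"] h by force
    then have "((\<lambda>x. tan (x / Nr)) has_real_derivative inverse ((cos (x / Nr))\<^sup>2) * (1 / Nr)) (at x)"
      using Nr_pos by (intro DERIV_chain2[OF DERIV_tan]) (auto intro!: derivative_eq_intros)
    then have "((\<lambda>x. arctan (tan (x / Nr) / 2)) has_real_derivative D x) (at x)"
      unfolding D_def by (intro DERIV_chain2[OF DERIV_arctan] DERIV_cdivide)
    then show ?thesis unfolding delta_def[abs_def] .
  qed
  obtain z where z: "a < z" "z < b" "delta b - delta a = (b - a) * D z"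
    using MVT2[OF assms(2) der] by auto
  have h: "0 \<le> z / Nr" "z / Nr < pi / 2" using half_angle[of z] z assms by auto
  have c: "cos (z / Nr) \<noteq> 0" using cos_gt_zero_pi[of "z/Nr"] h by force
  define T where "T = (tan (z / Nr))\<^sup>2"
  have T: "inverse ((cos (z / Nr))\<^sup>2) = 1 + T" "T \<ge> 0"
    using tan_sec[OF c] by (auto simp: T_def power_inverse)
  have D: "D z = 2 * (1 + T) / (4 + T) / Nr"
    unfolding D_def T using T(2) Nr_pos by (simp add: T_def[symmetric] power_divide divide_simps)
  have pos: "D z > 0" unfolding D using T(2) Nr_pos by (intro divide_pos_pos) auto
  then show "delta a < delta b" using z assms by (smt (verit) mult_pos_pos)
  have "2 * (1 + T) / (4 + T) \<le> 2" using T(2) by (simp add: divide_simps)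
  then have "D z \<le> 2 / Nr" unfolding D using Nr_pos by (intro divide_right_mono) auto
  then have "(b - a) * D z \<le> (b - a) * (2 / Nr)" using assms by (intro mult_left_mono) auto
  then show "delta b - delta a \<le> 2 / Nr * (b - a)" using z by (simp add: mult.commute)
qed

text \<open>The factor 1/3 is the smallest value of \<open>1 - 2 / Nr\<close>, attained at
  \<open>Nr = 3\<close>.\<close>

lemma gam_strict_mono:
  assumes "0 \<le> a" "a < b" "b < Nr * pi / 2"
  shows "gam a < gam b" "(b - a) / 3 \<le> gam b - gam a"
proof -
  have "2 / Nr * (b - a) \<le> 2 / 3 * (b - a)"
    using Nr_ge assms by (intro mult_right_mono) (auto simp: field_simps)
  then have "delta b - delta a \<le> 2 / 3 * (b - a)"
    using delta_lipschitz(2)[OF assms] by linarith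
  then show *: "(b - a) / 3 \<le> gam b - gam a" by (simp add: gam_def)
  then show "gam a < gam b" using assms(2) by (simp add: field_simps)
qed

lemma gam_bounds:
  assumes "0 \<le> a" "a < Nr * pi / 2"
  shows "a / 3 \<le> gam a" "gam a \<le> a"
proof -
  show "gam a \<le> a" using delta_bounds(1)[OF assms] by (simp add: gam_def)
  show "a / 3 \<le> gam a" using gam_strict_mono(2)[of 0 a] assms by (cases "a = 0") auto
qed

lemma X_strict_mono:
  assumes "0 \<le> a" "a < b" "b \<le> Nr * pi / 2" shows "X a < X b"
proof -
  have "sin (a / Nr) < sin (b / Nr)"
  proof (intro sin_monotone_2pi)
    have "0 \<le> a / Nr" using assms Nr_pos by simp
    then show "- (pi / 2) \<le> a / Nr" using pi_ge_zero by linarith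
  qed (use assms Nr_pos in \<open>auto simp: field_simps\<close>)
  moreover have "0 \<le> sin (a / Nr)"
  proof (intro sin_ge_zero)
    show "a / Nr \<le> pi" using half_angle[of a] assms by linarith
  qed (use assms Nr_pos in auto)
  ultimately have "(sin (a / Nr))\<^sup>2 < (sin (b / Nr))\<^sup>2" by (intro power_strict_mono) auto
  then show ?thesis by (simp add: X_def)
qed

lemma X_mono:
  assumes "0 \<le> a" "a \<le> b" "b \<le> Nr * pi / 2" shows "X a \<le> X b"
  using X_strict_mono[of a b] assms by (cases "a = b") auto

lemma X_less_iff:
  assumes "0 \<le> a" "0 \<le> b" "a \<le> Nr * pi / 2" "b \<le> Nr * pi / 2" shows "X a < X b \<longleftrightarrow> a < b"
  using X_strict_mono[of a b] X_mono[of b a] assms by (auto simp: not_less[symmetric])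

lemma X_range: "0 \<le> X a" "X a \<le> 2/3"
  using abs_sin_le_one[of "a / Nr"] unfolding X_def by (auto simp: abs_square_le_1)

lemma X_surj:
  assumes "0 \<le> x" "x < 2/3" obtains a where "0 \<le> a" "a < Nr * pi / 2" "X a = x"
proof -
  let ?s = "sqrt (3/2 * x)"
  have s: "0 \<le> ?s" "?s < 1" using assms by auto
  have "sin (arcsin ?s) = ?s" using s by (intro sin_arcsin) linarith+
  moreover have "arcsin ?s < pi/2" using arcsin_less_arcsin[of ?s 1] s by (auto simp: order_trans[of "-1" 0])
  moreover have "0 \<le> arcsin ?s" using arcsin_le_arcsin[of 0 ?s] s by simp
  ultimately show ?thesis
    using assms Nr_pos that[of "Nr * arcsin ?s"] by (simp add: X_def)
qed

section \<open>Closed form of the decimation function\<close>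

lemma R_0 [simp]: "R_fun n 0 = 0" by (simp add: R_fun_def)

lemma cos_X: "cos (2 * a / Nr) = 1 - 3 * X a"
  using cos_double_sin[of "a / Nr"] by (simp add: X_def)

text \<open>With \<open>p = a / Nr\<close> and \<open>Nr = 2 * n - 1\<close>, the two Chebyshev
  values are \<open>sin (a + p)\<close> and \<open>sin (a - p)\<close> over
  \<open>sin (2 * p)\<close>, up to sign. Addition formulas collapse \<open>g_fun\<close> to
  \<open>sin a / sin p\<close> and \<open>h_fun\<close> to
  \<open>(2 * sin a * cos p - cos a * sin p) / (sin p * cos p)\<close>; their common sign squares
  away, and \<open>X a\<close> supplies the factor \<open>(sin p)\<^sup>2\<close> that clears the
  denominators.\<close>

lemma R_X_raw:
  assumes "0 < a" "a < Nr * pi / 2"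
  shows "R_fun n (X a) = 2/3 * sin a * (2 * sin a - cos a * tan (a / Nr))"
proof -
  define p where "p = a / Nr"
  have p: "0 < p" "p < pi/2" using half_angle[of a] assms Nr_pos by (auto simp: p_def)
  have sp: "sin p > 0" using p by (intro sin_gt_zero) auto
  have cp: "cos p > 0" using p by (intro cos_gt_zero) auto
  have s2: "sin (2 * p) = 2 * sin p * cos p" by (rule sin_double)
  have s2p: "sin (2 * p) \<noteq> 0" using sp cp by (simp add: s2)
  have arg: "3 * X a - 1 = - cos (2 * p)" using cos_X[of a] by (simp add: p_def)
  obtain k where k: "n = Suc (Suc k)" using n_ge by (metis add_2_eq_Suc le_Suc_ex)
  have "Nr = 2 * real k + 3" unfolding Nr_def using k by simp
  then have a: "a = (2 * real k + 3) * p" using Nr_pos by (simp add: p_def)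
  have e1: "(real (n - 1) + 1) * (2 * p) = a + p" "(real (n - 2) + 1) * (2 * p) = a - p"
    unfolding a k by (simp_all add: algebra_simps)
  have U1: "chebyshev_U (n - 1) (3 * X a - 1) = - ((-1) ^ k * sin (a + p) / sin (2 * p))"
    using sin_chebyshev_U[of "2 * p" "n - 1"] s2p unfolding e1 arg by (simp add: field_simps k)
  have U2: "chebyshev_U (n - 2) (3 * X a - 1) = (-1) ^ k * sin (a - p) / sin (2 * p)"
    using sin_chebyshev_U[of "2 * p" "n - 2"] s2p unfolding e1 arg by (simp add: field_simps k)
  have g: "g_fun n (X a) = - ((-1) ^ k * (sin a / sin p))"
    unfolding g_fun_def U1 U2 s2 using sp cp by (simp add: sin_add sin_diff field_simps)
  have h: "h_fun n (X a) = - ((-1) ^ k * ((2 * sin a * cos p - cos a * sin p) / (sin p * cos p)))"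
    unfolding h_fun_def U1 U2 s2 using sp cp by (simp add: sin_add sin_diff field_simps)
  have kk: "((-1::real) ^ k) * (-1) ^ k = 1" by (simp flip: power_mult_distrib)
  have "R_fun n (X a) = 2/3 * (sin p)\<^sup>2 * (((-1) ^ k) * (-1) ^ k) * (sin a / sin p) * ((2 * sin a * cos p - cos a * sin p) / (sin p * cos p))"
    unfolding R_fun_def g h by (simp add: X_def p_def)
  also have "\<dots> = 2/3 * sin a * (2 * sin a - cos a * tan p)"
    unfolding kk using sp cp by (simp add: tan_def field_simps power2_eq_square)
  finally show ?thesis by (simp add: p_def)
qed

text \<open>The purpose of \<open>delta\<close>: since
  \<open>tan (a / Nr) = 2 * tan (delta a)\<close>, the combination of \<open>sin a\<close> and
  \<open>cos a\<close> left over from \<open>h_fun\<close> is a single sine with shifted phase,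
  whose zeros can be read off.\<close>

lemma sin_gam:
  assumes "0 \<le> a" "a < Nr * pi / 2"
  shows "2 * sin (gam a) = cos (delta a) * (2 * sin a - cos a * tan (a / Nr))"
    "2 * cos (gam a) = cos (delta a) * (2 * cos a + sin a * tan (a / Nr))"
proof -
  have "tan (a / Nr) = 2 * sin (delta a) / cos (delta a)" using tan_delta[of a] by (simp add: tan_def)
  then show "2 * sin (gam a) = cos (delta a) * (2 * sin a - cos a * tan (a / Nr))"
    "2 * cos (gam a) = cos (delta a) * (2 * cos a + sin a * tan (a / Nr))"
    using delta_bounds[OF assms] by (auto simp: gam_def sin_diff cos_diff field_simps)
qed

text \<open>The second identity follows from the first by
  \<open>sin a * sin (gam a) + cos a * cos (gam a) = cos (a - gam a)\<close>, where
  \<open>a - gam a = delta a\<close>.\<close>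

lemma R_X:
  assumes "0 \<le> a" "a < Nr * pi / 2"
  shows "R_fun n (X a) = 4/3 * sin a * sin (gam a) / cos (delta a)"
    "4/3 - R_fun n (X a) = 4/3 * cos a * cos (gam a) / cos (delta a)"
proof -
  note d = delta_bounds[OF assms]
  show *: "R_fun n (X a) = 4/3 * sin a * sin (gam a) / cos (delta a)"
  proof (cases "a = 0")
    case False
    have "2 * sin a - cos a * tan (a / Nr) = 2 * sin (gam a) / cos (delta a)"
      using sin_gam(1)[OF assms] d by (simp add: field_simps)
    then show ?thesis using R_X_raw[of a] False assms by simp
  qed simp
  have "sin a * sin (gam a) + cos a * cos (gam a) = cos (delta a)"
    using cos_diff[of a "gam a"] by (simp add: gam_def)
  then have "cos a * cos (gam a) = cos (delta a) - sin a * sin (gam a)" by linarith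
  then show "4/3 - R_fun n (X a) = 4/3 * cos a * cos (gam a) / cos (delta a)"
    unfolding * using d by (simp add: field_simps)
qed

lemma pi_half_lt: "pi / 2 < Nr * pi / 2" using Nr_ge by simp

text \<open>Up to \<open>pi / 2\<close> both sines increase while the denominator
  \<open>cos (delta a)\<close> decreases.\<close>

lemma R_X_strict_mono:
  assumes "0 \<le> a" "a < b" "b \<le> pi / 2"
  shows "R_fun n (X a) < R_fun n (X b)"
proof -
  have b: "b < Nr * pi / 2" using assms pi_half_lt by linarith
  have a: "a < Nr * pi / 2" using assms b by linarith
  note da = delta_bounds[OF assms(1) a]
  have b0: "0 \<le> b" using assms by linarith
  note db = delta_bounds[OF b0 b]
  have s: "sin a < sin b" using assms by (intro sin_monotone_2pi) auto
  have s0: "0 \<le> sin a" using assms by (intro sin_ge_zero) auto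
  have g: "gam a < gam b" "0 \<le> gam a" "gam b \<le> pi/2"
    using gam_strict_mono[of a b] gam_bounds[of a] gam_bounds[of b] assms a b b0 by auto
  have sg: "sin (gam a) < sin (gam b)" using g by (intro sin_monotone_2pi) auto
  have sg0: "0 \<le> sin (gam a)" using g by (intro sin_ge_zero) auto
  have c: "cos (delta b) \<le> cos (delta a)"
    using da db delta_lipschitz(1)[OF assms(1,2) b] by (intro cos_monotone_0_pi_le) auto
  have "sin a * sin (gam a) / cos (delta a) \<le> sin a * sin (gam a) / cos (delta b)"
    using s0 sg0 da db c by (intro divide_left_mono) auto
  also have "\<dots> < sin b * sin (gam b) / cos (delta b)"
    using s sg s0 sg0 db by (intro divide_strict_right_mono mult_strict_mono) auto
  finally show ?thesis unfolding R_X[OF assms(1) a] R_X[OF b0 b] by (simp add: field_simps)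
qed

text \<open>Gives continuity, and finiteness of the root sets, without which the sorted list in
  \<open>phi\<close> would be meaningless.\<close>

lemma R_poly: "\<exists>p. \<forall>x. R_fun n x = poly p x"
proof -
  obtain p q where "\<forall>x. chebyshev_U (n - 1) (3 * x - 1) = poly p x"
    "\<forall>x. chebyshev_U (n - 2) (3 * x - 1) = poly q x" using chebyshev_U_poly by meson
  then show ?thesis
    by (intro exI[of _ "[:0, 1:] * (p - q) * (p - smult 3 q)"]) (simp add: R_fun_def g_fun_def h_fun_def)
qed

lemma R_continuous: "continuous_on S (R_fun n)"
proof -
  obtain p where "R_fun n = poly p" using R_poly by auto
  then show ?thesis by (simp add: continuous_on_poly continuous_on_id)
qed

lemma R_pi_half: "R_fun n (X (pi / 2)) = 4/3"
  using R_X(2)[of "pi/2"] pi_half_lt by simp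

lemma finite_R_roots: "finite {x \<in> {0..4/3}. R_fun n x = t}"
proof -
  obtain p where p: "\<And>x. R_fun n x = poly p x" using R_poly by auto
  have "p - [:t:] \<noteq> 0"
  proof
    assume "p - [:t:] = 0"
    then have "R_fun n x = t" for x by (simp add: p)
    from this[of 0] this[of "X (pi/2)"] show False using R_pi_half by simp
  qed
  then have "finite {x. poly (p - [:t:]) x = 0}" by (rule poly_roots_finite)
  then show ?thesis by (rule finite_subset[rotated]) (auto simp: p)
qed

text \<open>Identifying a branch is reduced to counting the roots below the candidate.\<close>

lemma phi_card:
  assumes "0 \<le> x" "x \<le> 4/3" "R_fun n x = t"
    "card {y \<in> {0..4/3}. R_fun n y = t \<and> y < x} = i - 1"
  shows "phi n i t = x"
proof -
  have "{y \<in> {y \<in> {0..4/3}. R_fun n y = t}. y < x} = {y \<in> {0..4/3}. R_fun n y = t \<and> y < x}" by auto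
  then show ?thesis
    using sorted_list_of_set_nth_card[OF finite_R_roots[of t], of x] assms by (simp add: phi_def)
qed

lemma R_X_continuous: "continuous_on S (\<lambda>a. R_fun n (X a))"
proof -
  have "continuous_on S X" unfolding X_def[abs_def] using Nr_pos by (intro continuous_intros) auto
  then show ?thesis by (rule continuous_on_compose2[OF R_continuous[of UNIV]]) auto
qed

text \<open>The first branch inverts \<open>R_fun n\<close> on angles up to \<open>pi / 2\<close>:
  monotonicity there leaves no smaller root to count.\<close>

lemma phi_1_X:
  assumes "0 \<le> a" "a \<le> pi / 2" shows "phi n 1 (R_fun n (X a)) = X a"
proof (rule phi_card)
  have "{y \<in> {0..4/3}. R_fun n y = R_fun n (X a) \<and> y < X a} = {}"
  proof safe
    fix y assume y: "y \<in> {0..4/3}" "R_fun n y = R_fun n (X a)" "y < X a"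
    then have "y < 2/3" using X_range[of a] by linarith
    then obtain b where b: "0 \<le> b" "b < Nr * pi / 2" "X b = y" using y X_surj[of y] by auto
    then have "b < a" using y X_less_iff[of b a] assms pi_half_lt by auto
    then show "y \<in> {}" using R_X_strict_mono[of b a] b y assms by auto
  qed
  then show "card {y \<in> {0..4/3}. R_fun n y = R_fun n (X a) \<and> y < X a} = 1 - 1" by (simp only: card.empty diff_self_eq_0)
qed (use X_range[of a] in auto)

lemma R_X_surj:
  assumes "0 \<le> t" "t \<le> 4/3" obtains a where "0 \<le> a" "a \<le> pi / 2" "R_fun n (X a) = t"
  using IVT'[of "\<lambda>a. R_fun n (X a)" 0 t "pi/2"] R_X_continuous assms by (auto simp: R_pi_half)

text \<open>\<open>R_fun n (X a) = X a * (2 * S * T)\<close> with \<open>S = sin a / sin p\<close>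
  and \<open>T = S - cos a / (2 * cos p)\<close>. As \<open>a\<close> tends to 0 these tend to
  \<open>Nr\<close> and \<open>Nr - 1/2\<close>, whose doubled product is \<open>rho n\<close>. So
  \<open>rho n\<close> is the slope of \<open>R_fun n\<close> at 0, and the two estimates control
  the deviation from it.\<close>

lemma rho_X_bounds:
  assumes "0 \<le> a" "a \<le> pi / 2"
  shows "R_fun n (X a) \<le> rho n * X a" "rho n * X a * (1 - a\<^sup>2 / 5)\<^sup>2 \<le> R_fun n (X a)"
proof -
  show "R_fun n (X a) \<le> rho n * X a" "rho n * X a * (1 - a\<^sup>2 / 5)\<^sup>2 \<le> R_fun n (X a)"
  proof (atomize (full), cases "a = 0")
    case False
    define p where "p = a / Nr"
    have a: "0 < a" "a < Nr * pi / 2" using assms False pi_half_lt by linarith+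
    have p: "0 < p" "p < pi/2" using half_angle[of a] a Nr_pos by (auto simp: p_def)
    have ap: "a = Nr * p" using Nr_pos by (simp add: p_def)
    have sp: "sin p > 0" using p by (intro sin_gt_zero) auto
    have cp: "cos p > 0" using p by (intro cos_gt_zero) auto
    define S where "S = sin a / sin p"
    define T where "T = S - cos a / (2 * cos p)"
    have R: "R_fun n (X a) = X a * (2 * S * T)"
    proof -
      have "X a * (2 * S * T) = 4/3 * (S * sin p) * (T * sin p)"
        by (simp add: X_def p_def[symmetric] power2_eq_square)
      moreover have "S * sin p = sin a" using sp by (simp add: S_def)
      moreover have "T * sin p = sin a - cos a * tan p / 2"
        unfolding T_def S_def left_diff_distrib using sp by (simp add: tan_def)
      ultimately show ?thesis unfolding R_X_raw[OF a] p_def[symmetric] by (simp add: algebra_simps)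
    qed
    \<comment> \<open>Telescoping over the odd multiples of \<open>p\<close>: each increment
      \<open>2 * cos (2 * q) + sin (2 * q) * tan p\<close> is at most 2, because
      \<open>cos q * tan p \<le> sin q\<close> for \<open>p \<le> q\<close>. For
      \<open>M = n - 1\<close> the odd multiple is \<open>Nr * p = a\<close>.\<close>
    have upT: "sin ((2 * real M + 1) * p) / sin p - cos ((2 * real M + 1) * p) / (2 * cos p) \<le> 2 * real M + 1/2"
      if "real M * p \<le> pi/2" for M
      using that
    proof (induction M)
      case 0
      then show ?case using sp cp by simp
    next
      case (Suc M)
      define q where "q = (real M + 1) * p"
      have q: "p \<le> q" "q \<le> pi/2" using Suc.prems p by (auto simp: q_def algebra_simps)
      have 1: "(2 * real (Suc M) + 1) * p = 2 * q + p" "(2 * real M + 1) * p = 2 * q - p"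
        by (simp_all add: q_def algebra_simps)
      have d: "sin (2*q+p) / sin p - cos (2*q+p) / (2 * cos p) - (sin (2*q-p) / sin p - cos (2*q-p) / (2 * cos p))
          = 2 * cos (2 * q) + sin (2 * q) * tan p"
      proof -
        have id: "sin (w+p) / sin p - cos (w+p) / (2 * cos p) - (sin (w-p) / sin p - cos (w-p) / (2 * cos p))
          = (sin (w+p) - sin (w-p)) / sin p + (cos (w-p) - cos (w+p)) / (2 * cos p)" for w
          by (simp add: diff_divide_distrib)
        show ?thesis unfolding id using sp cp
          by (simp add: sin_add sin_diff cos_add cos_diff tan_def)
      qed
      have "cos q * sin p \<le> sin q * cos p" using sin_ge_zero[of "q - p"] q p by (simp add: sin_diff)
      then have "cos q * tan p \<le> sin q" using cp by (simp add: tan_def field_simps)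
      then have "sin q * (cos q * tan p) \<le> sin q * sin q"
        using q p by (intro mult_left_mono sin_ge_zero) auto
      moreover have "0 \<le> sin q * sin q" by simp
      ultimately have "2 * sin q * cos q * tan p \<le> 4 * (sin q * sin q)"
        unfolding mult.assoc by linarith
      then have "2 * cos (2 * q) + sin (2 * q) * tan p \<le> 2"
        unfolding sin_double cos_double_sin by (simp add: power2_eq_square)
      moreover have "real M * p \<le> pi / 2" using Suc.prems p by (simp add: algebra_simps)
      ultimately show ?case using d Suc.IH unfolding 1 by simp
    qed
    have Nn: "2 * real (n - 1) + 1 = Nr" using n_ge by (simp add: Nr_def of_nat_diff)
    then have "real (n - 1) \<le> Nr / 2" by linarith
    then have "real (n - 1) * p \<le> Nr / 2 * p" using p by (intro mult_right_mono) auto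
    also have "\<dots> \<le> pi / 2" using assms ap p by simp
    finally have "real (n - 1) * p \<le> pi / 2" .
    from upT[OF this] have "T \<le> 2 * real (n - 1) + 1/2" unfolding T_def S_def Nn ap .
    then have T: "T \<le> Nr - 1/2" using Nn by linarith
    have upS: "\<bar>sin (real k * p)\<bar> \<le> real k * sin p" for k
    proof (induction k)
      case (Suc k)
      have "\<bar>sin (real (Suc k) * p)\<bar> = \<bar>sin (real k * p) * cos p + cos (real k * p) * sin p\<bar>"
        by (simp add: algebra_simps sin_add)
      also have "\<dots> \<le> \<bar>sin (real k * p)\<bar> * \<bar>cos p\<bar> + \<bar>cos (real k * p)\<bar> * \<bar>sin p\<bar>"
        by (metis abs_mult abs_triangle_ineq)
      also have "\<dots> \<le> \<bar>sin (real k * p)\<bar> * 1 + 1 * \<bar>sin p\<bar>"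
        by (intro add_mono mult_mono) auto
      finally show ?case using Suc sp by (simp add: algebra_simps)
    qed simp
    have "real (2 * n - 1) = Nr" using n_ge by (simp add: Nr_def of_nat_diff)
    then have "\<bar>sin a\<bar> \<le> Nr * sin p" using upS[of "2*n-1"] unfolding ap by simp
    then have S: "S \<le> Nr" using sp unfolding S_def by (simp add: field_simps)
    have S0: "0 \<le> S" unfolding S_def using sp assms by (intro divide_nonneg_pos sin_ge_zero) auto
    have T_lo: "(Nr - 1/2) * (1 - a\<^sup>2 / 5) \<le> T" and S_lo: "Nr * (1 - a\<^sup>2/6) \<le> S"
    proof -
      have "sin a \<ge> a * (1 - a\<^sup>2 / 6)" using sin_ge_cubic[of a] assms by (simp add: power3_eq_cube power2_eq_square algebra_simps)
      moreover have "a\<^sup>2 \<le> 2\<^sup>2" using assms pi_less_4 by (intro power_mono) auto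
      then have pos: "0 \<le> 1 - a\<^sup>2/6" by simp
      have "Nr * (1 - a\<^sup>2/6) * sin p \<le> Nr * (1 - a\<^sup>2/6) * p"
        using pos Nr_pos sin_x_le_x[of p] p by (intro mult_left_mono) auto
      moreover have "Nr * (1 - a\<^sup>2/6) * p = a * (1 - a\<^sup>2/6)" using ap by simp
      ultimately have "Nr * (1 - a\<^sup>2/6) * sin p \<le> sin a" by linarith
      then show S1: "Nr * (1 - a\<^sup>2/6) \<le> S" unfolding S_def using sp by (simp add: field_simps)
      have "cos a \<le> cos p" 
      proof (intro cos_monotone_0_pi_le)
        show "p \<le> a" using Nr_ge p mult_right_mono[of 1 Nr p] unfolding ap by simp
      qed (use p assms in auto)
      then have "cos a / (2 * cos p) \<le> 1/2" using cp by (simp add: field_simps)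
      then have "Nr * (1 - a\<^sup>2/6) - 1/2 \<le> T" using S1 unfolding T_def by linarith
      \<comment> \<open>Replacing 6 by 5 pays for the summand 1/2; for \<open>a \<noteq> 0\<close>
        this is possible precisely when \<open>Nr \<ge> 3\<close>.\<close>
      moreover have "Nr * (a\<^sup>2/6) \<le> (Nr - 1/2) * (a\<^sup>2/5)"
        using Nr_ge mult_right_mono[of "Nr / 6" "(Nr - 1/2) / 5" "a\<^sup>2"] by simp
      ultimately show "(Nr - 1/2) * (1 - a\<^sup>2 / 5) \<le> T"
        unfolding right_diff_distrib mult_1_right by linarith
    qed
    have a4: "a\<^sup>2 \<le> 4" using power_mono[of a 2 2] assms pi_less_4 by simp
    have T0: "0 \<le> T" by (rule order_trans[OF _ T_lo]) (use a4 Nr_ge in auto)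
    have "S * T \<le> Nr * (Nr - 1/2)" using S T S0 T0 Nr_ge by (intro mult_mono) auto
    then have u: "2 * S * T \<le> rho n" unfolding rho_Nr right_diff_distrib by simp
    have S_lo': "Nr * (1 - a\<^sup>2/5) \<le> S"
      by (rule order_trans[OF _ S_lo]) (use Nr_ge in auto)
    have "(Nr * (1 - a\<^sup>2/5)) * ((Nr - 1/2) * (1 - a\<^sup>2/5)) \<le> S * T" (is ?st)
      using S_lo' T_lo S0 a4 Nr_ge by (intro mult_mono) auto
    have l: "rho n * (1 - a\<^sup>2/5)\<^sup>2 \<le> 2 * S * T"
    proof -
      have "rho n * (1 - a\<^sup>2/5)\<^sup>2 = 2 * ((Nr * (1 - a\<^sup>2/5)) * ((Nr - 1/2) * (1 - a\<^sup>2/5)))"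
      proof -
        have "Nr * (2 * Nr - 1) * w\<^sup>2 = 2 * ((Nr * w) * ((Nr - 1/2) * w))" for w
          by (simp add: algebra_simps power2_eq_square)
        then show ?thesis unfolding rho_Nr .
      qed
      then show ?thesis using \<open>?st\<close> by linarith
    qed
    have X0: "0 \<le> X a" by (rule X_range)
    show "R_fun n (X a) \<le> rho n * X a \<and> rho n * X a * (1 - a\<^sup>2 / 5)\<^sup>2 \<le> R_fun n (X a)"
      unfolding R using mult_left_mono[OF u X0] mult_left_mono[OF l X0] by (simp add: mult_ac)
  qed simp
qed

end


section \<open>Position of the odd branches over 0 and 4/3\<close>

lemma card_interleaved:
  fixes p q :: "nat \<Rightarrow> real"
  assumes "\<And>i. i < k \<Longrightarrow> p i < q i" "\<And>i. i < k \<Longrightarrow> q i < p (Suc i)"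
  shows "card (p ` {..<k} \<union> q ` {..<k}) = 2 * k \<and> (\<forall>x\<in>p ` {..<k} \<union> q ` {..<k}. x < p k)"
  using assms
proof (induction k)
  case (Suc k)
  let ?A = "p ` {..<k} \<union> q ` {..<k}"
  have IH: "card ?A = 2 * k" "\<And>x. x \<in> ?A \<Longrightarrow> x < p k" using Suc by auto
  have pq: "p k < q k" "q k < p (Suc k)" using Suc by auto
  have "p ` {..<Suc k} \<union> q ` {..<Suc k} = insert (p k) (insert (q k) ?A)"
    by (auto simp: lessThan_Suc)
  moreover have "q k \<notin> ?A" "p k \<notin> insert (q k) ?A" using IH(2) pq by force+
  moreover have "finite ?A" by auto
  ultimately have "card (p ` {..<Suc k} \<union> q ` {..<Suc k}) = 2 * Suc k" using IH(1) by simp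
  moreover have "\<forall>x\<in>p ` {..<Suc k} \<union> q ` {..<Suc k}. x < p (Suc k)"
    unfolding \<open>p ` {..<Suc k} \<union> q ` {..<Suc k} = _\<close> using IH(2) pq by (force dest: IH(2))
  ultimately show ?case by simp
qed simp

lemma sin_eq_0_nonneg: "0 \<le> x \<Longrightarrow> sin x = 0 \<longleftrightarrow> (\<exists>i::nat. x = i * pi)"
proof
  assume "0 \<le> x" "sin x = 0"
  then obtain i :: int where i: "x = i * pi" by (auto simp: sin_zero_iff_int2)
  then have "i \<ge> 0" using \<open>0 \<le> x\<close> pi_gt_zero unfolding i zero_le_mult_iff by linarith
  then show "\<exists>i::nat. x = i * pi" using i by (intro exI[of _ "nat i"]) auto
qed auto

lemma cos_eq_0_nonneg: "0 \<le> x \<Longrightarrow> cos x = 0 \<longleftrightarrow> (\<exists>i::nat. x = pi / 2 + i * pi)"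
proof
  assume "0 \<le> x" "cos x = 0"
  then have "sin (x + pi / 2) = 0" by (simp add: sin_add)
  then obtain i :: nat where i: "x + pi / 2 = i * pi"
    using sin_eq_0_nonneg[of "x + pi/2"] \<open>0 \<le> x\<close> by auto
  then have "i \<noteq> 0" using \<open>0 \<le> x\<close> pi_gt_zero by (intro notI) simp
  then show "\<exists>i::nat. x = pi / 2 + i * pi"
    using i by (intro exI[of _ "i - 1"]) (auto simp: of_nat_diff algebra_simps)
next
  assume "\<exists>i::nat. x = pi / 2 + i * pi"
  then show "cos x = 0" by (auto simp: cos_add)
qed

context vicsek begin

lemma gam_continuous: "b < Nr * pi / 2 \<Longrightarrow> continuous_on {0..b} gam"
proof -
  assume b: "b < Nr * pi / 2"
  have "cos (x / Nr) \<noteq> 0" if "x \<in> {0..b}" for x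
    using cos_gt_zero_pi[of "x / Nr"] half_angle[of x] that b by force
  then show ?thesis unfolding gam_def[abs_def] delta_def[abs_def]
    using Nr_pos by (intro continuous_intros) auto
qed

text \<open>The inverse of \<open>gam\<close>, which is strictly increasing on the stated interval;
  the choice is unique as soon as it exists.\<close>

definition E :: "real \<Rightarrow> real" where
  "E c = (SOME a. 0 \<le> a \<and> a < Nr * pi / 2 \<and> gam a = c)"

text \<open>The bound \<open>a / 3 \<le> gam a\<close> gives \<open>gam (3 * c) \<ge> c\<close>, so
  the intermediate value theorem applies on \<open>[0, 3 * c]\<close>; hence the factor 3 in the
  hypothesis.\<close>

lemma E_props:
  assumes "0 \<le> c" "3 * c < Nr * pi / 2"
  shows "0 \<le> E c" "E c < Nr * pi / 2" "gam (E c) = c"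
proof -
  have "gam (3 * c) \<ge> c" using gam_bounds[of "3 * c"] assms by simp
  then obtain a where "0 \<le> a" "a \<le> 3 * c" "gam a = c"
    using IVT'[of gam 0 c "3 * c"] gam_continuous[of "3*c"] assms by auto
  then have "\<exists>a. 0 \<le> a \<and> a < Nr * pi / 2 \<and> gam a = c" using assms by (intro exI[of _ a]) auto
  from someI_ex[OF this] show "0 \<le> E c" "E c < Nr * pi / 2" "gam (E c) = c" by (auto simp: E_def)
qed

lemma gam_inj:
  assumes "0 \<le> a" "a < Nr * pi / 2" "0 \<le> b" "b < Nr * pi / 2" "gam a = gam b"
  shows "a = b"
  using gam_strict_mono(1)[of a b] gam_strict_mono(1)[of b a] assms by (cases a b rule: linorder_cases) auto

text \<open>Everything comes from the fixed point equation \<open>E c = c + delta (E c)\<close>: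
  here \<open>delta\<close> takes values in \<open>[0, pi / 2)\<close> and
  \<open>delta (E c) \<le> 2 / Nr * E c\<close>, with \<open>E c \<le> 3 * c\<close>.\<close>

lemma E_bounds:
  assumes "0 \<le> c" "3 * c < Nr * pi / 2"
  shows "c \<le> E c" "E c < c + pi / 2" "E c \<le> c + 6 * c / Nr" "0 < c \<Longrightarrow> c < E c"
proof -
  note e = E_props[OF assms]
  have ed: "E c = c + delta (E c)" using e(3) by (simp add: gam_def)
  show "c \<le> E c" "E c < c + pi / 2" using delta_bounds[OF e(1,2)] ed by linarith+
  have c0: "E c > 0" if "0 < c"
    using e(3) that by (cases "E c = 0") (use e(1) in auto)
  show "0 < c \<Longrightarrow> c < E c" using delta_pos[OF c0 e(2)] ed by auto
  have "E c / 3 \<le> c" using gam_bounds[OF e(1,2)] e(3) by simp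
  then have "2 / Nr * E c \<le> 2 / Nr * (3 * c)" using Nr_pos by (intro mult_left_mono) auto
  moreover have "delta (E c) \<le> 2 / Nr * E c"
    using delta_lipschitz(2)[of 0 "E c"] e(1,2) by (cases "E c = 0") auto
  ultimately have "delta (E c) \<le> 6 * c / Nr" by simp
  then show "E c \<le> c + 6 * c / Nr" using ed by linarith
qed

lemma E_0: "E 0 = 0"
  using E_props[of 0] gam_inj[of "E 0" 0] Nr_pos by simp

lemma R_X_zero_iff:
  assumes "0 \<le> a" "a < Nr * pi / 2"
  shows "R_fun n (X a) = 0 \<longleftrightarrow> (\<exists>i::nat. a = i * pi) \<or> (\<exists>i::nat. gam a = i * pi)"
proof -
  have "0 \<le> gam a" using gam_bounds[OF assms] assms by auto
  then show ?thesis
    using R_X(1)[OF assms] delta_bounds[OF assms] sin_eq_0_nonneg[of a] sin_eq_0_nonneg[of "gam a"] assms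
    by auto
qed

lemma R_X_43_iff:
  assumes "0 \<le> a" "a < Nr * pi / 2"
  shows "R_fun n (X a) = 4/3 \<longleftrightarrow> (\<exists>i::nat. a = pi / 2 + i * pi) \<or> (\<exists>i::nat. gam a = pi / 2 + i * pi)"
proof -
  have g: "0 \<le> gam a" using gam_bounds[OF assms] assms by auto
  have "R_fun n (X a) = 4/3 \<longleftrightarrow> 4/3 * cos a * cos (gam a) / cos (delta a) = 0"
    using R_X(2)[OF assms] by linarith
  also have "\<dots> \<longleftrightarrow> cos a = 0 \<or> cos (gam a) = 0" using delta_bounds[OF assms] by auto
  finally show ?thesis
    using cos_eq_0_nonneg[of a] cos_eq_0_nonneg[of "gam a"] assms g by auto
qed

text \<open>Branch \<open>2 * k + 1\<close> is the root with exactly \<open>2 * k\<close> roots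
  below it. The family \<open>p\<close> contains the root looked for, and \<open>q\<close> is the
  family interleaved with it. Completeness of the list is asked for below \<open>p k\<close> alone,
  so the higher roots are never located.\<close>

lemma phi_odd_aux:
  fixes p q :: "nat \<Rightarrow> real"
  assumes "\<And>i. i < k \<Longrightarrow> p i < q i" "\<And>i. i < k \<Longrightarrow> q i < p (Suc i)"
    and p: "\<And>i. i \<le> k \<Longrightarrow> 0 \<le> p i \<and> p i < Nr * pi / 2 \<and> R_fun n (X (p i)) = t"
    and q: "\<And>i. i < k \<Longrightarrow> R_fun n (X (q i)) = t"
    and c: "\<And>a. 0 \<le> a \<Longrightarrow> a < p k \<Longrightarrow> R_fun n (X a) = t \<Longrightarrow> \<exists>i<k. a = p i \<or> a = q i"
  shows "phi n (2 * k + 1) t = X (p k)"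
proof (rule phi_card)
  let ?A = "p ` {..<k} \<union> q ` {..<k}"
  note A = card_interleaved[of k p q, OF assms(1,2)]
  have pk: "0 \<le> p k" "p k < Nr * pi / 2" using p[of k] by auto
  have A0: "0 \<le> a" if "a \<in> ?A" for a
  proof -
    obtain i where i: "i < k" "a = p i \<or> a = q i" using \<open>a \<in> ?A\<close> by auto
    then show ?thesis using p[of i] assms(1)[OF i(1)] by auto
  qed
  have "{y \<in> {0..4/3}. R_fun n y = t \<and> y < X (p k)} = X ` ?A"
  proof (intro set_eqI iffI)
    fix y assume y: "y \<in> {y \<in> {0..4/3}. R_fun n y = t \<and> y < X (p k)}"
    then have "y < 2/3" using X_range[of "p k"] by auto
    then obtain a where a: "0 \<le> a" "a < Nr * pi / 2" "X a = y" using y X_surj[of y] by auto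
    have "a < p k" using X_less_iff[of a "p k"] a pk y by auto
    then show "y \<in> X ` ?A" using c[of a] a y by auto
  next
    fix y assume "y \<in> X ` ?A"
    then obtain a where a: "a \<in> ?A" "y = X a" by auto
    have "a < p k" using A a by blast
    moreover have "R_fun n (X a) = t" using a p q by auto
    ultimately show "y \<in> {y \<in> {0..4/3}. R_fun n y = t \<and> y < X (p k)}"
      using a A0[of a] X_strict_mono[of a "p k"] pk X_range[of a] by auto
  qed
  moreover have "inj_on X ?A"
  proof (rule inj_onI)
    fix a b assume ab: "a \<in> ?A" "b \<in> ?A" "X a = X b"
    then have "a < p k" "b < p k" "0 \<le> a" "0 \<le> b" using A A0 by blast+
    then show "a = b" using X_less_iff[of a b] X_less_iff[of b a] pk ab by auto
  qed
  ultimately show "card {y \<in> {0..4/3}. R_fun n y = t \<and> y < X (p k)} = 2 * k + 1 - 1"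
    using A by (simp add: card_image)
  show "X (p k) \<le> 4/3" using X_range[of "p k"] by simp
qed (use p X_range in auto)

text \<open>The roots in increasing order have the angles \<open>E 0 = 0\<close>, \<open>pi\<close>,
  \<open>E pi\<close>, \<open>2 * pi\<close>, \<open>E (2 * pi)\<close> and so on: \<open>E\<close>
  raises an angle by less than \<open>pi / 2\<close>, so the family with
  \<open>sin (gam a) = 0\<close> takes the odd places.\<close>

lemma phi_odd_0:
  assumes "6 * real k < Nr" shows "phi n (2 * k + 1) 0 = X (E (real k * pi))"
proof (rule phi_odd_aux[where q = "\<lambda>i. real (Suc i) * pi"])
  have E: "0 \<le> real i * pi" "3 * (real i * pi) < Nr * pi / 2" if "i \<le> k" for i
  proof -
    have "6 * real i < Nr" using that assms by (auto simp: order_le_less_trans[of "6 * real i" "6 * real k"])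
    then show "3 * (real i * pi) < Nr * pi / 2" using mult_strict_right_mono[of "6 * real i" Nr pi] by simp
  qed simp
  show "E (real i * pi) < real (Suc i) * pi" if "i < k" for i
    using E_bounds(2)[OF E[of i]] that pi_gt_zero unfolding of_nat_Suc distrib_right by linarith
  show "real (Suc i) * pi < E (real (Suc i) * pi)" if "i < k" for i
    using E_bounds(4)[OF E[of "Suc i"]] that by simp
  show "0 \<le> E (real i * pi) \<and> E (real i * pi) < Nr * pi / 2 \<and> R_fun n (X (E (real i * pi))) = 0"
    if "i \<le> k" for i using E_props[OF E[OF that]] R_X_zero_iff by auto
  show "R_fun n (X (real (Suc i) * pi)) = 0" if "i < k" for i
  proof -
    have "real (Suc i) * pi < Nr * pi / 2"
      using E(2)[of "Suc i"] that by (smt (verit) E(1) less_eq_Suc_le)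
    then show ?thesis by (subst R_X_zero_iff) (auto simp del: of_nat_Suc)
  qed
  fix a assume a: "0 \<le> a" "a < E (real k * pi)" "R_fun n (X a) = 0"
  have a': "a < Nr * pi / 2" using a E_props[OF E[of k]] by auto
  consider i :: nat where "a = i * pi" | i :: nat where "gam a = i * pi"
    using R_X_zero_iff[OF a(1) a'] a(3) by auto
  then show "\<exists>i<k. a = E (real i * pi) \<or> a = real (Suc i) * pi"
  proof cases
    case (1 i)
    have "real i * pi < (real k + 1) * pi" using 1 a E_bounds(2)[OF E[of k]] pi_gt_zero unfolding distrib_right by linarith
    then have i: "i \<le> k" by (simp add: mult_less_cancel_right_pos)
    show ?thesis
    proof (cases i)
      \<comment> \<open>The angle 0 belongs to both families of zeros; it is listed as
        \<open>E 0\<close>, since \<open>q\<close> starts at \<open>pi\<close>.\<close>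
      case 0
      then have "k \<noteq> 0" using a 1 E_0 by (intro notI) auto
      then show ?thesis using 0 1 E_0 by (intro exI[of _ 0]) auto
    next
      case (Suc j)
      then show ?thesis using i 1 by (intro exI[of _ j]) auto
    qed
  next
    case (2 i)
    have "gam a < gam (E (real k * pi))" using gam_strict_mono(1)[OF a(1,2)] E_props[OF E[of k]] by auto
    then have "real i * pi < real k * pi" using 2 E_props(3)[OF E[of k]] by simp
    then have "i < k" by (simp add: mult_less_cancel_right_pos)
    moreover have "a = E (real i * pi)"
      using gam_inj[of a "E (real i * pi)"] a(1) a' 2 E_props[OF E[of i]] \<open>i < k\<close> by auto
    ultimately show ?thesis by auto
  qed
qed

text \<open>Over 4/3 the smallest root has the angle \<open>pi / 2\<close>, and each
  \<open>pi / 2 + i * pi\<close> precedes its image under \<open>E\<close>. So here the unshifted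
  family takes the odd places and the angles are explicit.\<close>

lemma phi_odd_43:
  assumes "6 * real k + 3 < Nr" shows "phi n (2 * k + 1) (4/3) = X (pi / 2 + real k * pi)"
proof (rule phi_odd_aux[where q = "\<lambda>i. E (pi / 2 + real i * pi)"])
  have E: "0 \<le> pi / 2 + real i * pi" "3 * (pi / 2 + real i * pi) < Nr * pi / 2" if "i \<le> k" for i
  proof -
    have "6 * real i \<le> 6 * real k" using that by simp
    then have "6 * real i + 3 < Nr" using assms by linarith
    then show "3 * (pi / 2 + real i * pi) < Nr * pi / 2"
      using mult_strict_right_mono[of "6 * real i + 3" Nr pi] by (simp add: algebra_simps)
  qed simp
  show "pi / 2 + real i * pi < E (pi / 2 + real i * pi)" if "i < k" for i
    using E_bounds(4)[OF E[of i]] that by (simp add: add_pos_nonneg)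
  show "E (pi / 2 + real i * pi) < pi / 2 + real (Suc i) * pi" if "i < k" for i
    using E_bounds(2)[OF E[of i]] that pi_gt_zero unfolding of_nat_Suc distrib_right by linarith
  have lt: "pi / 2 + real i * pi < Nr * pi / 2" if "i \<le> k" for i
  proof -
    have "c < B" if "0 \<le> c" "3 * c < B" for c B :: real using that by linarith
    from this[OF E[OF that]] show ?thesis .
  qed
  show "0 \<le> pi / 2 + real i * pi \<and> pi / 2 + real i * pi < Nr * pi / 2 \<and> R_fun n (X (pi / 2 + real i * pi)) = 4/3"
    if "i \<le> k" for i using lt[OF that] E[OF that] R_X_43_iff[of "pi / 2 + real i * pi"] by auto
  show "R_fun n (X (E (pi / 2 + real i * pi))) = 4/3" if "i < k" for i
    using E_props[OF E[of i]] R_X_43_iff[of "E (pi / 2 + real i * pi)"] that by auto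
  fix a assume a: "0 \<le> a" "a < pi / 2 + real k * pi" "R_fun n (X a) = 4/3"
  have a': "a < Nr * pi / 2" using a lt[of k] by auto
  consider i :: nat where "a = pi / 2 + i * pi" | i :: nat where "gam a = pi / 2 + i * pi"
    using R_X_43_iff[OF a(1) a'] a(3) by auto
  then show "\<exists>i<k. a = pi / 2 + real i * pi \<or> a = E (pi / 2 + real i * pi)"
  proof cases
    case (1 i)
    then have "real i * pi < real k * pi" using a by simp
    then show ?thesis using 1 by (auto simp: mult_less_cancel_right_pos)
  next
    case (2 i)
    then have "real i * pi < real k * pi" using a gam_bounds(2)[OF a(1) a'] by linarith
    then have "i < k" by (simp add: mult_less_cancel_right_pos)
    moreover have "a = E (pi / 2 + real i * pi)"
      using gam_inj[of a "E (pi / 2 + real i * pi)"] a(1) a' 2 E_props[OF E[of i]] \<open>i < k\<close> by auto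
    ultimately show ?thesis by auto
  qed
qed

text \<open>Turns bounds in the angle into bounds in the value \<open>R_fun n (X a)\<close>, the
  quantity that is iterated. From \<open>a \<le> 1.6\<close> and \<open>Nr \<ge> 3\<close> come
  \<open>X a \<ge> 3/5 * (a / Nr)\<^sup>2\<close> and \<open>rho n \<ge> 5/3 * Nr\<^sup>2\<close>,
  whose product is \<open>a\<^sup>2\<close>, and the last factor
  \<open>(1 - a\<^sup>2 / 5)\<^sup>2 \<ge> 1/5\<close>.\<close>

lemma R_X_lower:
  assumes "0 \<le> a" "a \<le> pi / 2" shows "a\<^sup>2 \<le> 5 * R_fun n (X a)"
proof -
  define p where "p = a / Nr"
  have a16: "a \<le> 1.6" using assms pi_approx by simp
  have a2: "a\<^sup>2 \<le> 1.6\<^sup>2" using assms a16 by (intro power_mono)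
  have p0: "0 \<le> p" using assms Nr_pos by (simp add: p_def)
  have "a * 3 \<le> 1.6 * Nr" using a16 Nr_ge assms by (intro mult_mono) auto
  then have p1: "p \<le> 0.54" unfolding p_def using Nr_pos by (simp add: field_simps)
  have "p\<^sup>2 \<le> 0.54\<^sup>2" using p0 p1 by (intro power_mono)
  then have "0.95 * p \<le> (1 - p\<^sup>2 / 6) * p" using p0 by (intro mult_right_mono) (auto simp: power2_eq_square)
  also have "\<dots> \<le> sin p" using sin_ge_cubic[OF p0] by (simp add: power3_eq_cube power2_eq_square algebra_simps)
  finally have "(0.95 * p)\<^sup>2 \<le> (sin p)\<^sup>2" using p0 by (intro power_mono) auto
  then have "361/400 * p\<^sup>2 \<le> (sin p)\<^sup>2" by (simp add: power_mult_distrib power2_eq_square)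
  moreover have "0 \<le> p\<^sup>2" by simp
  ultimately have X: "3/5 * p\<^sup>2 \<le> X a" unfolding X_def p_def[symmetric] by linarith
  have "5/3 * Nr * Nr \<le> (2 * Nr - 1) * Nr" using Nr_ge by (intro mult_right_mono) auto
  then have rho: "5/3 * Nr\<^sup>2 \<le> rho n" by (simp add: rho_Nr power2_eq_square mult_ac)
  have "a\<^sup>2 = Nr\<^sup>2 * p\<^sup>2" unfolding p_def using Nr_pos by (simp add: power_divide)
  then have "a\<^sup>2 = (5/3 * Nr\<^sup>2) * (3/5 * p\<^sup>2)" by simp
  also have "\<dots> \<le> rho n * X a" using rho X rho_ge by (intro mult_mono) auto
  finally have rX: "a\<^sup>2 \<le> rho n * X a" .
  have "0.48\<^sup>2 \<le> (1 - a\<^sup>2 / 5)\<^sup>2" using a2 by (intro power_mono) (auto simp: power2_eq_square)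
  then have "(1/5) \<le> (1 - a\<^sup>2 / 5)\<^sup>2" by (simp add: power2_eq_square)
  then have "a\<^sup>2 * (1/5) \<le> rho n * X a * (1 - a\<^sup>2 / 5)\<^sup>2" using rX X_range[of a] rho_ge by (intro mult_mono) auto
  then show ?thesis using rho_X_bounds(2)[OF assms] by linarith
qed

lemma rho_X_upper:
  assumes "0 \<le> a" "a \<le> pi / 2"
  shows "rho n * X a * (1 - 2 * R_fun n (X a)) \<le> R_fun n (X a)"
proof -
  have "1 - 2 * R_fun n (X a) \<le> 1 - 2 * a\<^sup>2 / 5" using R_X_lower[OF assms] by simp
  also have "\<dots> \<le> (1 - a\<^sup>2 / 5)\<^sup>2"
  proof -
    have "1 - 2 * w \<le> (1 - w)\<^sup>2" for w :: real by (simp add: power2_eq_square algebra_simps)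
    from this[of "a\<^sup>2 / 5"] show ?thesis by simp
  qed
  finally have "rho n * X a * (1 - 2 * R_fun n (X a)) \<le> rho n * X a * (1 - a\<^sup>2 / 5)\<^sup>2"
    using X_range[of a] rho_ge by (intro mult_left_mono) auto
  then show ?thesis using rho_X_bounds(2)[OF assms] by linarith
qed

lemma phi_1_props:
  assumes "0 \<le> t" "t \<le> 4/3"
  obtains a where "0 \<le> a" "a \<le> pi / 2" "phi n 1 t = X a" "R_fun n (X a) = t" "a\<^sup>2 \<le> 5 * t"
  using R_X_surj[OF assms] phi_1_X R_X_lower by metis

text \<open>Step \<open>j\<close> loses a factor \<open>1 - 2 * s\<close> with
  \<open>s \<le> t / 3 ^ j\<close>. The sum of \<open>2 / 3 ^ j\<close> over \<open>j < m\<close> is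
  \<open>3 * (1 - 1 / 3 ^ m)\<close>, which explains the constant 3 in the last bound.\<close>

lemma phi_1_iterate:
  assumes "0 \<le> t" "t \<le> 1/4"
  shows "0 \<le> (phi n 1 ^^ m) t" "(phi n 1 ^^ m) t \<le> t / 3 ^ m"
    "rho n ^ m * (phi n 1 ^^ m) t \<le> rho n ^ Suc m * (phi n 1 ^^ Suc m) t"
    "rho n ^ m * (phi n 1 ^^ m) t * (1 - 3 * t * (1 - 1 / 3 ^ m)) \<le> t"
proof -
  let ?t = "\<lambda>m. (phi n 1 ^^ m) t"
  have step: "0 \<le> phi n 1 s" "phi n 1 s \<le> s / 3" "s \<le> rho n * phi n 1 s" "rho n * phi n 1 s * (1 - 2 * s) \<le> s"
    if s: "0 \<le> s" "s \<le> 1/4" for s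
  proof -
    obtain a where a: "0 \<le> a" "a \<le> pi / 2" "phi n 1 s = X a" "R_fun n (X a) = s"
      using phi_1_props[of s] s by auto
    show "0 \<le> phi n 1 s" using X_range a by simp
    show "s \<le> rho n * phi n 1 s" using rho_X_bounds(1)[OF a(1,2)] a by simp
    show u: "rho n * phi n 1 s * (1 - 2 * s) \<le> s" using rho_X_upper[OF a(1,2)] a by simp
    have "15 * phi n 1 s * (1/2) \<le> rho n * phi n 1 s * (1 - 2 * s)"
      using rho_ge s \<open>0 \<le> phi n 1 s\<close> by (intro mult_mono) auto
    then show "phi n 1 s \<le> s / 3" using u \<open>0 \<le> phi n 1 s\<close> by linarith
  qed
  have *: "0 \<le> ?t m \<and> ?t m \<le> t / 3 ^ m" for m
  proof (induction m)
    case (Suc m)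
    have "t * 1 \<le> t * 3 ^ m" using assms by (intro mult_left_mono) auto
    then have "t / 3 ^ m \<le> t" by (simp add: divide_le_eq)
    then have "?t m \<le> 1/4" using Suc assms by linarith
    then show ?case using step[of "?t m"] Suc by simp
  qed (use assms in auto)
  have t4: "?t m \<le> 1/4" for m
  proof -
    have "t * 1 \<le> t * 3 ^ m" using assms by (intro mult_left_mono) auto
    then have "t / 3 ^ m \<le> t" by (simp add: divide_le_eq)
    then show ?thesis using *[of m] assms by linarith
  qed
  show "0 \<le> ?t m" "?t m \<le> t / 3 ^ m" using * by auto
  have r0: "0 \<le> rho n ^ m" for m using rho_ge by simp
  show "rho n ^ m * ?t m \<le> rho n ^ Suc m * ?t (Suc m)"
    using mult_left_mono[OF step(3)[of "?t m"] r0[of m]] * t4 by (simp add: mult_ac)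
  show "rho n ^ m * ?t m * (1 - 3 * t * (1 - 1 / 3 ^ m)) \<le> t"
  proof (induction m)
    case (Suc m)
    define e :: real where "e = 1 / 3 ^ m"
    have e: "0 \<le> e" "e \<le> 1" by (auto simp: e_def)
    have f0: "0 \<le> 1 - 3 * t * (1 - e)"
      using mult_mono[of "3 * t" "3/4" "1 - e" 1] assms e by simp
    \<comment> \<open>The product of the accumulated and the new loss factor exceeds the next bound
      by a nonnegative cross term.\<close>
    have "(1 - 2 * (t * e)) * (1 - 3 * t * (1 - e)) = 1 - 3 * t * (1 - e / 3) + 6 * (t * t) * (e * (1 - e))"
      by (simp add: algebra_simps)
    moreover have "0 \<le> 6 * (t * t) * (e * (1 - e))" using e by simp
    ultimately have "1 - 3 * t * (1 - e / 3) \<le> (1 - 2 * (t * e)) * (1 - 3 * t * (1 - e))" by linarith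
    also have "\<dots> \<le> (1 - 2 * ?t m) * (1 - 3 * t * (1 - e))"
      using f0 *[of m] by (intro mult_right_mono) (auto simp: e_def)
    finally have "rho n ^ Suc m * ?t (Suc m) * (1 - 3 * t * (1 - e / 3))
       \<le> rho n ^ Suc m * ?t (Suc m) * ((1 - 2 * ?t m) * (1 - 3 * t * (1 - e)))"
      using *[of "Suc m"] r0[of "Suc m"] by (intro mult_left_mono mult_nonneg_nonneg) auto
    also have "\<dots> = rho n ^ m * (rho n * phi n 1 (?t m) * (1 - 2 * ?t m)) * (1 - 3 * t * (1 - e))"
      by simp
    also have "\<dots> \<le> rho n ^ m * ?t m * (1 - 3 * t * (1 - e))"
      using step(4)[of "?t m"] *[of m] t4 r0 f0 by (intro mult_right_mono mult_left_mono) auto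
    also have "\<dots> \<le> t" using Suc by (simp add: e_def)
    finally show ?case by (simp add: e_def mult.commute)
  qed simp
qed

text \<open>The rescaled iterates increase, and \<open>1 - 3 * t \<ge> 1/4\<close> bounds them by
  \<open>4 * t\<close>, so the \<open>lim\<close> in \<open>psi\<close> exists and inherits the
  bounds.\<close>

lemma psi_props:
  assumes "0 \<le> t" "t \<le> 1/4"
  shows "(\<lambda>m. rho n ^ m * (phi n 1 ^^ m) t) \<longlonglongrightarrow> psi n t"
    "t \<le> psi n t" "psi n t * (1 - 3 * t) \<le> t" "rho n ^ m * (phi n 1 ^^ m) t \<le> 4 * t"
proof -
  let ?s = "\<lambda>m. rho n ^ m * (phi n 1 ^^ m) t"
  note it = phi_1_iterate[OF assms]
  have s0: "0 \<le> ?s m" for m using it(1)[of m] rho_ge by simp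
  have b: "?s m * (1 - 3 * t) \<le> t" for m
  proof -
    have "?s m * (1 - 3 * t) \<le> ?s m * (1 - 3 * t * (1 - 1 / 3 ^ m))"
      using s0[of m] assms by (intro mult_left_mono) (auto simp: mult_left_le)
    then show ?thesis using it(4)[of m] by linarith
  qed
  have b4: "?s m \<le> 4 * t" for m
    using b[of m] mult_left_mono[of "1/4" "1 - 3 * t" "?s m"] s0[of m] assms by simp
  then show "?s m \<le> 4 * t" .
  have inc: "incseq ?s" by (rule incseq_SucI) (rule it(3))
  have "convergent ?s"
    by (rule Bseq_monoseq_convergent)
       (use inc b4 s0 in \<open>auto simp: monoseq_iff intro!: BseqI'[of _ "4 * t"]\<close>)
  then show lim: "?s \<longlonglongrightarrow> psi n t" unfolding psi_def by (simp add: convergent_LIMSEQ_iff)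
  show "t \<le> psi n t" using incseq_le[OF inc lim, of 0] by simp
  show "psi n t * (1 - 3 * t) \<le> t"
    by (rule LIMSEQ_le_const2[OF tendsto_mult_right[OF lim]]) (use b in auto)
qed

end

text \<open>The origin of the factor 4/3:
  \<open>rho n * X a = 2/3 * (2 - 1 / N) * (N * sin (a / N))\<^sup>2\<close> for
  \<open>N = 2 * n - 1\<close>. The angle may depend on \<open>n\<close>, as \<open>E c\<close>
  does.\<close>

lemma rho_psi_X_limit:
  assumes a: "a \<longlonglongrightarrow> c" and a0: "\<forall>\<^sub>F n in sequentially. 0 \<le> a n"
  shows "(\<lambda>n. rho n * psi n (vicsek.X n (a n))) \<longlonglongrightarrow> 4/3 * c\<^sup>2"
    "(\<lambda>n. vicsek.X n (a n)) \<longlonglongrightarrow> 0"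
proof -
  let ?N = "\<lambda>n::nat. 2 * real n - 1"
  have ev2: "\<forall>\<^sub>F n in sequentially. n \<ge> 2" by (rule eventually_ge_at_top)
  have Ni: "(\<lambda>n. 1 / ?N n) \<longlonglongrightarrow> 0" by real_asymp
  have N: "vicsek.Nr n = ?N n" if "n \<ge> 2" for n using that by (simp add: vicsek.Nr_def vicsek_def)
  have s: "(\<lambda>n. ?N n * sin (a n / ?N n)) \<longlonglongrightarrow> c"
  proof (rule tendsto_sandwich)
    have "(\<lambda>n. a n - (a n) ^ 3 / 6 * (1 / ?N n) * (1 / ?N n)) \<longlonglongrightarrow> c - c ^ 3 / 6 * 0 * 0"
      by (intro tendsto_intros a Ni) auto
    then show "(\<lambda>n. a n - (a n) ^ 3 / 6 * (1 / ?N n) * (1 / ?N n)) \<longlonglongrightarrow> c" by simp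
    show "\<forall>\<^sub>F n in sequentially. a n - (a n) ^ 3 / 6 * (1 / ?N n) * (1 / ?N n) \<le> ?N n * sin (a n / ?N n)"
      using a0 ev2
    proof eventually_elim
      case (elim n)
      then have N0: "?N n > 0" by simp
      have "?N n * (a n / ?N n - (a n / ?N n) ^ 3 / 6) \<le> ?N n * sin (a n / ?N n)"
        using sin_ge_cubic[of "a n / ?N n"] elim N0 by (intro mult_left_mono) auto
      moreover have "N * (x / N - (x / N) ^ 3 / 6) = x - x ^ 3 / 6 * (1 / N) * (1 / N)" if "N > 0" for N x :: real
        using that by (simp add: power3_eq_cube field_simps)
      note this[OF N0, of "a n"]
      ultimately show ?case by simp
    qed
    show "\<forall>\<^sub>F n in sequentially. ?N n * sin (a n / ?N n) \<le> a n"
      using a0 ev2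
    proof eventually_elim
      case (elim n)
      then have N0: "?N n > 0" by simp
      then have "?N n * sin (a n / ?N n) \<le> ?N n * (a n / ?N n)"
        using elim by (intro mult_left_mono sin_x_le_x) auto
      then show ?case using N0 by simp
    qed
  qed (rule a)
  have r: "(\<lambda>n. rho n * vicsek.X n (a n)) \<longlonglongrightarrow> 4/3 * c\<^sup>2"
  proof (rule Lim_transform_eventually)
    have "(\<lambda>n. 2/3 * (2 - 1 / ?N n) * (?N n * sin (a n / ?N n))\<^sup>2) \<longlonglongrightarrow> 2/3 * (2 - 0) * c\<^sup>2"
      by (intro tendsto_intros s Ni)
    then show "(\<lambda>n. 2/3 * (2 - 1 / ?N n) * (?N n * sin (a n / ?N n))\<^sup>2) \<longlonglongrightarrow> 4/3 * c\<^sup>2" by simp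
    show "\<forall>\<^sub>F n in sequentially. 2/3 * (2 - 1 / ?N n) * (?N n * sin (a n / ?N n))\<^sup>2 = rho n * vicsek.X n (a n)"
      using ev2
    proof eventually_elim
      case (elim n)
      then interpret vicsek n by unfold_locales
      have "2/3 * (2 - 1 / Nr) * (Nr * w)\<^sup>2 = Nr * (2 * Nr - 1) * (2/3 * w\<^sup>2)" for w
        using Nr_pos by (simp add: power2_eq_square field_simps)
      then show ?case using elim by (simp add: rho_Nr X_def flip: N)
    qed
  qed
  have x: "(\<lambda>n. vicsek.X n (a n)) \<longlonglongrightarrow> 0"
  proof (rule Lim_transform_eventually)
    have "(\<lambda>n. 1 / rho n) \<longlonglongrightarrow> 0" unfolding rho_def by real_asymp
    from tendsto_mult[OF r this] show "(\<lambda>n. rho n * vicsek.X n (a n) * (1 / rho n)) \<longlonglongrightarrow> 0" by simp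
    show "\<forall>\<^sub>F n in sequentially. rho n * vicsek.X n (a n) * (1 / rho n) = vicsek.X n (a n)"
      using ev2
    proof eventually_elim
      case (elim n)
      then interpret vicsek n by unfold_locales
      show ?case using rho_ge by simp
    qed
  qed
  then show "(\<lambda>n. vicsek.X n (a n)) \<longlonglongrightarrow> 0" .
  have ev4: "\<forall>\<^sub>F n in sequentially. vicsek.X n (a n) < 1/4"
    using order_tendstoD(2)[OF x, of "1/4"] by simp
  show "(\<lambda>n. rho n * psi n (vicsek.X n (a n))) \<longlonglongrightarrow> 4/3 * c\<^sup>2"
  proof (rule tendsto_sandwich)
    show "\<forall>\<^sub>F n in sequentially. rho n * vicsek.X n (a n) \<le> rho n * psi n (vicsek.X n (a n))"
      using ev4 ev2
    proof eventually_elim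
      case (elim n)
      then interpret vicsek n by unfold_locales
      show ?case using elim rho_ge psi_props(2)[of "X (a n)"] X_range[of "a n"] by (intro mult_left_mono) auto
    qed
    show "\<forall>\<^sub>F n in sequentially. rho n * psi n (vicsek.X n (a n)) \<le> rho n * vicsek.X n (a n) / (1 - 3 * vicsek.X n (a n))"
      using ev4 ev2
    proof eventually_elim
      case (elim n)
      then interpret vicsek n by unfold_locales
      have "psi n (X (a n)) \<le> X (a n) / (1 - 3 * X (a n))"
        using elim psi_props(3)[of "X (a n)"] X_range[of "a n"] by (simp add: pos_le_divide_eq)
      then have "rho n * psi n (X (a n)) \<le> rho n * (X (a n) / (1 - 3 * X (a n)))"
        using rho_ge by (intro mult_left_mono) auto
      then show ?case by simp
    qed
    have "(\<lambda>n. rho n * vicsek.X n (a n) / (1 - 3 * vicsek.X n (a n))) \<longlonglongrightarrow> (4/3 * c\<^sup>2) / (1 - 3 * 0)"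
      by (intro tendsto_intros r x) auto
    then show "(\<lambda>n. rho n * vicsek.X n (a n) / (1 - 3 * vicsek.X n (a n))) \<longlonglongrightarrow> 4/3 * c\<^sup>2" by simp
  qed (rule r)
qed

lemma E_limit:
  assumes "0 \<le> c" shows "(\<lambda>n. vicsek.E n c) \<longlonglongrightarrow> c" "\<forall>\<^sub>F n in sequentially. 0 \<le> vicsek.E n c"
proof -
  have ev: "\<forall>\<^sub>F n in sequentially. n \<ge> 2 \<and> 3 * c < (2 * real n - 1) * pi / 2"
  proof (rule eventually_conj)
    have "filterlim (\<lambda>n::nat. (2 * real n - 1) * pi / 2) at_top sequentially" by real_asymp
    then show "\<forall>\<^sub>F n in sequentially. 3 * c < (2 * real n - 1) * pi / 2"
      unfolding filterlim_at_top_dense by blast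
  qed (rule eventually_ge_at_top)
  show "(\<lambda>n. vicsek.E n c) \<longlonglongrightarrow> c"
  proof (rule tendsto_sandwich)
    show "\<forall>\<^sub>F n in sequentially. c \<le> vicsek.E n c" using ev
    proof eventually_elim
      case (elim n)
      then interpret vicsek n by unfold_locales auto
      show ?case using E_bounds(1)[of c] assms elim by (simp add: Nr_def)
    qed
    show "\<forall>\<^sub>F n in sequentially. vicsek.E n c \<le> c + 6 * c / (2 * real n - 1)" using ev
    proof eventually_elim
      case (elim n)
      then interpret vicsek n by unfold_locales auto
      show ?case using E_bounds(3)[of c] assms elim by (simp add: Nr_def)
    qed
    have "(\<lambda>n. 1 / (2 * real n - 1)) \<longlonglongrightarrow> 0" by real_asymp
    then have "(\<lambda>n. c + 6 * c * (1 / (2 * real n - 1))) \<longlonglongrightarrow> c + 6 * c * 0" by (intro tendsto_intros)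
    then show "(\<lambda>n. c + 6 * c / (2 * real n - 1)) \<longlonglongrightarrow> c" by simp
  qed simp
  show "\<forall>\<^sub>F n in sequentially. 0 \<le> vicsek.E n c" using ev
  proof eventually_elim
    case (elim n)
    then interpret vicsek n by unfold_locales auto
    show ?case using E_props(1)[of c] assms elim by (simp add: Nr_def)
  qed
qed

section \<open>Cells and vertices on the integer grid\<close>

text \<open>A cell is coded by its lower left corner in units of the side length of its level, so
  that incidence becomes integer arithmetic.\<close>

definition corners :: "int \<times> int \<Rightarrow> (int \<times> int) set" where
  "corners B = {fst B, fst B + 1} \<times> {snd B, snd B + 1}"

lemma finite_corners [simp]: "finite (corners B)" by (simp add: corners_def)

lemma sum_corners:
  fixes f :: "int \<times> int \<Rightarrow> 'b::comm_monoid_add"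
  shows "(\<Sum>z\<in>corners (i, j). f z) = f (i, j) + (f (i + 1, j) + (f (i, j + 1) + f (i + 1, j + 1)))"
proof -
  have "corners (i, j) = {(i, j), (i + 1, j), (i, j + 1), (i + 1, j + 1)}"
    by (auto simp: corners_def)
  then show ?thesis by simp
qed

lemma card_corners [simp]: "card (corners B) = 4"
  using sum_corners[of "\<lambda>_. 1::nat" "fst B" "snd B"] by simp

text \<open>All cells have even coordinate sum (\<open>cells_even\<close>), so among the eight
  neighbouring positions only the diagonal ones occur.\<close>

lemma even_neighbours:
  fixes i j i' j' :: int
  assumes "even (i + j)" "even (i' + j')" "(i, j) \<noteq> (i', j')"
    "i \<le> i' + 1" "i' \<le> i + 1" "j \<le> j' + 1" "j' \<le> j + 1"
  shows "(i = i' + 1 \<or> i' = i + 1) \<and> (j = j' + 1 \<or> j' = j + 1)"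
  using assms by simp presburger

text \<open>Cells touch diagonally, hence in one vertex at most. Neighbours found in different cells
  are therefore distinct, and degrees and sums split cell by cell.\<close>

lemma even_corners_share:
  assumes "even (fst B + snd B)" "even (fst B' + snd B')" "B \<noteq> B'"
    "y \<in> corners B" "y \<in> corners B'" "z \<in> corners B" "z \<in> corners B'"
  shows "y = z"
proof -
  obtain i j where B: "B = (i, j)" by (cases B)
  obtain i' j' where B': "B' = (i', j')" by (cases B')
  obtain a b where y: "y = (a, b)" by (cases y)
  obtain c d where z: "z = (c, d)" by (cases z)
  have m: "a \<in> {i, i + 1}" "a \<in> {i', i' + 1}" "b \<in> {j, j + 1}" "b \<in> {j', j' + 1}"
    "c \<in> {i, i + 1}" "c \<in> {i', i' + 1}" "d \<in> {j, j + 1}" "d \<in> {j', j' + 1}"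
    using assms(4-7) by (simp_all only: B B' y z corners_def mem_Times_iff fst_conv snd_conv)
  have "(i = i' + 1 \<or> i' = i + 1) \<and> (j = j' + 1 \<or> j' = j + 1)"
  proof (rule even_neighbours)
    show "i \<le> i' + 1" "i' \<le> i + 1" using m(1,2) by auto
    show "j \<le> j' + 1" "j' \<le> j + 1" using m(3,4) by auto
  qed (use assms(1-3) in \<open>auto simp: B B'\<close>)
  moreover from this have "a = c" using m(1,2,5,6) by auto
  moreover from calculation have "b = d" using m(3,4,7,8) by auto
  ultimately show ?thesis unfolding y z by simp
qed

text \<open>For \<open>y\<close> a corner of the cells in \<open>S\<close>, \<open>Lam S lam g y\<close> is the unnormalized
  operator \<open>\<Delta> + lam\<close>: its degree-normalized version divides by \<open>3\<close> times the number of
  cells at \<open>y\<close>.\<close>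

definition Lc :: "real \<Rightarrow> (int \<times> int \<Rightarrow> real) \<Rightarrow> int \<times> int \<Rightarrow> int \<times> int \<Rightarrow> real" where
  "Lc lam g B y = (\<Sum>z\<in>corners B. g z - g y) + 3 * lam * g y"

definition Lam :: "(int \<times> int) set \<Rightarrow> real \<Rightarrow> (int \<times> int \<Rightarrow> real) \<Rightarrow> int \<times> int \<Rightarrow> real" where
  "Lam S lam g y = (\<Sum>B\<in>{B \<in> S. y \<in> corners B}. Lc lam g B y)"

lemma Lc_cong:
  assumes "\<And>z. z \<in> corners B \<Longrightarrow> g z = h z" "y \<in> corners B"
  shows "Lc lam g B y = Lc lam h B y"
  using assms by (simp add: Lc_def)

lemma Lam_cong:
  assumes "\<And>B z. B \<in> S \<Longrightarrow> z \<in> corners B \<Longrightarrow> g z = h z"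
  shows "Lam S lam g y = Lam S lam h y"
  unfolding Lam_def by (intro sum.cong refl Lc_cong) (use assms in auto)

lemma Lc_sum: "Lc lam (\<lambda>y. \<Sum>k\<in>K. c k * g k y) B y = (\<Sum>k\<in>K. c k * Lc lam (g k) B y)"
  unfolding Lc_def
  by (simp add: algebra_simps sum.distrib sum_distrib_left sum_subtractf sum.swap[of _ K])

lemma Lam_sum: "Lam S lam (\<lambda>y. \<Sum>k\<in>K. c k * g k y) y = (\<Sum>k\<in>K. c k * Lam S lam (g k) y)"
  unfolding Lam_def Lc_sum by (subst sum.swap) (simp add: sum_distrib_left)

lemma Lam_const: "Lam S lam (\<lambda>_. c) y = 3 * lam * c * real (card {B \<in> S. y \<in> corners B})"
  by (simp add: Lam_def Lc_def)

lemma Lam_as_cell_sum: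
  assumes "finite S"
  shows "(\<Sum>y\<in>(\<Union>B\<in>S. corners B). v y * Lam S lam u y) = (\<Sum>B\<in>S. \<Sum>y\<in>corners B. v y * Lc lam u B y)"
proof -
  let ?V = "\<Union>B\<in>S. corners B"
  have V: "finite ?V" using assms by auto
  have "(\<Sum>y\<in>?V. v y * Lam S lam u y) = (\<Sum>y\<in>?V. \<Sum>B\<in>{B \<in> S. y \<in> corners B}. v y * Lc lam u B y)"
    by (simp add: Lam_def sum_distrib_left)
  also have "\<dots> = (\<Sum>B\<in>S. \<Sum>y\<in>{y \<in> ?V. y \<in> corners B}. v y * Lc lam u B y)"
    by (rule sum.swap_restrict[OF V assms])
  also have "\<dots> = (\<Sum>B\<in>S. \<Sum>y\<in>corners B. v y * Lc lam u B y)"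
    by (intro sum.cong refl) auto
  finally show ?thesis .
qed

text \<open>The graph on a cell is complete, so the sum of differences is the total minus
  \<open>4 * u y\<close>. The result is symmetric in \<open>u\<close> and \<open>v\<close>, which is
  all that \<open>Lam_green\<close> requires.\<close>

lemma Lc_expand: "(\<Sum>y\<in>corners B. v y * Lc lam u B y)
  = (\<Sum>y\<in>corners B. v y) * (\<Sum>y\<in>corners B. u y) + (3 * lam - 4) * (\<Sum>y\<in>corners B. v y * u y)"
proof -
  have "v y * Lc lam u B y = v y * (\<Sum>z\<in>corners B. u z) + (3 * lam - 4) * (v y * u y)" for y
    by (simp add: Lc_def sum_subtractf algebra_simps)
  then show ?thesis by (simp add: sum.distrib flip: sum_distrib_left sum_distrib_right)
qed

lemma Lam_green:
  assumes "finite S"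
  shows "(\<Sum>y\<in>(\<Union>B\<in>S. corners B). v y * Lam S lam u y) = (\<Sum>y\<in>(\<Union>B\<in>S. corners B). u y * Lam S lam v y)"
  unfolding Lam_as_cell_sum[OF assms] Lc_expand by (simp add: mult.commute)

text \<open>The double sum of \<open>(u z - u y)\<^sup>2\<close> meets every edge twice, hence the
  division by 2.\<close>

lemma Lam_energy:
  assumes "finite S"
  shows "(\<Sum>y\<in>(\<Union>B\<in>S. corners B). u y * Lam S lam u y)
    = 3 * lam * (\<Sum>B\<in>S. \<Sum>y\<in>corners B. (u y)\<^sup>2) - (\<Sum>B\<in>S. \<Sum>y\<in>corners B. \<Sum>z\<in>corners B. (u z - u y)\<^sup>2) / 2"
proof -
  have "(\<Sum>z\<in>corners B. (u z - u y)\<^sup>2)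
      = (\<Sum>z\<in>corners B. (u z)\<^sup>2) + 4 * (u y)\<^sup>2 - 2 * (u y * (\<Sum>z\<in>corners B. u z))" for y B
    unfolding power2_diff by (simp add: sum.distrib sum_subtractf sum_distrib_left mult_ac)
  then have "(\<Sum>y\<in>corners B. \<Sum>z\<in>corners B. (u z - u y)\<^sup>2)
      = 8 * (\<Sum>y\<in>corners B. (u y)\<^sup>2) - 2 * ((\<Sum>y\<in>corners B. u y) * (\<Sum>y\<in>corners B. u y))" for B
    by (simp add: sum.distrib sum_subtractf flip: sum_distrib_left sum_distrib_right)
  then have e: "(\<Sum>y\<in>corners B. u y) * (\<Sum>y\<in>corners B. u y)
      = 4 * (\<Sum>y\<in>corners B. (u y)\<^sup>2) - (\<Sum>y\<in>corners B. \<Sum>z\<in>corners B. (u z - u y)\<^sup>2) / 2" for B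
    by (simp add: field_simps)
  have "(\<Sum>y\<in>corners B. u y * Lc lam u B y)
      = 3 * lam * (\<Sum>y\<in>corners B. (u y)\<^sup>2) - (\<Sum>y\<in>corners B. \<Sum>z\<in>corners B. (u z - u y)\<^sup>2) / 2" for B
    unfolding Lc_expand e by (simp add: power2_eq_square algebra_simps)
  then show ?thesis unfolding Lam_as_cell_sum[OF assms]
    by (simp add: sum_subtractf sum_distrib_left sum_divide_distrib)
qed

section \<open>Iterated subdivision of the integer grid\<close>

context vicsek begin

definition N :: int where "N = 2 * int n - 1"

definition D :: "(int \<times> int) set" where
  "D = {(a, b). 0 \<le> a \<and> a < N \<and> 0 \<le> b \<and> b < N \<and> (a = b \<or> a + b = N - 1)}"

definition shift :: "int \<times> int \<Rightarrow> int \<times> int \<Rightarrow> int \<times> int" where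
  "shift A y = (N * fst A + fst y, N * snd A + snd y)"

definition rel :: "int \<times> int \<Rightarrow> int \<times> int \<Rightarrow> int \<times> int" where
  "rel A y = (fst y - N * fst A, snd y - N * snd A)"

text \<open>The same point of the plane in the coordinates of the next level, see
  \<open>pt_refine\<close>.\<close>

definition refine :: "int \<times> int \<Rightarrow> int \<times> int" where
  "refine z = (N * fst z, N * snd z)"

text \<open>Subdivides every existing cell, which suits the passage between consecutive levels.
  \<open>cell_corners\<close> applies a map on the outside instead; \<open>cells_outer\<close>
  reconciles the two orders.\<close>

primrec cells :: "nat \<Rightarrow> (int \<times> int) set" where
  "cells 0 = {(0, 0)}"
| "cells (Suc m) = (\<lambda>(A, d). shift A d) ` (cells m \<times> D)"

definition verts :: "nat \<Rightarrow> (int \<times> int) set" where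
  "verts m = (\<Union>B\<in>cells m. corners B)"

definition block :: "int \<times> int \<Rightarrow> (int \<times> int) set" where
  "block A = {N * fst A .. N * fst A + N} \<times> {N * snd A .. N * snd A + N}"

lemma N_ge: "N \<ge> 3" using n_ge by (simp add: N_def)
lemma N_pos: "N > 0" using N_ge by simp

lemma real_N: "real_of_int N = Nr" using n_ge by (simp add: N_def Nr_def)

lemma shift_rel [simp]: "shift A (rel A y) = y" "rel A (shift A y) = y"
  by (simp_all add: shift_def rel_def)

lemma refine_inj [simp]: "refine y = refine z \<longleftrightarrow> y = z"
  using N_pos by (auto simp: refine_def prod_eq_iff)

lemma finite_D: "finite D"
  by (rule finite_subset[of _ "{0..<N} \<times> {0..<N}"]) (auto simp: D_def)

text \<open>The diagonals share the center cell, so the bound is one too large;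
  \<open>eig_edge\<close> has room for that.\<close>

lemma card_D: "card D \<le> nat (2 * N)"
proof -
  have "D \<subseteq> (\<lambda>a. (a, a)) ` {0..<N} \<union> (\<lambda>a. (a, N - 1 - a)) ` {0..<N}"
    by (auto simp: D_def)
  then have "card D \<le> card ((\<lambda>a. (a, a)) ` {0..<N} \<union> (\<lambda>a. (a, N - 1 - a)) ` {0..<N})"
    by (intro card_mono) auto
  also have "\<dots> \<le> card ((\<lambda>a. (a, a)) ` {0..<N}) + card ((\<lambda>a. (a, N - 1 - a)) ` {0..<N})"
    by (rule card_Un_le)
  also have "\<dots> \<le> nat N + nat N" by (intro add_mono order_trans[OF card_image_le]) auto
  finally show ?thesis by simp
qed

lemma finite_cells: "finite (cells m)"
  by (induction m) (auto simp: finite_D)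

lemma finite_verts: "finite (verts m)" by (simp add: verts_def finite_cells)

lemma card_cells: "real (card (cells m)) \<le> (2 * Nr) ^ m"
proof (induction m)
  case (Suc m)
  have "card (cells (Suc m)) \<le> card (cells m) * card D"
    using card_image_le[of "cells m \<times> D" "\<lambda>(A, d). shift A d"] finite_cells finite_D
    by (simp add: card_cartesian_product)
  then have "real (card (cells (Suc m))) \<le> real (card (cells m)) * real (card D)"
    by (metis of_nat_le_iff of_nat_mult)
  also have "\<dots> \<le> (2 * Nr) ^ m * (2 * Nr)"
  proof (intro mult_mono Suc)
    have "real (card D) \<le> real (nat (2 * N))" using card_D by simp
    then show "real (card D) \<le> 2 * Nr" using N_pos by (simp add: real_N)
  qed (use Nr_pos in auto)
  finally show ?case by (simp add: mult.commute)
qed simp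

text \<open>\<open>N\<close> is odd, and on the two diagonals of the \<open>N\<close> by
  \<open>N\<close> grid the coordinate sum is \<open>2 * a\<close> or \<open>N - 1\<close>, both
  even.\<close>

lemma cells_even: "B \<in> cells m \<Longrightarrow> even (fst B + snd B)"
proof (induction m arbitrary: B)
  case (Suc m)
  then obtain A d where A: "A \<in> cells m" "d \<in> D" "B = shift A d" by auto
  have "even (fst d + snd d)" using A(2) unfolding D_def N_def by (cases d) (simp, presburger)
  moreover have "even (N * (fst A + snd A))" using Suc.IH[OF A(1)] by simp
  moreover have "fst B + snd B = N * (fst A + snd A) + (fst d + snd d)"
    unfolding A(3) shift_def by (simp add: algebra_simps)
  ultimately show ?case by simp
qed simp

lemma cells_share:
  assumes "B \<in> cells m" "B' \<in> cells m" "B \<noteq> B'"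
    "y \<in> corners B" "y \<in> corners B'" "z \<in> corners B" "z \<in> corners B'"
  shows "y = z"
  using even_corners_share[of B B' y z] cells_even assms by blast

lemma N_mult_cancel: "N * a \<le> N * b \<longleftrightarrow> a \<le> b" using N_pos by simp

lemma refine_block: "refine z \<in> block A \<longleftrightarrow> z \<in> corners A"
proof -
  have "N * a \<le> N * b + N \<longleftrightarrow> a \<le> b + 1" for a b
    using N_mult_cancel[of a "b + 1"] by (simp add: distrib_left)
  moreover have "N * a \<le> N * b \<longleftrightarrow> a \<le> b" for a b by (rule N_mult_cancel)
  ultimately show ?thesis by (cases z; cases A) (auto simp: refine_def block_def corners_def)
qed

text \<open>Distinct cells whose squares meet are diagonal neighbours, so the squares share one
  point, a coarse corner. Every other fine vertex belongs to a single coarse cell.\<close>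

lemma block_inter:
  assumes "A \<in> cells m" "A' \<in> cells m" "A \<noteq> A'" "y \<in> block A" "y \<in> block A'"
  obtains z where "z \<in> corners A" "z \<in> corners A'" "y = refine z"
proof -
  obtain i j where A: "A = (i, j)" by (cases A)
  obtain i' j' where A': "A' = (i', j')" by (cases A')
  obtain a b where y: "y = (a, b)" by (cases y)
  have b: "N * i \<le> a" "a \<le> N * i + N" "N * j \<le> b" "b \<le> N * j + N"
    "N * i' \<le> a" "a \<le> N * i' + N" "N * j' \<le> b" "b \<le> N * j' + N"
    using assms by (auto simp: A A' y block_def)
  have le: "p \<le> q + 1" if "N * p \<le> c" "c \<le> N * q + N" for p q c
    using N_mult_cancel[of p "q + 1"] that by (simp add: distrib_left)
  have nb: "(i = i' + 1 \<or> i' = i + 1) \<and> (j = j' + 1 \<or> j' = j + 1)"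
    using even_neighbours[of i j i' j'] cells_even[OF assms(1)] cells_even[OF assms(2)] assms(3)
      le b by (auto simp: A A')
  have eq: "c = N * max p q \<and> max p q \<in> {p, p + 1} \<and> max p q \<in> {q, q + 1}"
    if "p = q + 1 \<or> q = p + 1" "N * p \<le> c" "c \<le> N * p + N" "N * q \<le> c" "c \<le> N * q + N" for p q c
    using that by (auto simp: distrib_left max_def)
  have m: "a = N * max i i'" "max i i' \<in> {i, i + 1}" "max i i' \<in> {i', i' + 1}"
    "b = N * max j j'" "max j j' \<in> {j, j + 1}" "max j j' \<in> {j', j' + 1}"
    using eq[of i i' a] eq[of j j' b] nb b by blast+
  show ?thesis
  proof (rule that)
    show "(max i i', max j j') \<in> corners A" "(max i i', max j j') \<in> corners A'"
      using m unfolding A A' corners_def by auto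
    show "y = refine (max i i', max j j')" using m by (simp add: y refine_def)
  qed
qed

lemma corners_shift: "corners (shift A d) = shift A ` corners d"
  by (cases A; cases d) (auto simp: corners_def shift_def image_iff)

lemma inj_shift: "inj_on (shift A) S"
  by (rule inj_onI) (metis shift_rel(2))

lemma Lc_shift: "Lc lam g (shift A d) y = Lc lam (g \<circ> shift A) d (rel A y)"
  unfolding Lc_def corners_shift by (simp add: sum.reindex[OF inj_shift])

lemma D_corners_bounds:
  assumes "d \<in> D" "y \<in> corners d" shows "0 \<le> fst y" "fst y \<le> N" "0 \<le> snd y" "snd y \<le> N"
  using assms by (auto simp: D_def corners_def)

lemma corners_shift_block:
  assumes "d \<in> D" "y \<in> corners (shift A d)" shows "y \<in> block A"
  using D_corners_bounds[OF assms(1), of "rel A y"] assms(2)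
  unfolding corners_shift by (cases y) (auto simp: block_def rel_def shift_def dest: D_corners_bounds[OF assms(1)])

lemma shift_inj2:
  assumes "d \<in> D" "d' \<in> D" "shift A d = shift A' d'" shows "A = A' \<and> d = d'"
proof -
  have "p = q \<and> a = b" if "N * p + a = N * q + b" "0 \<le> a" "a < N" "0 \<le> b" "b < N" for p q a b
  proof -
    have "(N * p + a) div N = p" "(N * q + b) div N = q" using that(2-) N_pos by simp_all
    then show ?thesis using that(1) by simp
  qed
  from this[of "fst A" "fst d" "fst A'" "fst d'"] this[of "snd A" "snd d" "snd A'" "snd d'"]
  show ?thesis using assms by (auto simp: shift_def D_def prod_eq_iff)
qed

text \<open>The localization on which all level changes rest: the finer operator is assembled from
  copies of the operator on the model cell \<open>D\<close>, one for each coarse cell whose square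
  contains the vertex.\<close>

lemma Lam_Suc:
  "Lam (cells (Suc m)) lam g y = (\<Sum>A\<in>{A \<in> cells m. y \<in> block A}. Lam D lam (g \<circ> shift A) (rel A y))"
proof -
  let ?S = "SIGMA A:{A \<in> cells m. y \<in> block A}. {d \<in> D. rel A y \<in> corners d}"
  have mem: "y \<in> corners (shift A d) \<longleftrightarrow> rel A y \<in> corners d" for A d
    unfolding corners_shift by (metis image_iff shift_rel)
  have "{B \<in> cells (Suc m). y \<in> corners B} = (\<lambda>(A, d). shift A d) ` ?S"
  proof (intro set_eqI iffI)
    fix B assume "B \<in> {B \<in> cells (Suc m). y \<in> corners B}"
    then obtain A d where "A \<in> cells m" "d \<in> D" "B = shift A d" "y \<in> corners (shift A d)" by auto
    then show "B \<in> (\<lambda>(A, d). shift A d) ` ?S"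
      using corners_shift_block mem by (intro image_eqI[of _ _ "(A, d)"]) auto
  next
    fix B assume "B \<in> (\<lambda>(A, d). shift A d) ` ?S"
    then obtain A d where "A \<in> cells m" "d \<in> D" "B = shift A d" "rel A y \<in> corners d" by auto
    then show "B \<in> {B \<in> cells (Suc m). y \<in> corners B}" using mem by (auto intro: image_eqI[of _ _ "(A, d)"])
  qed
  moreover have "inj_on (\<lambda>(A, d). shift A d) ?S"
    by (rule inj_onI) (auto dest: shift_inj2)
  ultimately have "Lam (cells (Suc m)) lam g y = (\<Sum>(A, d)\<in>?S. Lc lam g (shift A d) y)"
    by (simp add: Lam_def sum.reindex case_prod_unfold)
  also have "\<dots> = (\<Sum>A\<in>{A \<in> cells m. y \<in> block A}. \<Sum>d\<in>{d \<in> D. rel A y \<in> corners d}. Lc lam g (shift A d) y)"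
    by (rule sum.Sigma[symmetric]) (auto simp: finite_cells finite_D)
  finally show ?thesis unfolding Lam_def Lc_shift .
qed

lemma interior_block:
  assumes "A \<in> cells m" "y \<in> block A" "\<And>z. z \<in> corners A \<Longrightarrow> y \<noteq> refine z"
  shows "{A \<in> cells m. y \<in> block A} = {A}"
  using assms block_inter[of A m _ y] by blast

lemma verts_Suc: "verts (Suc m) = (\<Union>A\<in>cells m. shift A ` (\<Union>d\<in>D. corners d))"
proof -
  have "verts (Suc m) = (\<Union>(A, d)\<in>cells m \<times> D. corners (shift A d))"
    by (simp add: verts_def case_prod_unfold)
  also have "\<dots> = (\<Union>A\<in>cells m. \<Union>d\<in>D. shift A ` corners d)" by (simp add: corners_shift) blast
  finally show ?thesis by (simp add: image_UN)
qed

lemma verts_SucE: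
  assumes "y \<in> verts (Suc m)"
  obtains A where "A \<in> cells m" "y \<in> block A" "rel A y \<in> (\<Union>d\<in>D. corners d)"
proof -
  obtain A d x where A: "A \<in> cells m" "d \<in> D" "x \<in> corners d" "y = shift A x"
    using assms unfolding verts_Suc by auto
  then have "y \<in> corners (shift A d)" by (simp add: corners_shift)
  from corners_shift_block[OF A(2) this] show ?thesis using that[of A] A by auto
qed

lemma cells_1: "cells (Suc 0) = D" by (auto simp: shift_def image_iff)

end

section \<open>Extension inside a subdivided cell\<close>

lemma sin_rec: "sin ((x::real) - t) + sin (x + t) = 2 * cos t * sin x"
  by (simp add: sin_add sin_diff)

context vicsek begin

definition M :: int where "M = int n - 1"

lemma M_ge: "M \<ge> 1" using n_ge by (simp add: M_def)
lemma N_M: "N = 2 * M + 1" by (simp add: N_def M_def)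
lemma real_M: "real_of_int M = (Nr - 1) / 2" using n_ge by (simp add: M_def Nr_def of_nat_diff field_simps)

definition mirror :: "int \<times> int \<Rightarrow> int \<times> int \<Rightarrow> int \<times> int" where
  "mirror k y = (if fst k = 0 then fst y else N - fst y, if snd k = 0 then snd y else N - snd y)"

text \<open>The action of \<open>mirror\<close> on cells: the lower left corner of a reflected cell
  comes from another corner of the original, hence \<open>N - 1\<close> in place of
  \<open>N\<close>.\<close>

definition mirrorc :: "int \<times> int \<Rightarrow> int \<times> int \<Rightarrow> int \<times> int" where
  "mirrorc k d = (if fst k = 0 then fst d else N - 1 - fst d, if snd k = 0 then snd d else N - 1 - snd d)"

lemma mirror_mirror [simp]: "mirror k (mirror k y) = y" and mirrorc_mirrorc [simp]: "mirrorc k (mirrorc k d) = d"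
  by (auto simp: mirror_def mirrorc_def)

lemma mirror_0 [simp]: "mirror (0, 0) y = y" by (simp add: mirror_def)

lemma corners_mirrorc: "corners (mirrorc k d) = mirror k ` corners d"
  by (cases d; cases k) (auto simp: corners_def mirror_def mirrorc_def)

lemma mirrorc_D: "mirrorc k d \<in> D \<longleftrightarrow> d \<in> D"
  by (cases d; cases k) (auto simp: mirrorc_def D_def)

lemma inj_mirror: "inj_on (mirror k) S" by (rule inj_onI) (metis mirror_mirror)

text \<open>Reflections preserve \<open>D\<close>, so all computations can be done on the
  half-diagonal that starts at \<open>(0, 0)\<close>.\<close>

lemma Lam_mirror: "Lam D lam (g \<circ> mirror k) y = Lam D lam g (mirror k y)"
proof -
  have Lc: "Lc lam (g \<circ> mirror k) d y = Lc lam g (mirrorc k d) (mirror k y)" for d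
    unfolding Lc_def corners_mirrorc by (simp add: sum.reindex inj_mirror)
  have mem: "mirror k y \<in> corners (mirrorc k d) \<longleftrightarrow> y \<in> corners d" for d
    unfolding corners_mirrorc by (rule inj_image_mem_iff[OF inj_mirror])
  have eq: "{d \<in> D. mirror k y \<in> corners d} = mirrorc k ` {d \<in> D. y \<in> corners d}"
  proof (intro set_eqI iffI)
    fix d assume "d \<in> {d \<in> D. mirror k y \<in> corners d}"
    then show "d \<in> mirrorc k ` {d \<in> D. y \<in> corners d}"
      using mem[of "mirrorc k d"] by (intro image_eqI[of _ _ "mirrorc k d"]) (auto simp: mirrorc_D)
  next
    fix d assume "d \<in> mirrorc k ` {d \<in> D. y \<in> corners d}"
    then show "d \<in> {d \<in> D. mirror k y \<in> corners d}" using mem by (auto simp: mirrorc_D)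
  qed
  have "inj_on (mirrorc k) S" for S by (rule inj_onI) (metis mirrorc_mirrorc)
  then show ?thesis unfolding Lam_def eq by (simp add: sum.reindex Lc)
qed

lemma cells_at_corner: "{d \<in> D. (0, 0) \<in> corners d} = {(0, 0)}"
  using N_pos by (auto simp: D_def corners_def)

lemma cells_at_arm:
  assumes "1 \<le> l" "l \<le> M" shows "{d \<in> D. (l, l) \<in> corners d} = {(l - 1, l - 1), (l, l)}"
  using assms by (auto simp: D_def corners_def N_M)

lemma cells_at_side:
  assumes "1 \<le> l" "l \<le> M"
  shows "{d \<in> D. (l, l - 1) \<in> corners d} = {(l - 1, l - 1)}" "{d \<in> D. (l - 1, l) \<in> corners d} = {(l - 1, l - 1)}"
  using assms by (auto simp: D_def corners_def N_M) presburger+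

lemma D_vertexE:
  assumes "y \<in> (\<Union>d\<in>D. corners d)"
  obtains k l where "k \<in> corners (0, 0)" "0 \<le> l" "l \<le> M" "y = mirror k (l, l)"
  | k l where "k \<in> corners (0, 0)" "1 \<le> l" "l \<le> M" "y = mirror k (l, l - 1)"
  | k l where "k \<in> corners (0, 0)" "1 \<le> l" "l \<le> M" "y = mirror k (l - 1, l)"
proof -
  obtain d where d: "d \<in> D" "y \<in> corners d" using assms by auto
  show thesis
  \<comment> \<open>The center cell lies on both diagonals. Its corners are the inner ends
    \<open>(M, M)\<close> of the four reflected half-diagonals, since
    \<open>M + 1 = N - M\<close>.\<close>
  proof (cases "d = (M, M)")
    case True
    then have y: "y \<in> {(M, M), (M + 1, M), (M, M + 1), (M + 1, M + 1)}" using d by (auto simp: corners_def)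
    have "M + 1 = N - M" by (simp add: N_M)
    then have "y = mirror (fst y - M, snd y - M) (M, M)" "(fst y - M, snd y - M) \<in> corners (0, 0)"
      using y by (auto simp: mirror_def corners_def)
    from this(2) _ _ this(1) show thesis by (rule that(1)) (use M_ge in auto)
  next
    case False
    define k :: "int \<times> int" where "k = (if fst d < M then 0 else 1, if snd d < M then 0 else 1)"
    define a where "a = fst (mirrorc k d)"
    have k: "k \<in> corners (0, 0)" by (auto simp: k_def corners_def)
    have a: "mirrorc k d = (a, a)" "0 \<le> a" "a < M"
      using d(1) False by (cases d; auto simp: a_def k_def mirrorc_def D_def N_M)+
    have "mirror k y \<in> corners (a, a)" using d(2) unfolding a(1)[symmetric] corners_mirrorc by auto
    then have "mirror k y \<in> {(a, a), (a + 1, a), (a, a + 1), (a + 1, a + 1)}" by (auto simp: corners_def)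
    then have "mirror k (mirror k y) \<in> mirror k ` \<dots>" by (rule imageI)
    then consider "y = mirror k (a, a)" | "y = mirror k (a + 1, a)" | "y = mirror k (a, a + 1)" | "y = mirror k (a + 1, a + 1)"
      by auto
    then show thesis
      using that(1)[of k a] that(1)[of k "a + 1"] that(2)[of k "a + 1"] that(3)[of k "a + 1"] k a by cases auto
  qed
qed

lemma Lam_corner:
  "Lam D lam g (0, 0) = g (1, 0) + g (0, 1) + g (1, 1) - 3 * g (0, 0) + 3 * lam * g (0, 0)"
  unfolding Lam_def cells_at_corner by (simp add: Lc_def sum_corners)

lemma Lam_side:
  assumes "1 \<le> l" "l \<le> M"
  shows "Lam D lam g (l, l - 1) = g (l, l) + g (l - 1, l - 1) + g (l - 1, l) - (3 - 3 * lam) * g (l, l - 1)"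
    "Lam D lam g (l - 1, l) = g (l, l) + g (l - 1, l - 1) + g (l, l - 1) - (3 - 3 * lam) * g (l - 1, l)"
  unfolding Lam_def cells_at_side[OF assms] by (simp_all add: Lc_def sum_corners algebra_simps)

lemma Lam_arm:
  assumes "1 \<le> l" "l \<le> M"
  shows "Lam D lam g (l, l) = (g (l - 1, l - 1) + g (l, l - 1) + g (l - 1, l)) + (g (l + 1, l + 1) + g (l + 1, l) + g (l, l + 1))
    - (6 - 6 * lam) * g (l, l)"
  unfolding Lam_def cells_at_arm[OF assms] by (simp add: Lc_def sum_corners algebra_simps)

text \<open>With \<open>lam = (1 - C) / 3\<close>, the operator along an arm becomes a three-term recurrence
  with characteristic cosine \<open>C\<close> once the side vertices are eliminated.\<close>

lemma arm_recurrence: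
  assumes C: "C > -1" and lam: "lam = (1 - C) / 3"
    and arm: "\<And>l. 0 \<le> l \<Longrightarrow> l \<le> M \<Longrightarrow> g (l, l) = f l"
    and side: "\<And>l. 1 \<le> l \<Longrightarrow> l \<le> M \<Longrightarrow> g (l, l - 1) = (f l + f (l - 1)) / (1 + C)"
      "\<And>l. 1 \<le> l \<Longrightarrow> l \<le> M \<Longrightarrow> g (l - 1, l) = (f l + f (l - 1)) / (1 + C)"
  shows "Lam D lam g (0, 0) = (3 + C) / (1 + C) * (f 1 - C * f 0)"
    "1 \<le> l \<Longrightarrow> l \<le> M \<Longrightarrow> Lam D lam g (l, l - 1) = 0"
    "1 \<le> l \<Longrightarrow> l \<le> M \<Longrightarrow> Lam D lam g (l - 1, l) = 0"
    "1 \<le> l \<Longrightarrow> l < M \<Longrightarrow> Lam D lam g (l, l) = (3 + C) / (1 + C) * (f (l - 1) + f (l + 1) - 2 * C * f l)"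
    "Lam D lam g (M, M) = (3 + C) / (1 + C) * (f (M - 1) - (2 * C + 1) * f M) + (\<Sum>k\<in>corners (0, 0). g (mirror k (M, M)))"
proof -
  have C0: "1 + C \<noteq> 0" using C by simp
  show "Lam D lam g (0, 0) = (3 + C) / (1 + C) * (f 1 - C * f 0)"
    using arm[of 0] arm[of 1] side(1)[of 1] side(2)[of 1] M_ge C0
    by (simp add: Lam_corner lam field_simps)
  have aux: "f l + f (l - 1) + (f l + f (l - 1)) / (1 + C) - (3 - 3 * lam) * ((f l + f (l - 1)) / (1 + C)) = 0" for l
    using C0 by (simp add: lam field_simps)
  show "Lam D lam g (l, l - 1) = 0" if "1 \<le> l" "l \<le> M"
    using arm[of l] arm[of "l - 1"] side[of l] that aux[of l] by (simp add: Lam_side)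
  show "Lam D lam g (l - 1, l) = 0" if "1 \<le> l" "l \<le> M"
    using arm[of l] arm[of "l - 1"] side[of l] that aux[of l] by (simp add: Lam_side)
  show "Lam D lam g (l, l) = (3 + C) / (1 + C) * (f (l - 1) + f (l + 1) - 2 * C * f l)" if "1 \<le> l" "l < M"
    using arm[of l] arm[of "l - 1"] arm[of "l + 1"] side[of l] side[of "l + 1"] that C0
    by (simp add: Lam_arm lam field_simps)
  \<comment> \<open>Besides the last cell of its arm, \<open>(M, M)\<close> lies in the center cell,
    where the four arms meet; this sum is the only coupling between them.\<close>
  have "(\<Sum>k\<in>corners (0, 0). g (mirror k (M, M))) = g (M, M) + g (M + 1, M) + g (M, M + 1) + g (M + 1, M + 1)"
    by (simp add: sum_corners mirror_def N_M)
  then show "Lam D lam g (M, M) = (3 + C) / (1 + C) * (f (M - 1) - (2 * C + 1) * f M) + (\<Sum>k\<in>corners (0, 0). g (mirror k (M, M)))"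
    using arm[of M] arm[of "M - 1"] side[of M] M_ge C0
    by (simp add: Lam_arm lam field_simps)
qed

text \<open>\<open>min\<close> folds every vertex back to the half-diagonal. The profile
  \<open>p\<close> serves the arm of \<open>(0, 0)\<close> and \<open>q\<close> the three others;
  the quotient by \<open>c\<close> is the value of an eliminated side vertex.\<close>

definition arms :: "(int \<Rightarrow> real) \<Rightarrow> (int \<Rightarrow> real) \<Rightarrow> real \<Rightarrow> int \<times> int \<Rightarrow> real" where
  "arms p q c y = (let a = min (fst y) (N - fst y); b = min (snd y) (N - snd y);
      f = (if fst y \<le> M \<and> snd y \<le> M then p else q) in
    if a = b then f a else (f a + f b) / c)"

lemma arms_mirror:
  assumes "k \<in> corners (0, 0)" "0 \<le> a" "a \<le> M" "0 \<le> b" "b \<le> M"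
  shows "arms p q c (mirror k (a, b)) = (let f = (if k = (0, 0) then p else q) in
    if a = b then f a else (f a + f b) / c)"
  using assms by (auto simp: arms_def mirror_def corners_def N_M min_def Let_def)

section \<open>Explicit weights for the extension of a unit mass\<close>

definition theta :: "real \<Rightarrow> real" where "theta a = 2 * a / Nr"

text \<open>The amplitude that makes the four arms match at the center cell, see
  \<open>wt_center\<close>.\<close>

definition wt_scale :: "real \<Rightarrow> real" where
  "wt_scale a = cos (delta a) / (4 * sin a * cos (gam a))"

definition wt_other :: "real \<Rightarrow> int \<Rightarrow> real" where
  "wt_other a i = wt_scale a * sin (i * theta a)"

text \<open>The added wave is 1 at the corner and odd about the middle of the diagonal: its values
  at \<open>M\<close> and \<open>M + 1\<close> are opposite and cancel in their sum.\<close>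

definition wt_own :: "real \<Rightarrow> int \<Rightarrow> real" where
  "wt_own a i = wt_other a i + sin (a - i * theta a) / sin a"

text \<open>The extension of the unit mass at the corner \<open>(0, 0)\<close> to the subdivided cell that solves
  the eigenvalue equation for \<open>X a\<close> at the interior vertices.\<close>

definition wt :: "real \<Rightarrow> int \<times> int \<Rightarrow> real" where
  "wt a = arms (wt_own a) (wt_other a) (1 + cos (theta a))"

text \<open>The ratio between the fine operator at a coarse vertex and the coarse operator, see
  \<open>Lam_ext_refine\<close>.\<close>

definition kappa :: "real \<Rightarrow> real" where
  "kappa a = (3 + cos (theta a)) / (1 + cos (theta a)) * wt_other a 1"

text \<open>Excludes zero denominators in \<open>wt_scale\<close> and \<open>wt_own\<close>. At the
  excluded angles a subdivided cell has nonzero solutions that vanish at its four corners.\<close>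

definition regular :: "real \<Rightarrow> bool" where
  "regular a \<longleftrightarrow> 0 < a \<and> a < Nr * pi / 2 \<and> sin a \<noteq> 0 \<and> cos (gam a) \<noteq> 0"

lemma X_theta: "X a = (1 - cos (theta a)) / 3"
  using cos_X[of a] by (simp add: theta_def)

lemma theta_bounds:
  assumes "0 < a" "a < Nr * pi / 2" shows "0 < theta a" "theta a < pi" "-1 < cos (theta a)" "0 < sin (theta a)"
proof -
  show t: "0 < theta a" "theta a < pi" using assms Nr_pos by (auto simp: theta_def field_simps)
  have "cos pi < cos (theta a)" using t by (intro cos_monotone_0_pi) auto
  then show "-1 < cos (theta a)" by simp
  show "0 < sin (theta a)" using t by (intro sin_gt_zero) auto
qed

lemma M_theta: "M * theta a = a - theta a / 2" "(M + 1) * theta a = a + theta a / 2"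
  using Nr_pos by (simp_all add: real_M theta_def field_simps)

lemma wt_other_rec: "wt_other a (l - 1) + wt_other a (l + 1) = 2 * cos (theta a) * wt_other a l"
proof -
  have "sin (real_of_int (l - 1) * theta a) + sin (real_of_int (l + 1) * theta a) = 2 * cos (theta a) * sin (l * theta a)"
    using sin_rec[of "l * theta a" "theta a"] by (simp add: algebra_simps)
  then show ?thesis unfolding wt_other_def by (simp flip: distrib_left)
qed

lemma wt_own_rec: "wt_own a (l - 1) + wt_own a (l + 1) = 2 * cos (theta a) * wt_own a l"
proof -
  have "sin (a - real_of_int (l - 1) * theta a) + sin (a - real_of_int (l + 1) * theta a) = 2 * cos (theta a) * sin (a - l * theta a)"
    using sin_rec[of "a - l * theta a" "theta a"] by (simp add: algebra_simps)
  then have "sin (a - real_of_int (l - 1) * theta a) / sin a + sin (a - real_of_int (l + 1) * theta a) / sin a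
      = 2 * cos (theta a) * (sin (a - l * theta a) / sin a)"
    by (simp flip: add_divide_distrib)
  then show ?thesis using wt_other_rec[of a l] unfolding wt_own_def by (simp add: algebra_simps)
qed

text \<open>These are the conditions at \<open>(M, M)\<close> after the recurrence has been
  continued to the fictitious index \<open>M + 1\<close>. The first one determines
  \<open>wt_scale\<close>; inside the proof, \<open>W\<close> is \<open>cos (gam a)\<close> up to a
  positive factor.\<close>

lemma wt_center:
  assumes "regular a"
  shows "(3 + cos (theta a)) * (wt_other a (M + 1) + wt_other a M) = (1 + cos (theta a)) * (wt_own a M + 3 * wt_other a M)"
    "wt_own a (M + 1) + wt_own a M = wt_other a (M + 1) + wt_other a M"
proof -
  note a = assms[unfolded regular_def]
  define p where "p = a / Nr"
  define s c u v where "s = sin a" "c = cos a" "u = sin p" "v = cos p"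
  have p: "0 < p" "p < pi / 2" using a half_angle[of a] Nr_pos by (auto simp: p_def)
  have v: "v > 0" unfolding s_c_u_v_def using p by (intro cos_gt_zero) auto
  have th: "theta a / 2 = p" "theta a = 2 * p" by (simp_all add: theta_def p_def)
  have C: "cos (theta a) = 2 * v\<^sup>2 - 1" unfolding th s_c_u_v_def by (rule cos_double_cos)
  have uv: "u\<^sup>2 = 1 - v\<^sup>2" unfolding s_c_u_v_def using sin_squared_eq by auto
  have s0: "s \<noteq> 0" using a by (simp add: s_c_u_v_def)
  define W where "W = 2 * c * v + u * s"
  have "2 * cos (gam a) = cos (delta a) * (2 * c + s * (u / v))"
    using sin_gam(2)[of a] a by (simp add: s_c_u_v_def tan_def p_def)
  also have "2 * c + s * (u / v) = W / v" using v by (simp add: W_def field_simps)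
  finally have g: "2 * cos (gam a) = cos (delta a) * W / v" by simp
  have W0: "W \<noteq> 0" using g a by auto
  have d0: "cos (delta a) > 0" using delta_bounds[of a] a by auto
  have K: "wt_scale a = v / (2 * s * W)"
  proof -
    have "cos (gam a) = cos (delta a) * W / (2 * v)" using g v by (simp add: field_simps)
    then show ?thesis unfolding wt_scale_def s_c_u_v_def(1)[symmetric]
      using d0 W0 v s0 by simp
  qed
  have M1: "real_of_int (M + 1) * theta a = a + p" "M * theta a = a - p" using M_theta[of a] unfolding th(1) by (simp_all add: of_int_add)
  have o: "wt_other a (M + 1) = v / (2 * s * W) * (s * v + c * u)" "wt_other a M = v / (2 * s * W) * (s * v - c * u)"
    unfolding wt_other_def K M1 by (simp_all add: sin_add sin_diff s_c_u_v_def)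
  have sp: "sin (a - M * theta a) = u" "sin (a - real_of_int (M + 1) * theta a) = - u"
    unfolding M1 by (simp_all add: s_c_u_v_def)
  show "wt_own a (M + 1) + wt_own a M = wt_other a (M + 1) + wt_other a M"
    unfolding wt_own_def sp by simp
  have "(3 + cos (theta a)) * (wt_other a (M + 1) + wt_other a M) = 2 * v\<^sup>2 * (1 + v\<^sup>2) / W"
    unfolding o C using s0 W0 by (simp add: field_simps power2_eq_square)
  also have "\<dots> = 2 * v\<^sup>2 * (2 * v * (s * v - c * u) + u * W) / (s * W)"
  proof -
    have "2 * v * (s * v - c * u) + u * W = s * (2 * v\<^sup>2 + u\<^sup>2)"
      unfolding W_def by (simp add: algebra_simps power2_eq_square)
    also have "\<dots> = s * (1 + v\<^sup>2)" unfolding uv by simp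
    finally show ?thesis using s0 by simp
  qed
  also have "\<dots> = (1 + cos (theta a)) * (wt_own a M + 3 * wt_other a M)"
    unfolding wt_own_def sp o C s_c_u_v_def(1)[symmetric] using s0 W0 by (simp add: field_simps power2_eq_square)
  finally show "(3 + cos (theta a)) * (wt_other a (M + 1) + wt_other a M) = (1 + cos (theta a)) * (wt_own a M + 3 * wt_other a M)" .
qed

text \<open>Here \<open>R_fun\<close> emerges from the matching: the amplitude
  \<open>wt_scale\<close> carries \<open>cos (gam a) / cos (delta a)\<close> in its denominator, and
  \<open>R_X\<close> expresses that quotient through \<open>4/3 - R_fun n (X a)\<close>.\<close>

lemma wt_corner:
  assumes "regular a"
  shows "wt_own a 1 - cos (theta a) = wt_other a 1 * (3 * R_fun n (X a) - 3)"
proof -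
  note a = assms[unfolded regular_def]
  have d0: "cos (delta a) > 0" using delta_bounds[of a] a by auto
  have "4/3 - R_fun n (X a) = 4/3 * cos a * cos (gam a) / cos (delta a)" using R_X(2)[of a] a by auto
  then have r: "3 * R_fun n (X a) - 3 = 1 - 4 * cos a * cos (gam a) / cos (delta a)" by simp
  have "wt_other a 1 * (4 * cos a * cos (gam a) / cos (delta a)) = sin (theta a) * cos a / sin a"
    unfolding wt_other_def wt_scale_def using a d0 by (simp add: field_simps)
  then show ?thesis unfolding r wt_own_def using a by (simp add: sin_diff right_diff_distrib diff_divide_distrib)
qed

lemma wt_mirror_values:
  fixes a :: real
  assumes "k \<in> corners (0, 0)"
  defines "f \<equiv> if k = (0, 0) then wt_own (a::real) else wt_other a"
  shows "0 \<le> l \<Longrightarrow> l \<le> M \<Longrightarrow> wt a (mirror k (l, l)) = f l"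
    "1 \<le> l \<Longrightarrow> l \<le> M \<Longrightarrow> wt a (mirror k (l, l - 1)) = (f l + f (l - 1)) / (1 + cos (theta a))"
    "1 \<le> l \<Longrightarrow> l \<le> M \<Longrightarrow> wt a (mirror k (l - 1, l)) = (f l + f (l - 1)) / (1 + cos (theta a))"
  using arms_mirror[OF assms(1)] by (simp_all add: wt_def f_def Let_def add.commute)

lemma mirror_corners_image:
  fixes g :: "int \<times> int \<Rightarrow> real"
  assumes "k \<in> corners (0, 0)"
  shows "(\<Sum>j\<in>corners (0, 0). g (mirror k (mirror j (M, M)))) = (\<Sum>j\<in>corners (0, 0). g (mirror j (M, M)))"
proof -
  have k: "k \<in> {(0,0),(1,0),(0,1),(1,1)}" using assms by (auto simp: corners_def)
  show ?thesis using k by (auto simp: sum_corners mirror_def N_M algebra_simps)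
qed

text \<open>At the corners the values form, up to \<open>kappa a\<close>, the stencil of the coarse
  cell for the value \<open>R_fun n (X a)\<close>: \<open>3 * R_fun n (X a) - 3\<close> on the
  diagonal and 1 at each neighbour.\<close>

lemma Lam_wt:
  assumes "regular a" "k \<in> corners (0, 0)"
  shows "1 \<le> l \<Longrightarrow> l \<le> M \<Longrightarrow> Lam D (X a) (wt a) (mirror k (l, l)) = 0"
    "1 \<le> l \<Longrightarrow> l \<le> M \<Longrightarrow> Lam D (X a) (wt a) (mirror k (l, l - 1)) = 0"
    "1 \<le> l \<Longrightarrow> l \<le> M \<Longrightarrow> Lam D (X a) (wt a) (mirror k (l - 1, l)) = 0"
    "Lam D (X a) (wt a) (mirror k (0, 0)) = kappa a * (if k = (0, 0) then 3 * R_fun n (X a) - 3 else 1)"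
proof -
  note a = assms(1)[unfolded regular_def]
  let ?C = "cos (theta a)"
  define f where "f = (if k = (0, 0) then wt_own a else wt_other a)"
  have C: "?C > -1" using theta_bounds a by auto
  have C0: "1 + ?C \<noteq> 0" using C by simp
  note val = wt_mirror_values[OF assms(2), of _ a, folded f_def]
  note rec = arm_recurrence[OF C X_theta, of "wt a \<circ> mirror k" f, unfolded Lam_mirror o_apply, OF val]
  show "1 \<le> l \<Longrightarrow> l \<le> M \<Longrightarrow> Lam D (X a) (wt a) (mirror k (l, l - 1)) = 0"
    "1 \<le> l \<Longrightarrow> l \<le> M \<Longrightarrow> Lam D (X a) (wt a) (mirror k (l - 1, l)) = 0"
    by (rule rec(2), assumption+, rule rec(3), assumption+)
  have frec: "f (l - 1) + f (l + 1) = 2 * ?C * f l" for l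
    unfolding f_def using wt_own_rec wt_other_rec by simp
  show "Lam D (X a) (wt a) (mirror k (l, l)) = 0" if l: "1 \<le> l" "l \<le> M"
  proof (cases "l < M")
    case True
    then show ?thesis using rec(4)[of l] l frec[of l] by simp
  next
    case False
    then have lM: "l = M" using l by simp
    have "(\<Sum>j\<in>corners (0, 0). wt a (mirror j (M, M))) = wt_own a M + 3 * wt_other a M"
      using wt_mirror_values(1)[of _ M a] M_ge by (simp add: sum_corners corners_def)
    then have S: "(\<Sum>j\<in>corners (0, 0). wt a (mirror k (mirror j (M, M)))) = wt_own a M + 3 * wt_other a M"
      unfolding mirror_corners_image[OF assms(2)] .
    have "f (M - 1) - (2 * ?C + 1) * f M = - (f (M + 1) + f M)"
      using frec[of M] by (simp add: algebra_simps)
    also have "f (M + 1) + f M = wt_other a (M + 1) + wt_other a M"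
      using wt_center(2)[OF assms(1)] by (simp add: f_def)
    finally have e: "f (M - 1) - (2 * ?C + 1) * f M = - (wt_other a (M + 1) + wt_other a M)" .
    have "Lam D (X a) (wt a) (mirror k (M, M))
      = (3 + ?C) / (1 + ?C) * - (wt_other a (M + 1) + wt_other a M) + (wt_own a M + 3 * wt_other a M)"
      using rec(5) unfolding S e .
    also have "\<dots>
        = - ((3 + ?C) * (wt_other a (M + 1) + wt_other a M) / (1 + ?C)) + (wt_own a M + 3 * wt_other a M)"
    proof -
      have "x / z * - y = - (x * y / z)" for x y z :: real by simp
      then show ?thesis by (simp only:)
    qed
    also have "\<dots> = 0" unfolding wt_center(1)[OF assms(1)] using C0 by simp
    finally show ?thesis by (simp add: lM)
  qed
  have own0: "wt_own a 0 = 1" and oth0: "wt_other a 0 = 0" using a by (auto simp: wt_own_def wt_other_def)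
  show "Lam D (X a) (wt a) (mirror k (0, 0)) = kappa a * (if k = (0, 0) then 3 * R_fun n (X a) - 3 else 1)"
  proof -
    have "f 1 - ?C * f 0 = wt_other a 1 * (if k = (0, 0) then 3 * R_fun n (X a) - 3 else 1)"
      using own0 oth0 wt_corner[OF assms(1)] by (simp add: f_def)
    then show ?thesis using rec(1) by (simp only: kappa_def mult.assoc)
  qed
qed

end


section \<open>The extension operator between consecutive levels\<close>

context vicsek begin

declare cells.simps(2) [simp del]

abbreviation K :: "(int \<times> int) set" where "K \<equiv> corners (0, 0)"

text \<open>Addition modulo 2 in both coordinates, the group law of the four reflections.\<close>

definition plus2 :: "int \<times> int \<Rightarrow> int \<times> int \<Rightarrow> int \<times> int" where
  "plus2 k j = (if fst k = fst j then 0 else 1, if snd k = snd j then 0 else 1)"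

lemma K_cases: "k \<in> K \<longleftrightarrow> k = (0,0) \<or> k = (1,0) \<or> k = (0,1) \<or> k = (1,1)"
  by (cases k) (auto simp: corners_def)

lemma plus2_K [simp]: "plus2 k j \<in> K" by (auto simp: plus2_def corners_def)

lemma plus2_zero: "plus2 k j = (0, 0) \<longleftrightarrow> k = j" by (auto simp: plus2_def prod_eq_iff)

lemma mirror_mirror_plus2:
  assumes "k \<in> K" "j \<in> K" shows "mirror k (mirror j y) = mirror (plus2 k j) y"
  using assms unfolding K_cases by (auto simp: mirror_def plus2_def)

lemma refine_K: "j \<in> K \<Longrightarrow> refine j = mirror j (0, 0)"
  unfolding K_cases by (auto simp: refine_def mirror_def)

lemma wt_delta:
  assumes "regular a" "k \<in> K" "j \<in> K"
  shows "wt a (mirror k (refine j)) = (if k = j then 1 else 0)"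
  using wt_mirror_values(1)[of "plus2 k j" 0 a] assms M_ge
  by (auto simp: refine_K mirror_mirror_plus2 plus2_zero wt_own_def wt_other_def regular_def)

definition ext :: "nat \<Rightarrow> real \<Rightarrow> (int \<times> int \<Rightarrow> real) \<Rightarrow> int \<times> int \<Rightarrow> real" where
  "ext m a f y = (let A = SOME A. A \<in> cells m \<and> y \<in> block A in
     \<Sum>k\<in>K. f (fst A + fst k, snd A + snd k) * wt a (mirror k (rel A y)))"

lemma corner_offset:
  assumes "z \<in> corners A"
  shows "(fst z - fst A, snd z - snd A) \<in> K" "rel A (refine z) = refine (fst z - fst A, snd z - snd A)"
  using assms by (auto simp: corners_def rel_def refine_def right_diff_distrib)

lemma ext_at_corner:
  assumes "regular a" "z \<in> corners A"
  shows "(\<Sum>k\<in>K. f (fst A + fst k, snd A + snd k) * wt a (mirror k (rel A (refine z)))) = f z"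
proof -
  define j where "j = (fst z - fst A, snd z - snd A)"
  have j: "j \<in> K" "rel A (refine z) = refine j" using corner_offset[OF assms(2)] by (auto simp: j_def)
  have "(\<Sum>k\<in>K. f (fst A + fst k, snd A + snd k) * wt a (mirror k (rel A (refine z))))
      = (\<Sum>k\<in>K. if k = j then f (fst A + fst k, snd A + snd k) else 0)"
    unfolding j(2) using wt_delta[OF assms(1) _ j(1)] by (intro sum.cong refl) auto
  also have "\<dots> = f z" using j(1) by (simp add: sum.delta' j_def)
  finally show ?thesis .
qed

text \<open>The cell chosen in \<open>ext\<close> is immaterial: two blocks share only refined
  corners, where \<open>wt_delta\<close> makes both formulas return the value of
  \<open>f\<close>.\<close>

lemma ext_block:
  assumes "regular a" "A \<in> cells m" "y \<in> block A"
  shows "ext m a f y = (\<Sum>k\<in>K. f (fst A + fst k, snd A + snd k) * wt a (mirror k (rel A y)))"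
proof -
  define A' where "A' = (SOME A. A \<in> cells m \<and> y \<in> block A)"
  have A': "A' \<in> cells m" "y \<in> block A'"
    using someI[of "\<lambda>A. A \<in> cells m \<and> y \<in> block A" A] assms by (auto simp: A'_def)
  have e: "ext m a f y = (\<Sum>k\<in>K. f (fst A' + fst k, snd A' + snd k) * wt a (mirror k (rel A' y)))"
    by (simp add: ext_def A'_def Let_def)
  show ?thesis
  proof (cases "A = A'")
    case False
    then obtain z where z: "z \<in> corners A" "z \<in> corners A'" "y = refine z"
      using block_inter[of A m A' y] assms A' by blast
    then show ?thesis unfolding e by (simp add: ext_at_corner[OF assms(1)])
  qed (simp add: e)
qed

lemma shift_block: "d \<in> D \<Longrightarrow> x \<in> corners d \<Longrightarrow> shift A x \<in> block A"
  using corners_shift_block[of d "shift A x" A] by (simp add: corners_shift)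

lemma ext_refine:
  assumes "regular a" "z \<in> verts m" shows "ext m a f (refine z) = f z"
proof -
  obtain A where A: "A \<in> cells m" "z \<in> corners A" using assms(2) by (auto simp: verts_def)
  then show ?thesis using ext_block[OF assms(1) A(1), of "refine z" f] ext_at_corner[OF assms(1) A(2)]
    by (simp add: refine_block)
qed

lemma Lam_ext_block:
  assumes "regular a" "A \<in> cells m"
  shows "Lam D lam (ext m a f \<circ> shift A) x
    = (\<Sum>k\<in>K. f (fst A + fst k, snd A + snd k) * Lam D lam (wt a) (mirror k x))"
proof -
  have "Lam D lam (ext m a f \<circ> shift A) x
      = Lam D lam (\<lambda>y. \<Sum>k\<in>K. f (fst A + fst k, snd A + snd k) * (wt a \<circ> mirror k) y) x"
    using ext_block[OF assms] shift_block by (intro Lam_cong) auto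
  also have "\<dots> = (\<Sum>k\<in>K. f (fst A + fst k, snd A + snd k) * Lam D lam (wt a \<circ> mirror k) x)"
    by (rule Lam_sum)
  finally show ?thesis unfolding Lam_mirror .
qed

text \<open>A vertex that is not a refined one lies in a single block, and there the extension is a
  combination of reflected copies of \<open>wt\<close>.\<close>

lemma Lam_ext_interior:
  assumes "regular a" "y \<in> verts (Suc m)" "y \<notin> refine ` verts m"
  shows "Lam (cells (Suc m)) (X a) (ext m a f) y = 0"
proof -
  obtain A where A: "A \<in> cells m" "y \<in> block A" "rel A y \<in> (\<Union>d\<in>D. corners d)"
    using verts_SucE[OF assms(2)] .
  have nc: "y \<noteq> refine z" if "z \<in> corners A" for z using that A(1) assms(3) by (auto simp: verts_def)
  have "Lam D (X a) (wt a) (mirror k (rel A y)) = 0" if k: "k \<in> K" for k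
    using A(3)
  proof (cases rule: D_vertexE)
    case (1 j l)
    have "l \<noteq> 0"
    proof
      assume "l = 0"
      then have "rel A y = refine j" using 1 refine_K by simp
      then have "y = refine (fst A + fst j, snd A + snd j)"
        using shift_rel(1)[of A y] by (simp add: shift_def refine_def distrib_left prod_eq_iff)
      moreover have "(fst A + fst j, snd A + snd j) \<in> corners A" using 1(1) by (auto simp: corners_def)
      ultimately show False using nc by blast
    qed
    then show ?thesis using 1 k Lam_wt(1)[OF assms(1), of "plus2 k j" l] by (simp add: mirror_mirror_plus2)
  next
    case (2 j l)
    then show ?thesis using k Lam_wt(2)[OF assms(1), of "plus2 k j" l] by (simp add: mirror_mirror_plus2)
  next
    case (3 j l)
    then show ?thesis using k Lam_wt(3)[OF assms(1), of "plus2 k j" l] by (simp add: mirror_mirror_plus2)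
  qed
  then have "Lam D (X a) (ext m a f \<circ> shift A) (rel A y) = 0"
    unfolding Lam_ext_block[OF assms(1) A(1)] by simp
  moreover have "{A \<in> cells m. y \<in> block A} = {A}" by (rule interior_block[OF A(1,2)]) (rule nc)
  ultimately show ?thesis unfolding Lam_Suc by simp
qed

text \<open>Spectral decimation as an identity of operators, for arbitrary \<open>f\<close>: summing
  the stencils of \<open>Lam_wt\<close> over the corners of each coarse cell at \<open>z\<close>
  rebuilds \<open>Lc\<close> for the value \<open>R_fun n (X a)\<close>.\<close>

lemma Lam_ext_refine:
  assumes "regular a"
  shows "Lam (cells (Suc m)) (X a) (ext m a f) (refine z) = kappa a * Lam (cells m) (R_fun n (X a)) f z"
proof -
  let ?r = "3 * R_fun n (X a) - 3"
  have "Lam D (X a) (ext m a f \<circ> shift A) (rel A (refine z)) = kappa a * Lc (R_fun n (X a)) f A z"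
    if A: "A \<in> cells m" "z \<in> corners A" for A
  proof -
    define j where "j = (fst z - fst A, snd z - snd A)"
    have j: "j \<in> K" "rel A (refine z) = refine j" using corner_offset[OF A(2)] by (auto simp: j_def)
    have zj: "z = (fst A + fst j, snd A + snd j)" by (simp add: j_def)
    have "Lam D (X a) (ext m a f \<circ> shift A) (rel A (refine z))
        = (\<Sum>k\<in>K. f (fst A + fst k, snd A + snd k) * (kappa a * (if k = j then ?r else 1)))"
      unfolding Lam_ext_block[OF assms A(1)] j(2)
    proof (intro sum.cong refl)
      fix k assume k: "k \<in> K"
      show "f (fst A + fst k, snd A + snd k) * Lam D (X a) (wt a) (mirror k (refine j))
          = f (fst A + fst k, snd A + snd k) * (kappa a * (if k = j then ?r else 1))"
        using Lam_wt(4)[OF assms plus2_K[of k j]]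
        by (simp add: refine_K[OF j(1)] mirror_mirror_plus2[OF k j(1)] plus2_zero)
    qed
    also have "\<dots> = kappa a * (\<Sum>k\<in>K. f (fst A + fst k, snd A + snd k) + (if k = j then (?r - 1) * f z else 0))"
      unfolding sum_distrib_left by (intro sum.cong refl) (auto simp: zj algebra_simps)
    also have "\<dots> = kappa a * ((\<Sum>k\<in>K. f (fst A + fst k, snd A + snd k)) + (?r - 1) * f z)"
      using j(1) by (simp add: sum.distrib)
    also have "(\<Sum>k\<in>K. f (fst A + fst k, snd A + snd k)) = (\<Sum>y\<in>corners A. f y)"
      by (cases A) (simp add: sum_corners)
    finally show ?thesis by (simp add: Lc_def sum_subtractf algebra_simps comp_def)
  qed
  then show ?thesis unfolding Lam_Suc refine_block unfolding Lam_def sum_distrib_left by (intro sum.cong) auto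
qed

lemma refine_verts: "z \<in> verts m \<Longrightarrow> refine z \<in> verts (Suc m)"
proof -
  assume "z \<in> verts m"
  then obtain A where A: "A \<in> cells m" "z \<in> corners A" by (auto simp: verts_def)
  define j where "j = (fst z - fst A, snd z - snd A)"
  have j: "j \<in> K" "rel A (refine z) = mirror j (0, 0)" using corner_offset[OF A(2)] by (auto simp: j_def refine_K)
  have "mirror j (0, 0) \<in> corners (mirrorc j (0, 0))" unfolding corners_mirrorc by (auto simp: corners_def)
  moreover have "mirrorc j (0, 0) \<in> D" unfolding mirrorc_D using N_pos by (simp add: D_def)
  ultimately have "refine z \<in> shift A ` (\<Union>d\<in>D. corners d)"
    by (intro image_eqI[of _ _ "mirror j (0, 0)"]) (auto simp flip: j(2))
  then show ?thesis unfolding verts_Suc using A(1) by blast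
qed

definition vdeg :: "nat \<Rightarrow> int \<times> int \<Rightarrow> real" where
  "vdeg m y = real (card {B \<in> cells m. y \<in> corners B})"

lemma Lam_const_vdeg: "Lam (cells m) lam (\<lambda>_. c) y = 3 * lam * c * vdeg m y"
  by (simp add: Lam_const vdeg_def)

lemma vdeg_pos: "y \<in> verts m \<Longrightarrow> vdeg m y > 0"
  using finite_cells[of m] by (auto simp: vdeg_def verts_def card_gt_0_iff)

text \<open>Integration by parts against the extension of a unit mass recovers the coarse operator.\<close>

lemma Lam_coarse:
  assumes "regular a" "z \<in> verts m"
  shows "(\<Sum>y\<in>verts (Suc m). ext m a (\<lambda>x. if x = z then 1 else 0) y * Lam (cells (Suc m)) (X a) g y)
    = kappa a * Lam (cells m) (R_fun n (X a)) (g \<circ> refine) z"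
proof -
  let ?d = "\<lambda>x. if x = z then 1 else 0 :: real"
  let ?w = "ext m a ?d"
  have "(\<Sum>y\<in>verts (Suc m). ?w y * Lam (cells (Suc m)) (X a) g y)
      = (\<Sum>y\<in>verts (Suc m). g y * Lam (cells (Suc m)) (X a) ?w y)"
    unfolding verts_def by (rule Lam_green[OF finite_cells])
  also have "\<dots> = (\<Sum>y\<in>refine ` verts m. g y * Lam (cells (Suc m)) (X a) ?w y)"
    using Lam_ext_interior[OF assms(1)] refine_verts
    by (intro sum.mono_neutral_right finite_verts) auto
  also have "\<dots> = (\<Sum>x\<in>verts m. g (refine x) * Lam (cells (Suc m)) (X a) ?w (refine x))"
    by (subst sum.reindex) (auto intro: inj_onI)
  also have "\<dots> = kappa a * (\<Sum>x\<in>verts m. (g \<circ> refine) x * Lam (cells m) (R_fun n (X a)) ?d x)"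
    unfolding Lam_ext_refine[OF assms(1)] sum_distrib_left by (simp add: mult_ac)
  also have "(\<Sum>x\<in>verts m. (g \<circ> refine) x * Lam (cells m) (R_fun n (X a)) ?d x)
      = (\<Sum>x\<in>verts m. ?d x * Lam (cells m) (R_fun n (X a)) (g \<circ> refine) x)"
    unfolding verts_def by (rule Lam_green[OF finite_cells])
  also have "\<dots> = (\<Sum>x\<in>verts m. if x = z then Lam (cells m) (R_fun n (X a)) (g \<circ> refine) x else 0)"
    by (intro sum.cong refl) auto
  also have "\<dots> = Lam (cells m) (R_fun n (X a)) (g \<circ> refine) z"
    using assms(2) by (simp add: finite_verts sum.delta')
  finally show ?thesis .
qed

section \<open>Positivity and total mass of the weights at small angles\<close>

lemma small_angle:
  assumes "0 < a" "a \<le> pi / 2"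
  shows "regular a" "0 < sin a" "0 < cos (gam a)" "0 \<le> gam a" "gam a \<le> a"
    "0 < wt_scale a" "0 < kappa a" "a < Nr * pi / 2"
proof -
  show aN: "a < Nr * pi / 2" using assms pi_half_lt by linarith
  have a0: "0 \<le> a" using assms by simp
  show s: "0 < sin a" using assms pi_gt_zero by (intro sin_gt_zero) linarith+
  show g: "0 \<le> gam a" "gam a \<le> a" using gam_bounds[OF a0 aN] assms by auto
  have "gam a < pi / 2" using delta_pos[OF assms(1) aN] assms by (simp add: gam_def)
  then show c: "0 < cos (gam a)" using g by (intro cos_gt_zero_pi) auto
  show "regular a" unfolding regular_def using assms aN s c by auto
  show w: "0 < wt_scale a" unfolding wt_scale_def using s c delta_bounds[OF a0 aN] by simp
  show "0 < kappa a" unfolding kappa_def wt_other_def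
    using w theta_bounds[OF assms(1) aN] by (intro mult_pos_pos divide_pos_pos) auto
qed

lemma index_theta:
  assumes "0 < a" "a \<le> pi / 2" "0 \<le> l" "l \<le> M"
  shows "0 \<le> l * theta a" "l * theta a < a"
proof -
  have t: "0 < theta a" using theta_bounds(1)[OF assms(1) small_angle(8)[OF assms(1,2)]] .
  then show "0 \<le> l * theta a" using assms by simp
  have "l * theta a \<le> M * theta a" using assms t by (intro mult_right_mono) auto
  then show "l * theta a < a" using M_theta(1)[of a] t by linarith
qed

lemma wt_values_nonneg:
  assumes "0 < a" "a \<le> pi / 2" "0 \<le> l" "l \<le> M"
  shows "0 \<le> wt_other a l" "0 \<le> wt_own a l"
proof -
  note i = index_theta[OF assms]
  have s: "0 \<le> sin (l * theta a)" using i assms pi_gt_zero by (intro sin_ge_zero) linarith+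
  then show o: "0 \<le> wt_other a l" unfolding wt_other_def using small_angle(6)[OF assms(1,2)] by simp
  have "0 \<le> sin (a - l * theta a)" using i assms pi_gt_zero by (intro sin_ge_zero) linarith+
  then show "0 \<le> wt_own a l" unfolding wt_own_def using o small_angle(2)[OF assms(1,2)] by simp
qed

lemma block_rel_bounds:
  assumes "y \<in> block A" shows "0 \<le> fst (rel A y)" "fst (rel A y) \<le> N" "0 \<le> snd (rel A y)" "snd (rel A y) \<le> N"
  using assms by (auto simp: block_def rel_def)

text \<open>All sines involved have arguments in \<open>[0, pi / 2]\<close>. Positivity lets
  absolute values pass through the pairing in \<open>coarse_error\<close> and through the averages
  in \<open>eig_bounded\<close>.\<close>

lemma wt_nonneg:
  assumes "0 < a" "a \<le> pi / 2" "0 \<le> fst x" "fst x \<le> N" "0 \<le> snd x" "snd x \<le> N"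
  shows "0 \<le> wt a x"
proof -
  have c: "0 < 1 + cos (theta a)" using theta_bounds(3)[OF assms(1) small_angle(8)[OF assms(1,2)]] by simp
  have m: "0 \<le> min t (N - t)" "min t (N - t) \<le> M" if "0 \<le> t" "t \<le> N" for t
    using that by (auto simp: N_M)
  show ?thesis
    unfolding wt_def arms_def Let_def
    using wt_values_nonneg[OF assms(1,2) m[OF assms(3,4)]] wt_values_nonneg[OF assms(1,2) m[OF assms(5,6)]] c
    by auto
qed

lemma wt_mirror_nonneg:
  assumes "0 < a" "a \<le> pi / 2" "y \<in> block A" shows "0 \<le> wt a (mirror k (rel A y))"
  using block_rel_bounds[OF assms(3)] by (intro wt_nonneg[OF assms(1,2)]) (auto simp: mirror_def)

lemma ext_nonneg:
  assumes "0 < a" "a \<le> pi / 2" "y \<in> verts (Suc m)" "\<And>x. 0 \<le> f x" shows "0 \<le> ext m a f y"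
proof -
  obtain A where A: "A \<in> cells m" "y \<in> block A" using verts_SucE[OF assms(3)] .
  show ?thesis unfolding ext_block[OF small_angle(1)[OF assms(1,2)] A]
    using assms(4) wt_mirror_nonneg[OF assms(1,2) A(2)] by (intro sum_nonneg mult_nonneg_nonneg)
qed

text \<open>The weights are nonnegative, and the same pairing applied to the constant function 1
  computes their total mass exactly. It contains the quotient of \<open>R_fun n (X a)\<close> by
  \<open>X a\<close>, which is at most \<open>rho n\<close>.\<close>

lemma coarse_error:
  assumes a: "0 < a" "a \<le> pi / 2"
    and e: "\<And>y. y \<in> verts (Suc m) \<Longrightarrow> \<bar>Lam (cells (Suc m)) (X a) g y\<bar> \<le> e * vdeg (Suc m) y"
    and z: "z \<in> verts m" and e0: "0 \<le> e"
  shows "\<bar>Lam (cells m) (R_fun n (X a)) (g \<circ> refine) z\<bar> \<le> rho n * e * vdeg m z"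
proof -
  let ?w = "ext m a (\<lambda>x. if x = z then 1 else 0)"
  note sm = small_angle[OF a]
  have w: "0 \<le> ?w y" if "y \<in> verts (Suc m)" for y by (rule ext_nonneg[OF a that]) auto
  have Xp: "0 < X a" using X_strict_mono[of 0 a] a sm(8) by simp
  have "(\<Sum>y\<in>verts (Suc m). ?w y * (3 * X a * vdeg (Suc m) y)) = kappa a * (3 * R_fun n (X a) * vdeg m z)"
    using Lam_coarse[OF sm(1) z, of "\<lambda>_. 1"] by (simp add: Lam_const_vdeg o_def)
  then have "3 * X a * (\<Sum>y\<in>verts (Suc m). ?w y * vdeg (Suc m) y) = 3 * (kappa a * (R_fun n (X a) * vdeg m z))"
    by (simp add: sum_distrib_left mult_ac)
  then have W: "X a * (\<Sum>y\<in>verts (Suc m). ?w y * vdeg (Suc m) y) = kappa a * (R_fun n (X a) * vdeg m z)" by simp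
  have v: "0 \<le> vdeg m z" by (simp add: vdeg_def)
  have "R_fun n (X a) * vdeg m z \<le> rho n * X a * vdeg m z"
    using rho_X_bounds(1)[of a] a v by (intro mult_right_mono) auto
  then have "X a * (\<Sum>y\<in>verts (Suc m). ?w y * vdeg (Suc m) y) \<le> kappa a * (rho n * X a * vdeg m z)"
    unfolding W using sm(7) by (intro mult_left_mono) auto
  also have "\<dots> = X a * (kappa a * (rho n * vdeg m z))" by simp
  finally have W': "(\<Sum>y\<in>verts (Suc m). ?w y * vdeg (Suc m) y) \<le> kappa a * (rho n * vdeg m z)"
    using Xp by simp
  have "kappa a * \<bar>Lam (cells m) (R_fun n (X a)) (g \<circ> refine) z\<bar>
      = \<bar>\<Sum>y\<in>verts (Suc m). ?w y * Lam (cells (Suc m)) (X a) g y\<bar>"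
    unfolding Lam_coarse[OF sm(1) z] abs_mult using sm(7) by simp
  also have "\<dots> \<le> (\<Sum>y\<in>verts (Suc m). \<bar>?w y * Lam (cells (Suc m)) (X a) g y\<bar>)" by (rule sum_abs)
  also have "\<dots> \<le> (\<Sum>y\<in>verts (Suc m). ?w y * (e * vdeg (Suc m) y))"
    unfolding abs_mult using w e by (intro sum_mono mult_mono) auto
  also have "\<dots> = e * (\<Sum>y\<in>verts (Suc m). ?w y * vdeg (Suc m) y)"
    by (simp add: sum_distrib_left mult_ac)
  also have "\<dots> \<le> e * (kappa a * (rho n * vdeg m z))" using W' e0 by (rule mult_left_mono)
  also have "\<dots> = kappa a * (rho n * e * vdeg m z)" by simp
  finally show ?thesis using sm(7) by simp
qed

lemma wt_sum_mirror:
  assumes "k \<in> K" shows "(\<Sum>j\<in>K. wt a (mirror j (mirror k x))) = (\<Sum>j\<in>K. wt a (mirror j x))"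
  using assms unfolding K_cases by (auto simp: sum_corners mirror_def algebra_simps)

text \<open>The extension of the constant 1 is invariant under the reflections; along an arm it is
  one cosine wave, because \<open>cos (delta a) = cos (a - gam a)\<close> merges the two
  sines.\<close>

lemma own_plus_other:
  assumes "regular a"
  shows "wt_own a l + 3 * wt_other a l = cos (l * theta a - gam a) / cos (gam a)"
proof -
  note a = assms[unfolded regular_def]
  have "cos (delta a) = cos a * cos (gam a) + sin a * sin (gam a)"
    using cos_diff[of a "gam a"] by (simp add: gam_def)
  then have "cos (gam a) * sin (a - l * theta a) + cos (delta a) * sin (l * theta a) = sin a * cos (l * theta a - gam a)"
    by (simp add: sin_diff cos_diff algebra_simps)
  then have "(cos (gam a) * sin (a - l * theta a) + cos (delta a) * sin (l * theta a)) / (sin a * cos (gam a))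
      = cos (l * theta a - gam a) / cos (gam a)" using a by simp
  moreover have "wt_own a l + 3 * wt_other a l = (cos (gam a) * sin (a - l * theta a) + cos (delta a) * sin (l * theta a)) / (sin a * cos (gam a))"
    unfolding wt_own_def wt_other_def wt_scale_def using a by (simp add: field_simps)
  ultimately show ?thesis by simp
qed

lemma wt_sum_arm:
  assumes "0 \<le> l" "l \<le> M"
  shows "(\<Sum>j\<in>K. wt a (mirror j (l, l))) = wt_own a l + 3 * wt_other a l"
  using wt_mirror_values(1)[of _ l a] assms by (simp add: sum_corners corners_def)

lemma wt_sum_side:
  assumes "1 \<le> l" "l \<le> M"
  shows "(\<Sum>j\<in>K. wt a (mirror j (l, l - 1))) = ((wt_own a l + 3 * wt_other a l) + (wt_own a (l - 1) + 3 * wt_other a (l - 1))) / (1 + cos (theta a))"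
    "(\<Sum>j\<in>K. wt a (mirror j (l - 1, l))) = ((wt_own a l + 3 * wt_other a l) + (wt_own a (l - 1) + 3 * wt_other a (l - 1))) / (1 + cos (theta a))"
  using wt_mirror_values(2,3)[of _ l a] assms
  by (simp_all add: sum_corners corners_def add_divide_distrib)

text \<open>Measures how far the weights are from a partition of unity. Every total is
  \<open>cos q / (cos (gam a) * v)\<close> with \<open>\<bar>q\<bar> \<le> a\<close>, where
  \<open>v\<close> is 1 on an arm and \<open>cos (theta a / 2)\<close> at a side vertex; each cosine
  differs from 1 by at most \<open>a\<^sup>2 / 2\<close>.\<close>

lemma wt_sum_bounds:
  assumes a: "0 < a" "a\<^sup>2 \<le> 1/2" and x: "x \<in> (\<Union>d\<in>D. corners d)"
  shows "\<bar>(\<Sum>j\<in>K. wt a (mirror j x)) - 1\<bar> \<le> 2 * a\<^sup>2"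
proof -
  have "a < 1" using a by (intro power2_less_imp_less[of a 1]) auto
  then have a2: "a \<le> pi / 2" using pi_gt3 by simp
  note sm = small_angle[OF a(1) a2]
  define p where "p = theta a / 2"
  have t: "0 < theta a" using theta_bounds(1)[OF a(1) sm(8)] .
  have "theta a \<le> 2 * a / 3"
  proof -
    have "2 * a / Nr \<le> 2 * a / 3" using a Nr_ge by (intro divide_left_mono) auto
    then show ?thesis by (simp add: theta_def)
  qed
  then have p: "0 < p" "p \<le> a" "theta a = 2 * p" using t by (auto simp: p_def)
  have cq: "1 - a\<^sup>2 / 2 \<le> cos q" if "\<bar>q\<bar> \<le> a" for q
  proof -
    have "q\<^sup>2 \<le> a\<^sup>2" using that a by (metis abs_le_square_iff abs_of_pos)
    then show ?thesis using cos_ge_quadratic[of q] by linarith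
  qed
  define c where "c = 1 - a\<^sup>2 / 2"
  have c: "0 < c" "3/4 \<le> c" using a by (auto simp: c_def)
  have cg: "c \<le> cos (gam a)" and cp: "c \<le> cos p" using cq sm p by (auto simp: c_def)
  have cc: "1 - a\<^sup>2 \<le> c * c" by (simp add: c_def algebra_simps)
  have gen: "\<bar>cos q / (cos (gam a) * v) - 1\<bar> \<le> 2 * a\<^sup>2" if q: "\<bar>q\<bar> \<le> a" and v: "c \<le> v" "v \<le> 1" for q v
  proof -
    have w: "c * c \<le> cos (gam a) * v" "cos (gam a) * v \<le> 1"
      using cg v c sm by (auto intro!: mult_mono mult_le_one)
    have w0: "0 < cos (gam a) * v" using w(1) c by (smt (verit) mult_pos_pos)
    have "cos q / (cos (gam a) * v) \<ge> cos q / 1" using cq[OF q] c w w0 by (intro divide_left_mono) (auto simp: c_def)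
    moreover have "cos q \<ge> 1 - a\<^sup>2" using cq[OF q] zero_le_power2[of a] by linarith
    moreover have "cos q / (cos (gam a) * v) \<le> 1 + 2 * a\<^sup>2"
    proof -
      \<comment> \<open>This yields \<open>1 / (1 - a\<^sup>2) \<le> 1 + 2 * a\<^sup>2\<close>; the
        hypothesis \<open>a\<^sup>2 \<le> 1/2\<close> is what it takes.\<close>
      have "(1 + 2 * a\<^sup>2) * (1 - a\<^sup>2) = 1 + a\<^sup>2 * (1 - 2 * a\<^sup>2)" by (simp add: algebra_simps)
      moreover have "0 \<le> a\<^sup>2 * (1 - 2 * a\<^sup>2)" using a by (intro mult_nonneg_nonneg) auto
      ultimately have "1 \<le> (1 + 2 * a\<^sup>2) * (1 - a\<^sup>2)" by simp
      also have "\<dots> \<le> (1 + 2 * a\<^sup>2) * (cos (gam a) * v)" using w cc by (intro mult_left_mono) auto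
      finally have "cos q \<le> (1 + 2 * a\<^sup>2) * (cos (gam a) * v)" using cos_le_one[of q] by linarith
      then show ?thesis using w0 by (simp add: pos_divide_le_eq)
    qed
    ultimately show ?thesis using zero_le_power2[of a] unfolding div_by_1 by linarith
  qed
  have arm: "\<bar>(\<Sum>j\<in>K. wt a (mirror j (l, l))) - 1\<bar> \<le> 2 * a\<^sup>2" if "0 \<le> l" "l \<le> M" for l
    using gen[of "l * theta a - gam a" 1] index_theta[OF a(1) a2 that] sm c_def
    unfolding wt_sum_arm[OF that] own_plus_other[OF sm(1)] by auto
  have "\<bar>((wt_own a l + 3 * wt_other a l) + (wt_own a (l - 1) + 3 * wt_other a (l - 1))) / (1 + cos (theta a)) - 1\<bar> \<le> 2 * a\<^sup>2"
    if l: "1 \<le> l" "l \<le> M" for l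
  proof -
    define q where "q = l * theta a - gam a - p"
    have "0 \<le> real_of_int l * theta a - theta a"
      using index_theta(1)[OF a(1) a2, of "l - 1"] l by (simp add: left_diff_distrib)
    then have q: "\<bar>q\<bar> \<le> a" using index_theta(2)[OF a(1) a2, of l] sm(4,5) l p
      unfolding q_def abs_le_iff by linarith
    have e: "l * theta a - gam a = q + p" "real_of_int (l - 1) * theta a - gam a = q - p"
      using p by (auto simp: q_def algebra_simps)
    have C: "1 + cos (theta a) = 2 * cos p * cos p" unfolding p(3) cos_double_cos by (simp add: power2_eq_square)
    have "((wt_own a l + 3 * wt_other a l) + (wt_own a (l - 1) + 3 * wt_other a (l - 1))) / (1 + cos (theta a))
        = (cos (q + p) + cos (q - p)) / cos (gam a) / (2 * cos p * cos p)"
      unfolding own_plus_other[OF sm(1)] e C by (simp add: add_divide_distrib)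
    also have "\<dots> = cos q / (cos (gam a) * cos p)"
      using cp c sm by (simp add: cos_add cos_diff field_simps)
    finally show ?thesis using gen[OF q cp] by simp
  qed
  note side = this
  show ?thesis using x
  proof (cases rule: D_vertexE)
    case (1 k l)
    then show ?thesis using arm[of l] by (simp add: wt_sum_mirror)
  next
    case (2 k l)
    then show ?thesis using side[of l] by (simp add: wt_sum_mirror wt_sum_side)
  next
    case (3 k l)
    then show ?thesis using side[of l] by (simp add: wt_sum_mirror wt_sum_side)
  qed
qed

end

section \<open>Solutions on a single subdivided cell\<close>

context vicsek begin

definition arm_b :: "real \<Rightarrow> (int \<times> int \<Rightarrow> real) \<Rightarrow> int \<times> int \<Rightarrow> real" where
  "arm_b a g k = (g (mirror k (1, 1)) - g (mirror k (0, 0)) * cos (theta a)) / sin (theta a)"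

text \<open>The general solution of the recurrence, fitted to \<open>g\<close> at the first two arm
  vertices.\<close>

definition arm_wave :: "real \<Rightarrow> (int \<times> int \<Rightarrow> real) \<Rightarrow> int \<times> int \<Rightarrow> int \<Rightarrow> real" where
  "arm_wave a g k l = g (mirror k (0, 0)) * cos (l * theta a) + arm_b a g k * sin (l * theta a)"

lemma arm_wave_rec: "arm_wave a g k (l - 1) + arm_wave a g k (l + 1) = 2 * cos (theta a) * arm_wave a g k l"
proof -
  have "cos (x - t) + cos (x + t) = 2 * cos t * cos x" "sin (x - t) + sin (x + t) = 2 * cos t * sin x" for t x :: real
    by (simp_all add: cos_add cos_diff sin_add sin_diff)
  note id = this[where t = "theta a" and x = "l * theta a"]
  have e: "real_of_int (l - 1) * theta a = l * theta a - theta a" "real_of_int (l + 1) * theta a = l * theta a + theta a"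
    by (simp_all add: algebra_simps)
  have "arm_wave a g k (l - 1) + arm_wave a g k (l + 1)
      = g (mirror k (0, 0)) * (cos (l * theta a - theta a) + cos (l * theta a + theta a))
        + arm_b a g k * (sin (l * theta a - theta a) + sin (l * theta a + theta a))"
    unfolding arm_wave_def e by (simp only: distrib_left add_ac)
  also have "\<dots> = 2 * cos (theta a) * arm_wave a g k l"
    unfolding id arm_wave_def by (simp add: algebra_simps)
  finally show ?thesis .
qed

context
  fixes a :: real and g :: "int \<times> int \<Rightarrow> real"
  assumes a: "0 < a" "a < Nr * pi / 2"
    and interior: "\<And>k l. k \<in> K \<Longrightarrow> 1 \<le> l \<Longrightarrow> l \<le> M \<Longrightarrow>
      Lam D (X a) g (mirror k (l, l)) = 0 \<and> Lam D (X a) g (mirror k (l, l - 1)) = 0 \<and> Lam D (X a) g (mirror k (l - 1, l)) = 0"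
begin

text \<open>The two side equations differ by \<open>(3 + cos (theta a)) * (s - s') = 0\<close>, so
  both side values agree and either equation determines them.\<close>

lemma solution_sides:
  assumes "k \<in> K" "1 \<le> l" "l \<le> M"
  shows "g (mirror k (l, l - 1)) = (g (mirror k (l, l)) + g (mirror k (l - 1, l - 1))) / (1 + cos (theta a))"
    "g (mirror k (l - 1, l)) = (g (mirror k (l, l)) + g (mirror k (l - 1, l - 1))) / (1 + cos (theta a))"
proof -
  define s s' p where "s = g (mirror k (l, l - 1))" "s' = g (mirror k (l - 1, l))"
    "p = g (mirror k (l, l)) + g (mirror k (l - 1, l - 1))"
  have C: "1 + cos (theta a) > 0" using theta_bounds(3)[OF a] by simp
  have "p + s' - (3 - 3 * X a) * s = 0" "p + s - (3 - 3 * X a) * s' = 0"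
    using interior[OF assms] Lam_side[OF assms(2,3), of "X a" "g \<circ> mirror k"]
    unfolding Lam_mirror by (auto simp: s_s'_p_def)
  moreover have "3 - 3 * X a = 2 + cos (theta a)" by (simp add: X_theta field_simps)
  ultimately have e: "p + s' - (2 + cos (theta a)) * s = 0" "p + s - (2 + cos (theta a)) * s' = 0" by simp_all
  then have "(3 + cos (theta a)) * (s - s') = 0" by (simp add: algebra_simps)
  then have ss: "s = s'" using C by auto
  then have "s * (1 + cos (theta a)) = p" using e by (simp add: algebra_simps)
  then have "s = p / (1 + cos (theta a))" using C by (simp add: field_simps)
  then show "g (mirror k (l, l - 1)) = (g (mirror k (l, l)) + g (mirror k (l - 1, l - 1))) / (1 + cos (theta a))"
    "g (mirror k (l - 1, l)) = (g (mirror k (l, l)) + g (mirror k (l - 1, l - 1))) / (1 + cos (theta a))"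
    using ss by (auto simp: s_s'_p_def)
qed

lemmas solution_rec = arm_recurrence[OF theta_bounds(3)[OF a] X_theta, of "g \<circ> mirror k" "\<lambda>l. g (mirror k (l, l))" for k,
  unfolded Lam_mirror o_apply, OF HOL.refl solution_sides]

lemma solution_arm:
  assumes "k \<in> K" "0 \<le> l" "l \<le> M" shows "g (mirror k (l, l)) = arm_wave a g k l"
proof -
  let ?f = "\<lambda>l. g (mirror k (l, l))"
  have C: "(3 + cos (theta a)) / (1 + cos (theta a)) \<noteq> 0" using theta_bounds(3)[OF a] by auto
  have rec: "?f (l - 1) + ?f (l + 1) = 2 * cos (theta a) * ?f l" if "1 \<le> l" "l < M" for l
    using solution_rec(4)[OF assms(1), of l] interior[OF assms(1), of l] that C assms(1) by auto
  have "int j \<le> M \<longrightarrow> ?f (int j) = arm_wave a g k (int j)" for j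
  proof (induction j rule: induct_nat_012)
    case 0
    then show ?case by (simp add: arm_wave_def)
  next
    case 1
    then show ?case using theta_bounds(4)[OF a] by (simp add: arm_wave_def arm_b_def)
  next
    case (ge2 j)
    show ?case
    proof
      assume j: "int (Suc (Suc j)) \<le> M"
      have "?f (int j) + ?f (int j + 2) = 2 * cos (theta a) * ?f (int j + 1)" using rec[of "int j + 1"] j by (simp add: add.commute)
      moreover have "arm_wave a g k (int j) + arm_wave a g k (int j + 2) = 2 * cos (theta a) * arm_wave a g k (int j + 1)"
        using arm_wave_rec[of a g k "int j + 1"] by (simp add: add.commute)
      moreover have "?f (int j) = arm_wave a g k (int j)" "?f (int j + 1) = arm_wave a g k (int j + 1)"
        using ge2 j by (simp_all add: add.commute)
      ultimately have "?f (int j + 2) = arm_wave a g k (int j + 2)" by simp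
      then show "?f (int (Suc (Suc j))) = arm_wave a g k (int (Suc (Suc j)))" by (simp add: algebra_simps)
    qed
  qed
  from this[of "nat l"] show ?thesis using assms by simp
qed

text \<open>The equation at \<open>(M, M)\<close> with the wave continued to \<open>M + 1\<close>.
  Its right-hand side does not depend on the arm, which forces equal amplitudes in
  \<open>dirichlet_zero\<close> and \<open>neumann_angle\<close>.\<close>

lemma solution_center:
  assumes "k \<in> K"
  shows "(3 + cos (theta a)) * (arm_wave a g k (M + 1) + arm_wave a g k M) = (1 + cos (theta a)) * (\<Sum>j\<in>K. arm_wave a g j M)"
proof -
  let ?C = "cos (theta a)"
  have C: "1 + ?C > 0" using theta_bounds(3)[OF a] by simp
  have "(\<Sum>j\<in>K. g (mirror k (mirror j (M, M)))) = (\<Sum>j\<in>K. arm_wave a g j M)"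
    unfolding mirror_corners_image[OF assms] using solution_arm M_ge by (intro sum.cong) auto
  moreover have "g (mirror k (M - 1, M - 1)) - (2 * ?C + 1) * g (mirror k (M, M)) = - (arm_wave a g k (M + 1) + arm_wave a g k M)"
    using solution_arm[OF assms] M_ge arm_wave_rec[of a g k M] by (simp add: algebra_simps)
  moreover have "Lam D (X a) g (mirror k (M, M)) = 0" using interior[OF assms, of M] M_ge by simp
  ultimately have "(3 + ?C) / (1 + ?C) * - (arm_wave a g k (M + 1) + arm_wave a g k M) + (\<Sum>j\<in>K. arm_wave a g j M) = 0"
    using solution_rec(5)[OF assms] assms by simp
  then show ?thesis using C by (simp add: field_simps)
qed

lemma solution_zero:
  assumes arm0: "\<And>k l. k \<in> K \<Longrightarrow> 0 \<le> l \<Longrightarrow> l \<le> M \<Longrightarrow> arm_wave a g k l = 0"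
    and y: "y \<in> (\<Union>d\<in>D. corners d)"
  shows "g y = 0"
  using y
proof (cases rule: D_vertexE)
  case (1 k l)
  then show ?thesis using solution_arm[of k l] arm0 by simp
next
  case (2 k l)
  then show ?thesis using solution_sides[of k l] solution_arm[of k l] solution_arm[of k "l - 1"] arm0 by simp
next
  case (3 k l)
  then show ?thesis using solution_sides[of k l] solution_arm[of k l] solution_arm[of k "l - 1"] arm0 by simp
qed

lemma half_theta:
  defines "p \<equiv> a / Nr"
  shows "0 < sin p" "0 < cos p" "theta a = 2 * p" "real_of_int (M + 1) * theta a = a + p" "M * theta a = a - p"
    "1 + cos (theta a) = 2 * (cos p)\<^sup>2" "3 + cos (theta a) = 2 + 2 * (cos p)\<^sup>2"
proof -
  have p: "0 < p" "p < pi / 2" using half_angle[of a] a Nr_pos by (auto simp: p_def)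
  then show "0 < sin p" "0 < cos p" by (auto intro!: sin_gt_zero cos_gt_zero)
  show t: "theta a = 2 * p" by (simp add: theta_def p_def)
  show "real_of_int (M + 1) * theta a = a + p" "M * theta a = a - p" using M_theta[of a] t by (simp_all add: of_int_add)
  show "1 + cos (theta a) = 2 * (cos p)\<^sup>2" "3 + cos (theta a) = 2 + 2 * (cos p)\<^sup>2" unfolding t cos_double_cos by simp_all
qed

text \<open>Zero corner values leave pure sine waves. As \<open>sin a > 0\<close>,
  \<open>solution_center\<close> makes their four amplitudes equal and then equates a positive
  multiple of the common amplitude to 0.\<close>

lemma dirichlet_zero:
  assumes a2: "a \<le> pi / 2" and z: "\<And>k. k \<in> K \<Longrightarrow> g (mirror k (0, 0)) = 0"
    and y: "y \<in> (\<Union>d\<in>D. corners d)"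
  shows "g y = 0"
proof -
  define s c u v where "s = sin a" "c = cos a" "u = sin (a / Nr)" "v = cos (a / Nr)"
  note h = half_theta
  have uv: "0 < u" "0 < v" using h by (auto simp: s_c_u_v_def)
  have sc: "0 < s" "0 \<le> c" using small_angle(2)[OF a(1) a2] a a2 by (auto simp: s_c_u_v_def intro!: cos_ge_zero)
  let ?b = "arm_b a g"
  have w: "arm_wave a g k l = ?b k * sin (l * theta a)" if "k \<in> K" for k l
    using z[OF that] by (simp add: arm_wave_def)
  have eq: "(2 + 2 * v\<^sup>2) * (?b k * (2 * s * v)) = 2 * v\<^sup>2 * ((\<Sum>j\<in>K. ?b j) * (s * v - c * u))" if "k \<in> K" for k
  proof -
    have "arm_wave a g k (M + 1) + arm_wave a g k M = ?b k * (2 * s * v)"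
      unfolding w[OF that] h(4,5) by (simp add: sin_add sin_diff s_c_u_v_def algebra_simps)
    moreover have "(\<Sum>j\<in>K. arm_wave a g j M) = (\<Sum>j\<in>K. ?b j) * (s * v - c * u)"
      unfolding sum_distrib_right by (intro sum.cong refl) (simp add: w h(5) sin_diff s_c_u_v_def)
    ultimately show ?thesis using solution_center[OF that] unfolding h(6,7) by (simp add: s_c_u_v_def)
  qed
  have "2 + 2 * v\<^sup>2 > 0" by (simp add: add_pos_nonneg)
  then have pos: "(2 + 2 * v\<^sup>2) * (2 * s * v) \<noteq> 0" using uv sc by simp
  have K0: "(0, 0) \<in> K" by (simp add: corners_def)
  have same: "?b k = ?b (0, 0)" if "k \<in> K" for k
  proof -
    have "((2 + 2 * v\<^sup>2) * (2 * s * v)) * ?b k = ((2 + 2 * v\<^sup>2) * (2 * s * v)) * ?b (0, 0)"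
      using eq[OF that] eq[OF K0] by (simp only: mult_ac)
    then show ?thesis using pos by simp
  qed
  then have "(\<Sum>j\<in>K. ?b j) = 4 * ?b (0, 0)" by simp
  then have "?b (0, 0) * ((2 + 2 * v\<^sup>2) * (2 * s * v) - 8 * v\<^sup>2 * (s * v - c * u)) = 0"
    using eq[OF K0] by (simp add: algebra_simps)
  moreover have "(2 + 2 * v\<^sup>2) * (2 * s * v) - 8 * v\<^sup>2 * (s * v - c * u) = 4 * v * (s * (1 - v\<^sup>2) + 2 * c * v * u)"
    by (simp add: algebra_simps power2_eq_square)
  moreover have "1 - v\<^sup>2 = u\<^sup>2" unfolding s_c_u_v_def using sin_squared_eq[of "a / Nr"] by simp
  moreover have "4 * v * (s * u\<^sup>2 + 2 * c * v * u) > 0" using uv sc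
    by (intro mult_pos_pos add_pos_nonneg) auto
  ultimately have "?b (0, 0) = 0" by auto
  then have "?b k = 0" if "k \<in> K" for k using same[OF that] by simp
  then show ?thesis using y by (intro solution_zero) (auto simp: w)
qed

text \<open>The corner equations remove the sine parts. If \<open>cos a \<noteq> 0\<close>, matching
  at the center makes the four cosine amplitudes equal, and a nonzero common amplitude requires
  \<open>2 * sin a = cos a * tan (a / Nr)\<close>, that is, \<open>sin (gam a) = 0\<close>.\<close>

lemma neumann_angle:
  assumes corner: "\<And>k. k \<in> K \<Longrightarrow> Lam D (X a) g (mirror k (0, 0)) = 0"
    and y: "y \<in> (\<Union>d\<in>D. corners d)" "g y \<noteq> 0"
  shows "cos a = 0 \<or> sin (gam a) = 0"
proof (rule ccontr)
  assume neg: "\<not> (cos a = 0 \<or> sin (gam a) = 0)"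
  define s c u v where "s = sin a" "c = cos a" "u = sin (a / Nr)" "v = cos (a / Nr)"
  note h = half_theta
  have uv: "0 < u" "0 < v" using h by (auto simp: s_c_u_v_def)
  have C: "(3 + cos (theta a)) / (1 + cos (theta a)) \<noteq> 0" using theta_bounds(3)[OF a] by auto
  have b0: "arm_b a g k = 0" if "k \<in> K" for k
    using solution_rec(1)[OF that] corner[OF that] that C by (auto simp: arm_b_def mult.commute)
  let ?f = "\<lambda>k. g (mirror k (0, 0))"
  have w: "arm_wave a g k l = ?f k * cos (l * theta a)" if "k \<in> K" for k l
    using b0[OF that] by (simp add: arm_wave_def)
  have eq: "(2 + 2 * v\<^sup>2) * (?f k * (2 * c * v)) = 2 * v\<^sup>2 * ((\<Sum>j\<in>K. ?f j) * (c * v + s * u))" if "k \<in> K" for k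
  proof -
    have "arm_wave a g k (M + 1) + arm_wave a g k M = ?f k * (2 * c * v)"
      unfolding w[OF that] h(4,5) by (simp add: cos_add cos_diff s_c_u_v_def algebra_simps)
    moreover have "(\<Sum>j\<in>K. arm_wave a g j M) = (\<Sum>j\<in>K. ?f j) * (c * v + s * u)"
      unfolding sum_distrib_right by (intro sum.cong refl) (simp add: w h(5) cos_diff s_c_u_v_def)
    ultimately show ?thesis using solution_center[OF that] unfolding h(6,7) by (simp add: s_c_u_v_def)
  qed
  have c0: "c \<noteq> 0" using neg by (simp add: s_c_u_v_def)
  have "2 + 2 * v\<^sup>2 > 0" by (simp add: add_pos_nonneg)
  then have pos: "(2 + 2 * v\<^sup>2) * (2 * c * v) \<noteq> 0" using uv c0 by simp
  have K0: "(0, 0) \<in> K" by (simp add: corners_def)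
  have same: "?f k = ?f (0, 0)" if "k \<in> K" for k
  proof -
    have "((2 + 2 * v\<^sup>2) * (2 * c * v)) * ?f k = ((2 + 2 * v\<^sup>2) * (2 * c * v)) * ?f (0, 0)"
      using eq[OF that] eq[OF K0] by (simp only: mult_ac)
    then show ?thesis using pos by simp
  qed
  then have "(\<Sum>j\<in>K. ?f j) = 4 * ?f (0, 0)" by simp
  then have "?f (0, 0) * ((2 + 2 * v\<^sup>2) * (2 * c * v) - 8 * v\<^sup>2 * (c * v + s * u)) = 0"
    using eq[OF K0] by (simp add: algebra_simps)
  moreover have "(2 + 2 * v\<^sup>2) * (2 * c * v) - 8 * v\<^sup>2 * (c * v + s * u) = 4 * v * (c * (1 - v\<^sup>2) - 2 * s * v * u)"
    by (simp add: algebra_simps power2_eq_square)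
  moreover have "1 - v\<^sup>2 = u\<^sup>2" unfolding s_c_u_v_def using sin_squared_eq[of "a / Nr"] by simp
  moreover have "4 * v * (c * u\<^sup>2 - 2 * s * v * u) \<noteq> 0"
  proof
    assume "4 * v * (c * u\<^sup>2 - 2 * s * v * u) = 0"
    then have "u * (c * u - 2 * s * v) = 0" using uv by (simp add: algebra_simps power2_eq_square)
    then have "c * u = 2 * s * v" using uv by simp
    then have "2 * s - c * (u / v) = 0" using uv by (simp add: field_simps)
    then have "2 * sin a - cos a * tan (a / Nr) = 0" by (simp add: s_c_u_v_def tan_def)
    then have "sin (gam a) = 0" using sin_gam(1)[of a] a by simp
    then show False using neg by simp
  qed
  ultimately have "?f (0, 0) = 0" by auto
  then have "?f k = 0" if "k \<in> K" for k using same[OF that] by simp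
  then have "g y = 0" using y(1) by (intro solution_zero) (auto simp: w)
  then show False using y(2) by simp
qed

end

lemma interior_mirror_vertices:
  assumes "k \<in> K" "1 \<le> l" "l \<le> M" "x \<in> {(l, l), (l, l - 1), (l - 1, l)}"
  shows "mirror k x \<in> (\<Union>d\<in>D. corners d)" "j \<in> K \<Longrightarrow> mirror k x \<noteq> refine j"
proof -
  have "(l - 1, l - 1) \<in> D" using assms by (auto simp: D_def N_M)
  then have "mirrorc k (l - 1, l - 1) \<in> D" by (simp add: mirrorc_D)
  moreover have "x \<in> corners (l - 1, l - 1)" using assms(4) by (auto simp: corners_def)
  then have "mirror k x \<in> corners (mirrorc k (l - 1, l - 1))" by (simp add: corners_mirrorc)
  ultimately show "mirror k x \<in> (\<Union>d\<in>D. corners d)" by blast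
  show "mirror k x \<noteq> refine j" if "j \<in> K"
  proof
    assume "mirror k x = refine j"
    then have "x = mirror k (refine j)" by (metis mirror_mirror)
    then have "x = refine (plus2 k j)" using that assms(1) by (simp add: refine_K mirror_mirror_plus2)
    moreover have "fst (refine i) \<in> {0, N} \<and> snd (refine i) \<in> {0, N}" if "i \<in> K" for i
      using that by (auto simp: refine_def corners_def)
    ultimately have "fst x \<in> {0, N} \<and> snd x \<in> {0, N}" by simp
    then show False using assms by (auto simp: N_M)
  qed
qed

lemma Lam_shift_interior:
  assumes "A \<in> cells m" "x \<in> (\<Union>d\<in>D. corners d)" "\<And>j. j \<in> K \<Longrightarrow> x \<noteq> refine j"
  shows "Lam (cells (Suc m)) lam g (shift A x) = Lam D lam (g \<circ> shift A) x"
proof -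
  obtain d where "d \<in> D" "x \<in> corners d" using assms(2) by auto
  then have b: "shift A x \<in> block A" by (rule shift_block)
  have "{B \<in> cells m. shift A x \<in> block B} = {A}"
  proof (rule interior_block[OF assms(1) b])
    fix z assume z: "z \<in> corners A"
    show "shift A x \<noteq> refine z"
    proof
      assume "shift A x = refine z"
      then have "x = rel A (refine z)" by (metis shift_rel(2))
      then show False using corner_offset[OF z] assms(3) by auto
    qed
  qed
  then show ?thesis unfolding Lam_Suc by simp
qed

text \<open>The bound \<open>a \<le> pi / 2\<close> keeps \<open>X a\<close> below the first Dirichlet eigenvalue of a subdivided cell.\<close>

lemma fine_zero:
  assumes a: "0 < a" "a \<le> pi / 2"
    and L: "\<And>y. y \<in> verts (Suc m) \<Longrightarrow> Lam (cells (Suc m)) (X a) g y = 0"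
    and z: "\<And>z. z \<in> verts m \<Longrightarrow> g (refine z) = 0"
    and y: "y \<in> verts (Suc m)"
  shows "g y = 0"
proof -
  obtain A where A: "A \<in> cells m" "y \<in> block A" "rel A y \<in> (\<Union>d\<in>D. corners d)"
    using verts_SucE[OF y] .
  note sm = small_angle[OF a]
  have v: "shift A x \<in> verts (Suc m)" if "x \<in> (\<Union>d\<in>D. corners d)" for x
    using that A(1) unfolding verts_Suc by blast
  have "(g \<circ> shift A) (rel A y) = 0"
  proof (rule dirichlet_zero[OF a(1) sm(8) _ a(2) _ A(3)])
    fix k l assume k: "k \<in> K" "1 \<le> l" "l \<le> M"
    have "Lam D (X a) (g \<circ> shift A) (mirror k x) = 0" if "x \<in> {(l, l), (l, l - 1), (l - 1, l)}" for x
    proof -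
      note im = interior_mirror_vertices[OF k that]
      have "Lam (cells (Suc m)) (X a) g (shift A (mirror k x)) = Lam D (X a) (g \<circ> shift A) (mirror k x)"
        by (rule Lam_shift_interior[OF A(1) im(1)]) (rule im(2))
      then show ?thesis using L[OF v[OF im(1)]] by simp
    qed
    then show "Lam D (X a) (g \<circ> shift A) (mirror k (l, l)) = 0 \<and> Lam D (X a) (g \<circ> shift A) (mirror k (l, l - 1)) = 0 \<and>
        Lam D (X a) (g \<circ> shift A) (mirror k (l - 1, l)) = 0" by simp
  next
    fix k assume k: "k \<in> K"
    have "shift A (mirror k (0, 0)) = refine (fst A + fst k, snd A + snd k)"
      unfolding refine_K[OF k, symmetric] by (simp add: shift_def refine_def distrib_left)
    moreover have "(fst A + fst k, snd A + snd k) \<in> verts m"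
      unfolding verts_def using A(1) k by (intro UN_I[of A]) (auto simp: corners_def)
    ultimately show "(g \<circ> shift A) (mirror k (0, 0)) = 0" using z by simp
  qed
  then show ?thesis by simp
qed

text \<open>Level 1 is one subdivided cell with free corners, so the equation holds at the corners
  too.\<close>

lemma level1_angle:
  assumes a: "0 < a" "a < Nr * pi / 2"
    and L: "\<And>y. y \<in> verts 1 \<Longrightarrow> Lam (cells 1) (X a) g y = 0"
    and y: "y \<in> verts 1" "g y \<noteq> 0"
  shows "cos a = 0 \<or> sin (gam a) = 0"
proof -
  have v: "verts 1 = (\<Union>d\<in>D. corners d)" by (simp add: verts_def cells_1)
  have L': "Lam D (X a) g y = 0" if "y \<in> (\<Union>d\<in>D. corners d)" for y
    using L that unfolding v by (simp add: cells_1)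
  show ?thesis
  proof (rule neumann_angle[OF a])
    fix k l assume "k \<in> K" "1 \<le> l" "l \<le> M"
    then show "Lam D (X a) g (mirror k (l, l)) = 0 \<and> Lam D (X a) g (mirror k (l, l - 1)) = 0 \<and> Lam D (X a) g (mirror k (l - 1, l)) = 0"
      using interior_mirror_vertices(1) L' by simp
  next
    fix k assume k: "k \<in> K"
    have "refine k \<in> verts (Suc 0)" by (rule refine_verts) (use k in \<open>simp add: verts_def\<close>)
    then show "Lam D (X a) g (mirror k (0, 0)) = 0" using L' v by (simp add: refine_K[OF k, symmetric])
  next
    show "y \<in> (\<Union>d\<in>D. corners d)" "g y \<noteq> 0" using y v by auto
  qed
qed

end

section \<open>Realization in the plane\<close>

context vicsek begin

definition pt :: "nat \<Rightarrow> int \<times> int \<Rightarrow> real \<times> real" where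
  "pt m y = (real_of_int (fst y) / Nr ^ m, real_of_int (snd y) / Nr ^ m)"

lemma pt_refine [simp]: "pt (Suc m) (refine y) = pt m y"
  using Nr_pos by (simp add: pt_def refine_def real_N)

lemma pt_eq_iff [simp]: "pt m y = pt m z \<longleftrightarrow> y = z"
  using Nr_pos by (simp add: pt_def prod_eq_iff)

lemma inj_pt: "inj_on (pt m) S" by (rule inj_onI) simp

definition oshift :: "nat \<Rightarrow> int \<times> int \<Rightarrow> int \<times> int \<Rightarrow> int \<times> int" where
  "oshift m d y = (N ^ m * fst d + fst y, N ^ m * snd d + snd y)"

text \<open>Subdividing inside and placing copies outside commute, which is the equation
  \<open>sh\<close> in the proof.\<close>

lemma cells_outer: "cells (Suc m) = (\<lambda>(e, B). oshift m e B) ` (D \<times> cells m)"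
proof (induction m)
  case 0
  show ?case by (auto simp: cells_1 oshift_def image_iff)
next
  case (Suc m)
  have "shift (oshift m e A) d = oshift (Suc m) e (shift A d)" for e A d
    by (simp add: shift_def oshift_def algebra_simps)
  note sh = this
  show ?case
  proof (intro set_eqI iffI)
    fix x assume "x \<in> cells (Suc (Suc m))"
    then obtain C d where "C \<in> cells (Suc m)" "d \<in> D" "x = shift C d"
      unfolding cells.simps(2)[of "Suc m"] by auto
    moreover from this(1) obtain e A where "e \<in> D" "A \<in> cells m" "C = oshift m e A" unfolding Suc by auto
    ultimately have "e \<in> D" "shift A d \<in> cells (Suc m)" "x = oshift (Suc m) e (shift A d)"
      by (auto simp: sh cells.simps(2)[of m])
    then show "x \<in> (\<lambda>(e, B). oshift (Suc m) e B) ` (D \<times> cells (Suc m))" by auto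
  next
    fix x assume "x \<in> (\<lambda>(e, B). oshift (Suc m) e B) ` (D \<times> cells (Suc m))"
    then obtain e C where "e \<in> D" "C \<in> cells (Suc m)" "x = oshift (Suc m) e C" by auto
    moreover from this(2) obtain A d where "A \<in> cells m" "d \<in> D" "C = shift A d"
      unfolding cells.simps(2)[of m] by auto
    ultimately have "oshift m e A \<in> cells (Suc m)" "d \<in> D" "x = shift (oshift m e A) d"
      unfolding Suc by (auto simp: sh)
    then show "x \<in> cells (Suc (Suc m))" unfolding cells.simps(2)[of "Suc m"] by auto
  qed
qed

lemma diag_cells_D: "(\<lambda>c. (int (fst c), int (snd c))) ` diag_cells n = D"
proof (intro set_eqI iffI)
  fix d assume "d \<in> (\<lambda>c. (int (fst c), int (snd c))) ` diag_cells n"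
  then show "d \<in> D" using n_ge by (auto simp: diag_cells_def D_def N_def)
next
  fix d assume "d \<in> D"
  then show "d \<in> (\<lambda>c. (int (fst c), int (snd c))) ` diag_cells n"
    using n_ge by (intro image_eqI[of _ _ "(nat (fst d), nat (snd d))"]) (auto simp: diag_cells_def D_def N_def)
qed

lemma cell_map_pt: "cell_map n c (pt m y) = pt (Suc m) (oshift m (int (fst c), int (snd c)) y)"
proof -
  have "(real c + y / Nr ^ m) / Nr = real_of_int (N ^ m * int c + y) / Nr ^ Suc m" for c :: nat and y :: int
    using Nr_pos by (simp add: real_N field_simps)
  then show ?thesis by (simp add: cell_map_def pt_def oshift_def Nr_def)
qed

lemma corners_oshift: "corners (oshift m e B) = oshift m e ` corners B"
  by (cases e; cases B) (auto simp: corners_def oshift_def image_iff)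

lemma cell_corners_eq: "cell_corners n m = (\<lambda>B. pt m ` corners B) ` cells m"
proof (induction m)
  case 0
  have "unit_corners = pt 0 ` corners (0, 0)" by (auto simp: unit_corners_def pt_def corners_def)
  then show ?case by simp
next
  case (Suc m)
  have im: "cell_map n c ` pt m ` corners B = pt (Suc m) ` corners (oshift m (int (fst c), int (snd c)) B)" for c B
    unfolding corners_oshift by (auto simp: image_iff cell_map_pt)
  show ?case
  proof (intro set_eqI iffI)
    fix Q assume "Q \<in> cell_corners n (Suc m)"
    then obtain c B where c: "c \<in> diag_cells n" "B \<in> cells m" "Q = cell_map n c ` pt m ` corners B"
      using Suc by auto
    have "oshift m (int (fst c), int (snd c)) B \<in> cells (Suc m)"
      unfolding cells_outer diag_cells_D[symmetric] using c(1,2) by force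
    then show "Q \<in> (\<lambda>B. pt (Suc m) ` corners B) ` cells (Suc m)" using c(3) im by blast
  next
    fix Q assume "Q \<in> (\<lambda>B. pt (Suc m) ` corners B) ` cells (Suc m)"
    then obtain C where C: "C \<in> cells (Suc m)" "Q = pt (Suc m) ` corners C" by auto
    then obtain e B where e: "e \<in> D" "B \<in> cells m" "C = oshift m e B" unfolding cells_outer by auto
    then obtain c where c: "c \<in> diag_cells n" "e = (int (fst c), int (snd c))" using diag_cells_D by blast
    have "Q = cell_map n c ` pt m ` corners B" unfolding C(2) e(3) c(2) im ..
    moreover have "pt m ` corners B \<in> cell_corners n m" unfolding Suc using e(2) by blast
    ultimately show "Q \<in> cell_corners n (Suc m)" using c(1) unfolding cell_corners.simps by blast
  qed
qed

lemma vicsek_V_cell_corners: "vicsek_V n m = \<Union> (cell_corners n m)"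
proof (induction m)
  case (Suc m)
  then show ?case by (auto simp: Suc)
qed simp

lemma vicsek_V_eq: "vicsek_V n m = pt m ` verts m"
  unfolding vicsek_V_cell_corners cell_corners_eq verts_def by auto

lemma Lam_lam: "Lam (cells m) lam g y = Lam (cells m) 0 g y + 3 * lam * g y * vdeg m y"
  unfolding Lam_def Lc_def vdeg_def by (simp add: sum.distrib)

text \<open>Two cells at \<open>y\<close> share no other vertex, so the neighbours of
  \<open>y\<close> split into disjoint triples; hence the degree \<open>3 * vdeg m y\<close> and the
  cellwise sum.\<close>

lemma graph_laplacian_pt:
  assumes y: "y \<in> verts m"
  shows "graph_laplacian n m u (pt m y) = Lam (cells m) 0 (u \<circ> pt m) y / (3 * vdeg m y)"
proof -
  let ?C = "{B \<in> cells m. y \<in> corners B}"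
  let ?U = "\<Union>B\<in>?C. corners B - {y}"
  have nb: "vicsek_nbrs n m (pt m y) = pt m ` ?U"
  proof (intro set_eqI iffI)
    fix w assume "w \<in> vicsek_nbrs n m (pt m y)"
    then obtain B where "B \<in> cells m" "pt m y \<in> pt m ` corners B" "w \<in> pt m ` corners B" "w \<noteq> pt m y"
      unfolding vicsek_nbrs_def cell_corners_eq by blast
    then obtain z where "B \<in> cells m" "y \<in> corners B" "z \<in> corners B" "w = pt m z" "z \<noteq> y" by auto
    then show "w \<in> pt m ` ?U" by blast
  next
    fix w assume "w \<in> pt m ` ?U"
    then obtain B z where "B \<in> cells m" "y \<in> corners B" "z \<in> corners B" "w = pt m z" "z \<noteq> y" by blast
    then show "w \<in> vicsek_nbrs n m (pt m y)"
      unfolding vicsek_nbrs_def vicsek_V_eq cell_corners_eq verts_def by auto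
  qed
  have fC: "finite ?C" using finite_cells[of m] by auto
  have dis: "\<forall>B\<in>?C. \<forall>B'\<in>?C. B \<noteq> B' \<longrightarrow> (corners B - {y}) \<inter> (corners B' - {y}) = {}"
    using cells_share[of _ m _ y] by blast
  have c3: "card (corners B - {y}) = 3" if "B \<in> ?C" for B using that by (simp add: card_Diff_singleton)
  have "card (vicsek_nbrs n m (pt m y)) = card ?U" unfolding nb by (rule card_image[OF inj_pt])
  also have "\<dots> = (\<Sum>B\<in>?C. card (corners B - {y}))" by (rule card_UN_disjoint[OF fC _ dis]) auto
  also have "\<dots> = (\<Sum>B\<in>?C. 3)" by (intro sum.cong refl c3)
  finally have card: "real (card (vicsek_nbrs n m (pt m y))) = 3 * vdeg m y" by (simp add: vdeg_def)
  have "(\<Sum>w\<in>vicsek_nbrs n m (pt m y). u w - u (pt m y)) = (\<Sum>z\<in>?U. (u \<circ> pt m) z - (u \<circ> pt m) y)"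
    unfolding nb by (subst sum.reindex[OF inj_pt]) simp
  also have "\<dots> = (\<Sum>B\<in>?C. \<Sum>z\<in>corners B - {y}. (u \<circ> pt m) z - (u \<circ> pt m) y)"
    by (rule sum.UNION_disjoint[OF fC _ dis]) auto
  also have "\<dots> = (\<Sum>B\<in>?C. \<Sum>z\<in>corners B. (u \<circ> pt m) z - (u \<circ> pt m) y)"
    by (intro sum.cong refl sum.mono_neutral_left) auto
  also have "\<dots> = Lam (cells m) 0 (u \<circ> pt m) y" by (simp add: Lam_def Lc_def)
  finally show ?thesis unfolding graph_laplacian_def card by simp
qed

lemma verts_nonempty: "(0, 0) \<in> verts m"
proof (induction m)
  case (Suc m)
  from refine_verts[OF this] show ?case by (simp add: refine_def)
qed (simp add: verts_def corners_def)

section \<open>The Vicsek set as the closure of all vertices\<close>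

definition Vinf :: "(real \<times> real) set" where "Vinf = (\<Union>m. vicsek_V n m)"

lemma vicsek_V_mono: "m \<le> k \<Longrightarrow> vicsek_V n m \<subseteq> vicsek_V n k"
proof (induction k rule: dec_induct)
  case (step k)
  have "vicsek_V n k \<subseteq> vicsek_V n (Suc k)"
  proof
    fix x assume "x \<in> vicsek_V n k"
    then obtain y where "y \<in> verts k" "x = pt k y" unfolding vicsek_V_eq by auto
    then show "x \<in> vicsek_V n (Suc k)" unfolding vicsek_V_eq
      using refine_verts[of y k] by (intro image_eqI[of _ _ "refine y"]) auto
  qed
  then show ?case using step by blast
qed simp

lemma vicsek_V_unit: "vicsek_V n m \<subseteq> {0..1} \<times> {0..1}"
proof (induction m)
  case (Suc m)
  have "0 \<le> (real c + s) / Nr \<and> (real c + s) / Nr \<le> 1" if "c < 2 * n - 1" "0 \<le> s" "s \<le> 1" for c :: nat and s :: real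
  proof -
    have "real c + 1 \<le> Nr" using that(1) by (simp add: Nr_def)
    then show ?thesis using that Nr_pos by (simp add: field_simps)
  qed
  then show ?case using Suc by (auto simp: cell_map_def diag_cells_def Nr_def subset_iff)
qed (auto simp: unit_corners_def)

lemma cell_map_eq: "cell_map n c p = (1 / Nr) *\<^sub>R ((real (fst c), real (snd c)) + p)"
  by (simp add: cell_map_def Nr_def scaleR_prod_def plus_prod_def)

lemma dist_cell_map: "dist (cell_map n c p) (cell_map n c q) = dist p q / Nr"
  unfolding cell_map_eq using Nr_pos by (simp add: dist_norm flip: scaleR_diff_right)

lemma cell_map_continuous: "continuous_on S (cell_map n c)"
  unfolding cell_map_eq[abs_def] by (intro continuous_intros)

lemma finite_diag_cells: "finite (diag_cells n)"
  by (rule finite_subset[of _ "{..<2 * n} \<times> {..<2 * n}"]) (auto simp: diag_cells_def)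

text \<open>A point of \<open>A\<close> farthest from \<open>B\<close> is the image of a point of
  \<open>A\<close>, so its distance to \<open>B\<close> is at most \<open>1 / Nr\<close> times the
  largest distance, which must then be 0. Used in both directions this is uniqueness of the
  attractor.\<close>

lemma attractor_subset:
  assumes "compact A" "A \<noteq> {}" "A = (\<Union>c\<in>diag_cells n. cell_map n c ` A)"
    and "compact B" "B \<noteq> {}" "B = (\<Union>c\<in>diag_cells n. cell_map n c ` B)"
  shows "A \<subseteq> B"
proof -
  have "continuous_on A (\<lambda>x. infdist x B)" by (intro continuous_intros)
  from continuous_attains_sup[OF assms(1,2) this]
  obtain x where x: "x \<in> A" "\<And>y. y \<in> A \<Longrightarrow> infdist y B \<le> infdist x B" by blast
  obtain c x' where c: "c \<in> diag_cells n" "x' \<in> A" "x = cell_map n c x'" using x(1) assms(3) by blast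
  obtain b where b: "b \<in> B" "infdist x' B = dist x' b"
    using infdist_attains_inf[OF compact_imp_closed[OF assms(4)] assms(5)] by blast
  have "cell_map n c b \<in> B" using assms(6) c(1) b(1) by blast
  then have "infdist x B \<le> dist x (cell_map n c b)" by (rule infdist_le)
  also have "\<dots> = infdist x' B / Nr" by (simp add: c(3) dist_cell_map b(2))
  also have "\<dots> \<le> infdist x B / Nr" using x(2)[OF c(2)] Nr_pos by (intro divide_right_mono) auto
  finally have "infdist x B * Nr \<le> infdist x B" using Nr_pos by (simp add: field_simps)
  moreover have "infdist x B * 3 \<le> infdist x B * Nr" using Nr_ge infdist_nonneg by (intro mult_left_mono) auto
  ultimately have "infdist x B \<le> 0" by linarith
  then have "infdist y B = 0" if "y \<in> A" for y using x(2)[OF that] infdist_nonneg[of y B] by linarith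
  then show ?thesis using in_closed_iff_infdist_zero[OF compact_imp_closed[OF assms(4)] assms(5)] by blast
qed

lemma Vinf_closure: "compact (closure Vinf)" "closure Vinf \<noteq> {}"
  "closure Vinf = (\<Union>c\<in>diag_cells n. cell_map n c ` closure Vinf)"
proof -
  have "Vinf \<subseteq> {0..1} \<times> {0..1}" using vicsek_V_unit by (auto simp: Vinf_def)
  then have "bounded Vinf" by (rule bounded_subset[rotated]) (intro bounded_Times bounded_closed_interval)
  then show comp: "compact (closure Vinf)" by simp
  show "closure Vinf \<noteq> {}" using verts_nonempty[of 0] by (auto simp: Vinf_def vicsek_V_eq)
  have V: "vicsek_V n (Suc m) \<subseteq> (\<Union>c\<in>diag_cells n. cell_map n c ` Vinf)" for m
    by (auto simp: Vinf_def)
  have inc: "cell_map n c ` Vinf \<subseteq> Vinf" if "c \<in> diag_cells n" for c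
  proof
    fix x assume "x \<in> cell_map n c ` Vinf"
    then obtain w m where "x = cell_map n c w" "w \<in> vicsek_V n m" by (auto simp: Vinf_def)
    then have "x \<in> vicsek_V n (Suc m)" using that by auto
    then show "x \<in> Vinf" unfolding Vinf_def by blast
  qed
  show "closure Vinf = (\<Union>c\<in>diag_cells n. cell_map n c ` closure Vinf)"
  proof
    have "closed (\<Union>c\<in>diag_cells n. cell_map n c ` closure Vinf)"
      by (intro closed_UN finite_diag_cells ballI compact_imp_closed compact_continuous_image cell_map_continuous comp)
    moreover have "Vinf \<subseteq> (\<Union>c\<in>diag_cells n. cell_map n c ` closure Vinf)"
    proof
      fix x assume "x \<in> Vinf"
      then obtain m where "x \<in> vicsek_V n m" by (auto simp: Vinf_def)
      then have "x \<in> vicsek_V n (Suc m)"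
        using subsetD[OF vicsek_V_mono[of m "Suc m"]] by (simp del: vicsek_V.simps)
      then have "x \<in> (\<Union>c\<in>diag_cells n. cell_map n c ` Vinf)" using V by blast
      then show "x \<in> (\<Union>c\<in>diag_cells n. cell_map n c ` closure Vinf)" using closure_subset by blast
    qed
    ultimately show "closure Vinf \<subseteq> (\<Union>c\<in>diag_cells n. cell_map n c ` closure Vinf)"
      by (rule closure_minimal[rotated])
    show "(\<Union>c\<in>diag_cells n. cell_map n c ` closure Vinf) \<subseteq> closure Vinf"
    proof (rule UN_least)
      fix c assume "c \<in> diag_cells n"
      then have "cell_map n c ` Vinf \<subseteq> closure Vinf" using inc closure_subset by blast
      then show "cell_map n c ` closure Vinf \<subseteq> closure Vinf"
        by (intro image_closure_subset cell_map_continuous) auto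
    qed
  qed
qed

lemma vicsek_set_eq: "vicsek_set n = closure Vinf"
  unfolding vicsek_set_def
proof (rule the_equality)
  show "compact (closure Vinf) \<and> closure Vinf \<noteq> {} \<and> closure Vinf = (\<Union>c\<in>diag_cells n. cell_map n c ` closure Vinf)"
    using Vinf_closure by blast
  fix A assume "compact A \<and> A \<noteq> {} \<and> A = (\<Union>c\<in>diag_cells n. cell_map n c ` A)"
  then show "A = closure Vinf" using attractor_subset[of A "closure Vinf"] attractor_subset[of "closure Vinf" A] Vinf_closure
    by (intro equalityI) blast+
qed

end

section \<open>Existence of the low eigenvalues\<close>

context vicsek begin

context
  fixes a1 :: real and f0 :: "int \<times> int \<Rightarrow> real"
  assumes a1: "regular a1" and X1: "X a1 \<le> 1/10"
    and f0: "\<And>y. y \<in> verts 0 \<Longrightarrow> Lam (cells 0) (R_fun n (X a1)) f0 y = 0"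
begin

text \<open>Indices are shifted by one: \<open>lv m\<close> is the eigenvalue on level
  \<open>Suc m\<close>, where \<open>eig m\<close> lives. The bound 1/10 on \<open>X a1\<close>
  keeps \<open>(ang (Suc m))\<^sup>2\<close> at most 1/2, as \<open>wt_sum_bounds\<close>
  asks.\<close>

definition lv :: "nat \<Rightarrow> real" where "lv m = (phi n 1 ^^ m) (X a1)"

definition ang :: "nat \<Rightarrow> real" where
  "ang m = (if m = 0 then a1 else SOME a. 0 < a \<and> a \<le> pi / 2 \<and> X a = lv m \<and> R_fun n (X a) = lv (m - 1) \<and> a\<^sup>2 \<le> 5 * lv (m - 1))"

primrec eig :: "nat \<Rightarrow> int \<times> int \<Rightarrow> real" where
  "eig 0 = ext 0 a1 f0"
| "eig (Suc m) = ext (Suc m) (ang (Suc m)) (eig m)"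

lemma X1_pos: "0 < X a1"
  using X_strict_mono[of 0 a1] a1 by (simp add: regular_def)

lemma lv_0 [simp]: "lv 0 = X a1" and lv_Suc: "lv (Suc m) = phi n 1 (lv m)"
  by (simp_all add: lv_def)

lemma lv_bounds: "lv m \<le> X a1 / 3 ^ m" "lv m \<le> 1/10" "rho n ^ m * lv m \<le> 4 * X a1"
proof -
  have x: "0 \<le> X a1" "X a1 \<le> 1/4" using X1 X1_pos by auto
  show l: "lv m \<le> X a1 / 3 ^ m" using phi_1_iterate(2)[OF x] by (simp add: lv_def)
  have "X a1 * 1 \<le> X a1 * 3 ^ m" using x by (intro mult_left_mono) auto
  then have "X a1 / 3 ^ m \<le> X a1" by (simp add: divide_le_eq)
  then show "lv m \<le> 1/10" using l X1 by linarith
  show "rho n ^ m * lv m \<le> 4 * X a1" using psi_props(4)[OF x] by (simp add: lv_def)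
qed

lemma lv_pos: "0 < lv m"
proof (induction m)
  case 0
  then show ?case using X1_pos by simp
next
  case (Suc m)
  obtain a where a: "0 \<le> a" "a \<le> pi / 2" "phi n 1 (lv m) = X a" "R_fun n (X a) = lv m"
    using phi_1_props[of "lv m"] Suc lv_bounds(2)[of m] by auto
  have "X a \<noteq> 0" using a(4) Suc by auto
  then show ?case using X_range(1)[of a] a(3) by (simp add: lv_Suc)
qed

lemma ang_Suc:
  "0 < ang (Suc m)" "ang (Suc m) \<le> pi / 2" "X (ang (Suc m)) = lv (Suc m)"
  "R_fun n (X (ang (Suc m))) = lv m" "(ang (Suc m))\<^sup>2 \<le> 5 * lv m"
proof -
  obtain a where a: "0 \<le> a" "a \<le> pi / 2" "phi n 1 (lv m) = X a" "R_fun n (X a) = lv m" "a\<^sup>2 \<le> 5 * lv m"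
    using phi_1_props[of "lv m"] lv_pos[of m] lv_bounds(2)[of m] by auto
  moreover have "a \<noteq> 0" using a(4) lv_pos[of m] by auto
  ultimately have "\<exists>a. 0 < a \<and> a \<le> pi / 2 \<and> X a = lv (Suc m) \<and> R_fun n (X a) = lv m \<and> a\<^sup>2 \<le> 5 * lv m"
    by (intro exI[of _ a]) (auto simp: lv_Suc)
  from someI_ex[OF this]
  show "0 < ang (Suc m)" "ang (Suc m) \<le> pi / 2" "X (ang (Suc m)) = lv (Suc m)"
    "R_fun n (X (ang (Suc m))) = lv m" "(ang (Suc m))\<^sup>2 \<le> 5 * lv m"
    by (auto simp: ang_def)
qed

lemma ang_regular: "regular (ang (Suc m))"
  using small_angle(1) ang_Suc by blast

lemma eig_refine:
  "z \<in> verts 0 \<Longrightarrow> eig 0 (refine z) = f0 z"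
  "z \<in> verts (Suc m) \<Longrightarrow> eig (Suc m) (refine z) = eig m z"
  by (simp_all add: ext_refine a1 ang_regular)

lemma eig_Lam: "y \<in> verts (Suc m) \<Longrightarrow> Lam (cells (Suc m)) (lv m) (eig m) y = 0"
proof (induction m arbitrary: y)
  case 0
  show ?case
  proof (cases "y \<in> refine ` verts 0")
    case True
    then show ?thesis using Lam_ext_refine[OF a1, of 0 f0] f0 by auto
  next
    case False
    then show ?thesis using Lam_ext_interior[OF a1, of y 0 f0] 0 by simp
  qed
next
  case (Suc m)
  show ?case
  proof (cases "y \<in> refine ` verts (Suc m)")
    case True
    then obtain z where z: "z \<in> verts (Suc m)" "y = refine z" by auto
    moreover have "R_fun n (lv (Suc m)) = lv m" using ang_Suc(3,4)[of m] by simp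
    ultimately show ?thesis using Lam_ext_refine[OF ang_regular, of "Suc m" m "eig m" z] Suc.IH[of z]
      by (simp add: ang_Suc)
  next
    case False
    then show ?thesis using Lam_ext_interior[OF ang_regular, of y "Suc m" m "eig m"] Suc.prems
      by (simp add: ang_Suc)
  qed
qed

lemma wt_sum_ang:
  assumes "x \<in> (\<Union>d\<in>D. corners d)"
  shows "\<bar>(\<Sum>k\<in>K. wt (ang (Suc m)) (mirror k x)) - 1\<bar> \<le> 10 * lv m"
proof -
  have "(ang (Suc m))\<^sup>2 \<le> 1/2" using ang_Suc(5)[of m] lv_bounds(2)[of m] by linarith
  from wt_sum_bounds[OF ang_Suc(1) this assms] show ?thesis using ang_Suc(5)[of m] by linarith
qed

section \<open>Uniform bound and uniform continuity of the extended functions\<close>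

lemma corner_vert:
  assumes "A \<in> cells m" "k \<in> K" shows "(fst A + fst k, snd A + snd k) \<in> corners A" "(fst A + fst k, snd A + snd k) \<in> verts m"
  using assms by (auto simp: verts_def corners_def)

text \<open>An extension step enlarges the maximum at most by the total weight
  \<open>1 + 10 * lv m \<le> exp (10 * lv m)\<close>. As \<open>lv m\<close> decays like
  \<open>1 / 3 ^ m\<close>, the product over all levels is finite.\<close>

lemma eig_bounded: "\<exists>B>0. \<forall>m. \<forall>y\<in>verts (Suc m). \<bar>eig m y\<bar> \<le> B"
proof -
  define B0 where "B0 = 1 + (\<Sum>y\<in>verts (Suc 0). \<bar>eig 0 y\<bar>)"
  have B0: "B0 > 0" unfolding B0_def by (simp add: add_pos_nonneg sum_nonneg)
  have st: "\<forall>y\<in>verts (Suc m). \<bar>eig m y\<bar> \<le> B0 * exp (10 * (\<Sum>j<m. lv j))" for m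
  proof (induction m)
    case 0
    have "\<bar>eig 0 y\<bar> \<le> (\<Sum>y\<in>verts (Suc 0). \<bar>eig 0 y\<bar>)" if "y \<in> verts (Suc 0)" for y
      using that by (intro member_le_sum finite_verts) auto
    then show ?case by (force simp: B0_def simp del: eig.simps)
  next
    case (Suc m)
    show ?case
    proof
      fix y assume y: "y \<in> verts (Suc (Suc m))"
      obtain A where A: "A \<in> cells (Suc m)" "y \<in> block A" "rel A y \<in> (\<Union>d\<in>D. corners d)" using verts_SucE[OF y] .
      let ?w = "\<lambda>k. wt (ang (Suc m)) (mirror k (rel A y))"
      let ?B = "B0 * exp (10 * (\<Sum>j<m. lv j))"
      have w: "0 \<le> ?w k" for k by (rule wt_mirror_nonneg[OF ang_Suc(1,2) A(2)])
      have "\<bar>eig (Suc m) y\<bar> = \<bar>\<Sum>k\<in>K. eig m (fst A + fst k, snd A + snd k) * ?w k\<bar>"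
        by (simp add: ext_block[OF ang_regular A(1,2)])
      also have "\<dots> \<le> (\<Sum>k\<in>K. \<bar>eig m (fst A + fst k, snd A + snd k) * ?w k\<bar>)" by (rule sum_abs)
      also have "\<dots> \<le> (\<Sum>k\<in>K. ?B * ?w k)"
        unfolding abs_mult using Suc corner_vert(2)[OF A(1)] w B0 by (intro sum_mono mult_mono) auto
      also have "\<dots> = ?B * (\<Sum>k\<in>K. ?w k)" by (simp add: sum_distrib_left)
      also have "\<dots> \<le> ?B * exp (10 * lv m)"
      proof (rule mult_left_mono)
        have "(\<Sum>k\<in>K. ?w k) \<le> 1 + 10 * lv m" using wt_sum_ang[OF A(3), of m] by linarith
        also have "\<dots> \<le> exp (10 * lv m)" by (rule exp_ge_add_one_self)
        finally show "(\<Sum>k\<in>K. ?w k) \<le> exp (10 * lv m)" .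
      qed (use B0 in simp)
      also have "\<dots> = B0 * exp (10 * (\<Sum>j<Suc m. lv j))" by (simp add: distrib_left exp_add)
      finally show "\<bar>eig (Suc m) y\<bar> \<le> B0 * exp (10 * (\<Sum>j<Suc m. lv j))" .
    qed
  qed
  have "(\<Sum>j<m. lv j) \<le> 3/2 * X a1" for m
  proof -
    have "(\<Sum>j<m. lv j) \<le> (\<Sum>j<m. X a1 * (1/3) ^ j)"
      using lv_bounds(1) by (intro sum_mono) (simp add: power_divide)
    also have "\<dots> = X a1 * (\<Sum>j<m. (1/3) ^ j)" by (simp add: sum_distrib_left)
    also have "\<dots> \<le> X a1 * (3/2)"
    proof (rule mult_left_mono)
      have "(\<Sum>j<m. (1/3::real) ^ j) = 3/2 * (1 - (1/3) ^ m)"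
      proof -
        have "(y - 1) / (1/3 - 1) = 3/2 * (1 - y)" for y :: real by (simp add: field_simps)
        then show ?thesis using geometric_sum[of "1/3::real" m] by simp
      qed
      then show "(\<Sum>j<m. (1/3::real) ^ j) \<le> 3/2" by simp
    qed (use X1_pos in simp)
    finally show ?thesis by simp
  qed
  then have "B0 * exp (10 * (\<Sum>j<m. lv j)) \<le> B0 * exp (15 * X a1)" for m
    using B0 by (intro mult_left_mono) (auto, smt (verit))
  then have "\<forall>m. \<forall>y\<in>verts (Suc m). \<bar>eig m y\<bar> \<le> B0 * exp (15 * X a1)" using st by (meson order_trans)
  then show ?thesis using B0 by (intro exI[of _ "B0 * exp (15 * X a1)"]) auto
qed

text \<open>The energy of an eigenfunction is its eigenvalue times its mass, and the number of cells
  times the eigenvalue decays geometrically.\<close>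

lemma eig_edge: "\<exists>C>0. \<forall>m. \<forall>A\<in>cells (Suc m). \<forall>y\<in>corners A. \<forall>z\<in>corners A. \<bar>eig m z - eig m y\<bar> \<le> C * (2/3) ^ m"
proof -
  obtain B where B: "B > 0" "\<And>m y. y \<in> verts (Suc m) \<Longrightarrow> \<bar>eig m y\<bar> \<le> B" using eig_bounded by blast
  \<comment> \<open>\<open>24 = 6 * 4\<close> comes from the energy identity and the four corners of
    a cell, \<open>4 * X a1\<close> bounds \<open>rho n ^ m * lv m\<close>, and
    \<open>2 * Nr\<close> accounts for the cells of level \<open>Suc m\<close> instead of
    \<open>m\<close>.\<close>
  define C2 where "C2 = 24 * B\<^sup>2 * (4 * X a1) * (2 * Nr)"
  have C2: "C2 > 0" unfolding C2_def using B(1) X1_pos Nr_pos by simp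
  have "\<bar>eig m z - eig m y\<bar> \<le> sqrt C2 * (2/3) ^ m"
    if A: "A \<in> cells (Suc m)" "y \<in> corners A" "z \<in> corners A" for m A y z
  proof -
    let ?f = "eig m"
    let ?E = "\<Sum>A\<in>cells (Suc m). \<Sum>y\<in>corners A. \<Sum>z\<in>corners A. (?f z - ?f y)\<^sup>2"
    have "(\<Sum>y\<in>verts (Suc m). ?f y * Lam (cells (Suc m)) (lv m) ?f y) = 0"
      using eig_Lam[of _ m] by simp
    then have en: "?E = 6 * lv m * (\<Sum>A\<in>cells (Suc m). \<Sum>y\<in>corners A. (?f y)\<^sup>2)"
      unfolding verts_def Lam_energy[OF finite_cells] by simp
    have "(?f z - ?f y)\<^sup>2 \<le> (\<Sum>z\<in>corners A. (?f z - ?f y)\<^sup>2)"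
      using A by (intro member_le_sum) auto
    also have "\<dots> \<le> (\<Sum>y\<in>corners A. \<Sum>z\<in>corners A. (?f z - ?f y)\<^sup>2)"
      using A by (intro member_le_sum[where f = "\<lambda>y. \<Sum>z\<in>corners A. (?f z - ?f y)\<^sup>2"]) (auto intro: sum_nonneg)
    also have "\<dots> \<le> ?E"
      using A finite_cells
      by (intro member_le_sum[where f = "\<lambda>A. \<Sum>y\<in>corners A. \<Sum>z\<in>corners A. (?f z - ?f y)\<^sup>2"]) (auto intro!: sum_nonneg)
    also have "\<dots> \<le> 6 * lv m * (\<Sum>A\<in>cells (Suc m). \<Sum>y\<in>corners A. B\<^sup>2)"
      unfolding en
    proof (intro mult_left_mono sum_mono)
      fix A' y' assume "A' \<in> cells (Suc m)" "y' \<in> corners A'"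
      then have "\<bar>?f y'\<bar> \<le> B" by (intro B(2)) (auto simp: verts_def)
      then show "(?f y')\<^sup>2 \<le> B\<^sup>2" using B(1) by (metis abs_le_square_iff abs_of_pos)
    qed (use lv_pos[of m] in simp)
    also have "\<dots> = 24 * B\<^sup>2 * lv m * real (card (cells (Suc m)))" by simp
    finally have 1: "(?f z - ?f y)\<^sup>2 \<le> 24 * B\<^sup>2 * lv m * real (card (cells (Suc m)))" .
    have 2: "24 * B\<^sup>2 * lv m * real (card (cells (Suc m))) \<le> 24 * B\<^sup>2 * lv m * (2 * Nr) ^ Suc m"
    proof (rule mult_left_mono[OF card_cells])
      have "0 \<le> lv m" using lv_pos[of m] by (rule less_imp_le)
      then show "0 \<le> 24 * B\<^sup>2 * lv m" by (rule mult_nonneg_nonneg[rotated]) simp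
    qed
    have 3: "24 * B\<^sup>2 * lv m * (2 * Nr) ^ Suc m = 24 * B\<^sup>2 * (rho n ^ m * lv m) * (2 * Nr) * (2 / (2 * Nr - 1)) ^ m"
    proof -
      have "(2 * Nr) ^ m = rho n ^ m * (2 / (2 * Nr - 1)) ^ m"
      proof -
        have "2 * Nr = rho n * (2 / (2 * Nr - 1))" using Nr_ge by (simp add: rho_Nr)
        then show ?thesis by (simp only: power_mult_distrib[symmetric])
      qed
      then show ?thesis by simp
    qed
    \<comment> \<open>\<open>2 / (2 * Nr - 1) \<le> 2/5 < 4/9\<close>, and 4/9 is the square of the
      rate 2/3.\<close>
    have 4: "24 * B\<^sup>2 * (rho n ^ m * lv m) * (2 * Nr) * (2 / (2 * Nr - 1)) ^ m \<le> 24 * B\<^sup>2 * (4 * X a1) * (2 * Nr) * (4/9) ^ m"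
    proof (rule mult_mono)
      have "0 \<le> rho n ^ m * lv m" using lv_pos[of m] rho_ge by simp
      then show "24 * B\<^sup>2 * (rho n ^ m * lv m) * (2 * Nr) \<le> 24 * B\<^sup>2 * (4 * X a1) * (2 * Nr)"
        using Nr_pos by (intro mult_right_mono mult_left_mono lv_bounds(3)) auto
      show "(2 / (2 * Nr - 1)) ^ m \<le> (4/9) ^ m" using Nr_ge by (intro power_mono) (auto simp: field_simps)
    qed (use X1_pos Nr_ge in auto)
    have 5: "24 * B\<^sup>2 * (4 * X a1) * (2 * Nr) * (4/9) ^ m = (sqrt C2 * (2/3) ^ m)\<^sup>2"
    proof -
      have "(4/9::real) ^ m = ((2/3) ^ m)\<^sup>2" by (simp add: power2_eq_square flip: power_mult_distrib)
      moreover have "(sqrt C2 * (2/3) ^ m)\<^sup>2 = C2 * ((2/3) ^ m)\<^sup>2" using C2 by (simp add: power_mult_distrib)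
      ultimately show ?thesis by (simp only: C2_def)
    qed
    have "(?f z - ?f y)\<^sup>2 \<le> (sqrt C2 * (2/3) ^ m)\<^sup>2" using 1 2 3 4 5 by linarith
    then have "\<bar>?f z - ?f y\<bar> \<le> \<bar>sqrt C2 * (2/3) ^ m\<bar>" by (simp only: abs_le_square_iff)
    then show ?thesis using C2 by (simp add: abs_mult)
  qed
  then show ?thesis using C2 by (intro exI[of _ "sqrt C2"]) auto
qed

text \<open>An extended value is a weighted mean of corner values up to the defect of the weights.
  Their total is at most 2, so the value moves by at most twice the oscillation on the cell plus
  \<open>B * (10 * lv m)\<close>.\<close>

lemma eig_step: "\<exists>C>0. \<forall>m. \<forall>A\<in>cells (Suc m).
    (\<forall>y\<in>corners A. \<forall>x\<in>corners A. \<bar>eig m y - eig m x\<bar> \<le> C * (2/3) ^ m) \<and>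
    (\<forall>y\<in>verts (Suc (Suc m)) \<inter> block A. \<forall>x\<in>corners A. \<bar>eig (Suc m) y - eig m x\<bar> \<le> C * (2/3) ^ m)"
proof -
  obtain B where B: "B > 0" "\<And>m y. y \<in> verts (Suc m) \<Longrightarrow> \<bar>eig m y\<bar> \<le> B" using eig_bounded by blast
  obtain C1 where C1: "C1 > 0" "\<And>m A y z. A \<in> cells (Suc m) \<Longrightarrow> y \<in> corners A \<Longrightarrow> z \<in> corners A \<Longrightarrow> \<bar>eig m z - eig m y\<bar> \<le> C1 * (2/3) ^ m"
    using eig_edge by blast
  define C where "C = 2 * C1 + B"
  have C: "C > 0" "C1 \<le> C" using B(1) C1(1) by (auto simp: C_def)
  have "\<bar>eig (Suc m) y - eig m x\<bar> \<le> C * (2/3) ^ m"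
    if A: "A \<in> cells (Suc m)" "y \<in> verts (Suc (Suc m))" "y \<in> block A" "x \<in> corners A" for m A y x
  proof -
    obtain A' where A': "A' \<in> cells (Suc m)" "y \<in> block A'" "rel A' y \<in> (\<Union>d\<in>D. corners d)"
      using verts_SucE[OF A(2)] .
    \<comment> \<open>\<open>verts_SucE\<close> may return another cell \<open>A'\<close>; then
      \<open>y\<close> is a common refined corner, hence also a vertex of the model cell seen from
      \<open>A\<close>.\<close>
    have rA: "rel A y \<in> (\<Union>d\<in>D. corners d)"
    proof (cases "A = A'")
      case False
      then obtain z where z: "z \<in> corners A" "y = refine z" using block_inter[OF A(1) A'(1) _ A(3) A'(2)] by blast
      have "rel A y = mirror (fst z - fst A, snd z - snd A) (0, 0)"
        using corner_offset[OF z(1)] z(2) refine_K by simp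
      moreover have "mirror k (0, 0) \<in> corners (mirrorc k (0, 0))" for k unfolding corners_mirrorc by (auto simp: corners_def)
      moreover have "mirrorc k (0, 0) \<in> D" for k unfolding mirrorc_D using N_pos by (simp add: D_def)
      ultimately show ?thesis by (metis UN_I)
    qed (use A' in simp)
    let ?w = "\<lambda>k. wt (ang (Suc m)) (mirror k (rel A y))"
    let ?f = "\<lambda>k. eig m (fst A + fst k, snd A + snd k)"
    have w: "0 \<le> ?w k" for k by (rule wt_mirror_nonneg[OF ang_Suc(1,2) A(3)])
    have H: "\<bar>(\<Sum>k\<in>K. ?w k) - 1\<bar> \<le> 10 * lv m" by (rule wt_sum_ang[OF rA])
    have deq: "eig (Suc m) y - eig m x = (\<Sum>k\<in>K. (?f k - eig m x) * ?w k) + eig m x * ((\<Sum>k\<in>K. ?w k) - 1)"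
      by (simp add: ext_block[OF ang_regular A(1,3)] left_diff_distrib sum_subtractf sum_distrib_left right_diff_distrib)
    have "\<bar>eig (Suc m) y - eig m x\<bar> \<le> \<bar>\<Sum>k\<in>K. (?f k - eig m x) * ?w k\<bar> + \<bar>eig m x * ((\<Sum>k\<in>K. ?w k) - 1)\<bar>"
      unfolding deq by (rule abs_triangle_ineq)
    also have "\<bar>\<Sum>k\<in>K. (?f k - eig m x) * ?w k\<bar> \<le> (\<Sum>k\<in>K. \<bar>(?f k - eig m x) * ?w k\<bar>)" by (rule sum_abs)
    also have "\<dots> \<le> (\<Sum>k\<in>K. (C1 * (2/3) ^ m) * ?w k)"
      unfolding abs_mult using C1 corner_vert(1)[OF A(1)] A(1,4) w by (intro sum_mono mult_mono) auto
    also have "\<dots> = (C1 * (2/3) ^ m) * (\<Sum>k\<in>K. ?w k)" by (simp add: sum_distrib_left)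
    also have "\<dots> \<le> (C1 * (2/3) ^ m) * 2"
      using H lv_bounds(2)[of m] C1(1) by (intro mult_left_mono) auto
    also have "\<bar>eig m x * ((\<Sum>k\<in>K. ?w k) - 1)\<bar> \<le> B * (10 * lv m)"
      unfolding abs_mult using H B(1) A by (intro mult_mono B(2)) (auto simp: verts_def)
    also have "\<dots> \<le> B * (2/3) ^ m"
    proof -
      have "10 * lv m \<le> 1 / 3 ^ m" using lv_bounds(1)[of m] X1 by (simp add: field_simps)
      also have "\<dots> \<le> (2/3) ^ m" by (simp add: power_divide divide_right_mono)
      finally show ?thesis using B(1) by simp
    qed
    finally show ?thesis by (simp add: C_def algebra_simps)
  qed
  moreover have "\<bar>eig m y - eig m x\<bar> \<le> C * (2/3) ^ m" if "A \<in> cells (Suc m)" "y \<in> corners A" "x \<in> corners A" for m A x y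
  proof -
    have "C1 * (2/3) ^ m \<le> C * (2/3) ^ m" using C by (intro mult_right_mono) auto
    then show ?thesis using C1(2)[OF that(1,3,2)] by linarith
  qed
  ultimately show ?thesis using C(1) by (intro exI[of _ C]) auto
qed

text \<open>Climbs from a vertex to a cell of level \<open>Suc m\<close> containing it. The steps
  form a geometric series of ratio 2/3, so the constant 3 reproduces itself:
  \<open>1 + 3 * (2/3) = 3\<close>.\<close>

lemma eig_ancestor:
  assumes C: "\<And>m A x y. A \<in> cells (Suc m) \<Longrightarrow> y \<in> corners A \<Longrightarrow> x \<in> corners A \<Longrightarrow> \<bar>eig m y - eig m x\<bar> \<le> C * (2/3) ^ m"
    "\<And>m A x y. A \<in> cells (Suc m) \<Longrightarrow> y \<in> verts (Suc (Suc m)) \<Longrightarrow> y \<in> block A \<Longrightarrow> x \<in> corners A \<Longrightarrow> \<bar>eig (Suc m) y - eig m x\<bar> \<le> C * (2/3) ^ m"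
    and C0: "C > 0"
  shows "y \<in> verts (Suc (m + d)) \<Longrightarrow> \<exists>A\<in>cells (Suc m).
      N ^ d * fst A \<le> fst y \<and> fst y \<le> N ^ d * (fst A + 1) \<and> N ^ d * snd A \<le> snd y \<and> snd y \<le> N ^ d * (snd A + 1) \<and>
      (\<forall>x\<in>corners A. \<bar>eig (m + d) y - eig m x\<bar> \<le> 3 * C * (2/3) ^ m)"
proof (induction d arbitrary: m)
  case 0
  then obtain A where A: "A \<in> cells (Suc m)" "y \<in> corners A" by (auto simp: verts_def)
  have "C * (2/3) ^ m \<le> 3 * C * (2/3) ^ m" using C0 by (intro mult_right_mono) auto
  then have "\<bar>eig m y - eig m x\<bar> \<le> 3 * C * (2/3) ^ m" if "x \<in> corners A" for x using C(1)[OF A that] by linarith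
  then show ?case using A by (intro bexI[of _ A]) (auto simp: corners_def)
next
  case (Suc d)
  have "y \<in> verts (Suc (Suc m + d))" using Suc.prems by simp
  from Suc.IH[OF this] obtain A' where A': "A' \<in> cells (Suc (Suc m))"
    "N ^ d * fst A' \<le> fst y" "fst y \<le> N ^ d * (fst A' + 1)" "N ^ d * snd A' \<le> snd y" "snd y \<le> N ^ d * (snd A' + 1)"
    "\<And>x. x \<in> corners A' \<Longrightarrow> \<bar>eig (Suc m + d) y - eig (Suc m) x\<bar> \<le> 3 * C * (2/3) ^ Suc m" by blast
  obtain A e where A: "A \<in> cells (Suc m)" "e \<in> D" "A' = shift A e"
    using A'(1) unfolding cells.simps(2)[of "Suc m"] by auto
  have loc: "N ^ Suc d * p \<le> c \<and> c \<le> N ^ Suc d * (p + 1)"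
    if "N ^ d * (N * p + q) \<le> c" "c \<le> N ^ d * (N * p + q + 1)" "0 \<le> q" "q < N" for p q c
  proof -
    have "N ^ d * (N * p) \<le> N ^ d * (N * p + q)" "N ^ d * (N * p + q + 1) \<le> N ^ d * (N * (p + 1))"
      by (intro mult_left_mono; use that N_pos in \<open>simp add: distrib_left\<close>)+
    moreover have "N ^ Suc d * p = N ^ d * (N * p)" "N ^ Suc d * (p + 1) = N ^ d * (N * (p + 1))"
      by (simp_all only: power_Suc mult_ac)
    ultimately show ?thesis using that(1,2) by linarith
  qed
  have e: "0 \<le> fst e" "fst e < N" "0 \<le> snd e" "snd e < N" using A(2) by (auto simp: D_def)
  have "A' \<in> corners A'" by (cases A') (simp add: corners_def)
  then have x': "A' \<in> verts (Suc (Suc m))" "A' \<in> block A" "\<bar>eig (Suc m + d) y - eig (Suc m) A'\<bar> \<le> 3 * C * (2/3) ^ Suc m"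
    using A' corners_shift_block[OF A(2), of A' A] by (auto simp: verts_def A(3))
  have "\<bar>eig (m + Suc d) y - eig m x\<bar> \<le> 3 * C * (2/3) ^ m" if "x \<in> corners A" for x
    using C(2)[OF A(1) x'(1,2) that] x'(3) by simp
  then show ?case
    using A(1) loc[of "fst A" "fst e" "fst y"] loc[of "snd A" "snd e" "snd y"] A'(2-5) e
    by (intro bexI[of _ A]) (auto simp: A(3) shift_def)
qed

lemma refine_iterate:
  assumes "y \<in> verts (Suc m)"
  shows "(refine ^^ d) y \<in> verts (Suc (m + d))" "pt (Suc (m + d)) ((refine ^^ d) y) = pt (Suc m) y" "eig (m + d) ((refine ^^ d) y) = eig m y"
proof (induction d)
  case (Suc d)
  {
    case 1
    show ?case using refine_verts[OF Suc(1)] by simp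
  next
    case 2
    show ?case using Suc(2) pt_refine[of "Suc (m + d)"] by simp
  next
    case 3
    show ?case using Suc(3) eig_refine(2)[OF Suc(1)] by simp
  }
qed (use assms in auto)

text \<open>A point of \<open>Vinf\<close> has coordinates on all sufficiently fine levels;
  \<open>eigfun_pt\<close> shows that the value does not depend on the level.\<close>

definition eigfun :: "real \<times> real \<Rightarrow> real" where
  "eigfun x = (SOME v. \<exists>m. \<exists>y\<in>verts (Suc m). x = pt (Suc m) y \<and> v = eig m y)"

lemma eigfun_pt:
  assumes y: "y \<in> verts (Suc m)" shows "eigfun (pt (Suc m) y) = eig m y"
proof -
  have same: "eig m' y' = eig m y" if y': "y' \<in> verts (Suc m')" "pt (Suc m) y = pt (Suc m') y'" for m' y'
  proof -
    have "pt (Suc (m + m')) ((refine ^^ m') y) = pt (Suc (m + m')) ((refine ^^ m) y')"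
      using refine_iterate(2)[OF y, of m'] refine_iterate(2)[OF y'(1), of m] y'(2) by (simp add: add.commute)
    then have "(refine ^^ m') y = (refine ^^ m) y'" by simp
    then show ?thesis using refine_iterate(3)[OF y, of m'] refine_iterate(3)[OF y'(1), of m] by (simp add: add.commute)
  qed
  have "\<exists>m'. \<exists>y'\<in>verts (Suc m'). pt (Suc m) y = pt (Suc m') y' \<and> eigfun (pt (Suc m) y) = eig m' y'"
    unfolding eigfun_def by (rule someI_ex) (use y in blast)
  then show ?thesis using same by auto
qed

lemma Vinf_level:
  assumes "x \<in> Vinf" "x' \<in> Vinf"
  obtains d y y' where "y \<in> verts (Suc (m + d))" "y' \<in> verts (Suc (m + d))" "x = pt (Suc (m + d)) y" "x' = pt (Suc (m + d)) y'"
proof -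
  obtain i j where "x \<in> vicsek_V n i" "x' \<in> vicsek_V n j" using assms by (auto simp: Vinf_def)
  then have "x \<in> vicsek_V n (Suc (m + (i + j)))" "x' \<in> vicsek_V n (Suc (m + (i + j)))"
    using subsetD[OF vicsek_V_mono[of i "Suc (m + (i + j))"]] subsetD[OF vicsek_V_mono[of j "Suc (m + (i + j))"]]
    by (simp_all del: vicsek_V.simps)
  then show thesis using that[of _ "i + j"] unfolding vicsek_V_eq by auto
qed

lemma shared_corner:
  assumes "A \<in> cells m" "A' \<in> cells m"
    "fst A \<le> fst A' + 1" "fst A' \<le> fst A + 1" "snd A \<le> snd A' + 1" "snd A' \<le> snd A + 1"
  shows "\<exists>x. x \<in> corners A \<and> x \<in> corners A'"
proof (cases "A = A'")
  case False
  have nb: "(fst A = fst A' + 1 \<or> fst A' = fst A + 1) \<and> (snd A = snd A' + 1 \<or> snd A' = snd A + 1)"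
    using even_neighbours[of "fst A" "snd A" "fst A'" "snd A'"] assms cells_even[OF assms(1)] cells_even[OF assms(2)] False
    by (simp add: prod_eq_iff)
  show ?thesis
    by (rule exI[of _ "(max (fst A) (fst A'), max (snd A) (snd A'))"]) (use nb in \<open>cases A; cases A'; auto simp: corners_def\<close>)
qed (auto simp: corners_def)

text \<open>Points closer than the side of a cell of level \<open>Suc m\<close> lie in cells of that
  level that coincide or share a corner, and passing through that corner costs
  \<open>3 * C + 3 * C\<close> times \<open>(2/3) ^ m\<close>. Uniformity permits the extension to
  the closure.\<close>

lemma eigfun_uniformly_continuous: "uniformly_continuous_on Vinf eigfun"
proof -
  obtain C where C0: "C > 0"
    and C: "\<And>m A x y. A \<in> cells (Suc m) \<Longrightarrow> y \<in> corners A \<Longrightarrow> x \<in> corners A \<Longrightarrow> \<bar>eig m y - eig m x\<bar> \<le> C * (2/3) ^ m"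
      "\<And>m A x y. A \<in> cells (Suc m) \<Longrightarrow> y \<in> verts (Suc (Suc m)) \<Longrightarrow> y \<in> block A \<Longrightarrow> x \<in> corners A \<Longrightarrow> \<bar>eig (Suc m) y - eig m x\<bar> \<le> C * (2/3) ^ m"
    using eig_step by blast
  have anc: "\<exists>A\<in>cells (Suc m).
      N ^ d * fst A \<le> fst y \<and> fst y \<le> N ^ d * (fst A + 1) \<and> N ^ d * snd A \<le> snd y \<and> snd y \<le> N ^ d * (snd A + 1) \<and>
      (\<forall>x\<in>corners A. \<bar>eig (m + d) y - eig m x\<bar> \<le> 3 * C * (2/3) ^ m)"
    if "y \<in> verts (Suc (m + d))" for m d y
  proof (rule eig_ancestor[OF _ _ C0 that])
  qed (rule C(1), assumption+, rule C(2), assumption+)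
  show ?thesis unfolding uniformly_continuous_on_def
  proof (intro allI impI)
    fix e :: real assume e: "e > 0"
    have "(\<lambda>m. 6 * C * (2/3::real) ^ m) \<longlonglongrightarrow> 6 * C * 0" by (intro tendsto_intros LIMSEQ_power_zero) simp
    then have "\<forall>\<^sub>F m in sequentially. 6 * C * (2/3::real) ^ m < e" using e order_tendstoD(2) by fastforce
    then obtain m where m: "6 * C * (2/3::real) ^ m < e" by (auto simp: eventually_sequentially)
    let ?d = "1 / Nr ^ Suc m"
    show "\<exists>d>0. \<forall>x\<in>Vinf. \<forall>x'\<in>Vinf. dist x' x < d \<longrightarrow> dist (eigfun x') (eigfun x) < e"
    proof (intro exI[of _ ?d] conjI ballI impI)
      show "0 < ?d" using Nr_pos by simp
      fix x x' assume x: "x \<in> Vinf" "x' \<in> Vinf" "dist x' x < ?d"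
      obtain d y y' where y: "y \<in> verts (Suc (m + d))" "y' \<in> verts (Suc (m + d))" "x = pt (Suc (m + d)) y" "x' = pt (Suc (m + d)) y'"
        using Vinf_level[OF x(1,2)] .
      have Np: "Nr ^ d > 0" "Nr ^ Suc m > 0" using Nr_pos by auto
      have close: "\<bar>i - j\<bar> < N ^ d" if "\<bar>real_of_int i / Nr ^ Suc (m + d) - real_of_int j / Nr ^ Suc (m + d)\<bar> < ?d" for i j
      proof -
        have P: "Nr ^ Suc (m + d) = Nr ^ Suc m * Nr ^ d" by (simp add: power_add)
        have "\<bar>real_of_int i / Nr ^ Suc (m + d) - real_of_int j / Nr ^ Suc (m + d)\<bar> = \<bar>real_of_int (i - j)\<bar> / (Nr ^ Suc m * Nr ^ d)"
          unfolding P by (simp only: diff_divide_distrib[symmetric] abs_divide of_int_diff abs_of_pos[OF mult_pos_pos[OF Np(2,1)]])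
        moreover have "x < Q" if "x / (P * Q) < 1 / P" "0 < P" "0 < Q" for x P Q :: real
          using that by (simp add: field_simps)
        ultimately have "\<bar>real_of_int (i - j)\<bar> < Nr ^ d" using that Np by metis
        then have "real_of_int \<bar>i - j\<bar> < real_of_int (N ^ d)" by (simp add: real_N)
        then show ?thesis by (simp only: of_int_less_iff)
      qed
      have "\<bar>fst x' - fst x\<bar> < ?d" "\<bar>snd x' - snd x\<bar> < ?d"
        using x(3) dist_fst_le[of x' x] dist_snd_le[of x' x] by (auto simp: dist_real_def)
      then have cl: "\<bar>fst y' - fst y\<bar> < N ^ d" "\<bar>snd y' - snd y\<bar> < N ^ d"
        using close[of "fst y'" "fst y"] close[of "snd y'" "snd y"] unfolding y(3,4) by (auto simp: pt_def)
      obtain A where A: "A \<in> cells (Suc m)" "N ^ d * fst A \<le> fst y" "fst y \<le> N ^ d * (fst A + 1)"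
        "N ^ d * snd A \<le> snd y" "snd y \<le> N ^ d * (snd A + 1)"
        "\<And>x. x \<in> corners A \<Longrightarrow> \<bar>eig (m + d) y - eig m x\<bar> \<le> 3 * C * (2/3) ^ m"
        using anc[OF y(1)] by blast
      obtain A' where A': "A' \<in> cells (Suc m)" "N ^ d * fst A' \<le> fst y'" "fst y' \<le> N ^ d * (fst A' + 1)"
        "N ^ d * snd A' \<le> snd y'" "snd y' \<le> N ^ d * (snd A' + 1)"
        "\<And>x. x \<in> corners A' \<Longrightarrow> \<bar>eig (m + d) y' - eig m x\<bar> \<le> 3 * C * (2/3) ^ m"
        using anc[OF y(2)] by blast
      have near: "p \<le> q + 1" if "N ^ d * p \<le> i" "j \<le> N ^ d * (q + 1)" "\<bar>i - j\<bar> < N ^ d" for p q i j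
      proof -
        have "N ^ d * p < N ^ d * (q + 2)" using that by (simp add: distrib_left)
        then show ?thesis using N_pos by simp
      qed
      have "\<exists>w. w \<in> corners A \<and> w \<in> corners A'"
        using near[of "fst A" "fst y" "fst y'" "fst A'"] near[of "fst A'" "fst y'" "fst y" "fst A"]
          near[of "snd A" "snd y" "snd y'" "snd A'"] near[of "snd A'" "snd y'" "snd y" "snd A"] A(1-5) A'(1-5) cl
        by (intro shared_corner[of A "Suc m"]) (auto simp: abs_minus_commute)
      then obtain w where w: "w \<in> corners A" "w \<in> corners A'" by blast
      have "\<bar>eig (m + d) y' - eig (m + d) y\<bar> \<le> 6 * C * (2/3) ^ m"
        using A(6)[OF w(1)] A'(6)[OF w(2)] by linarith
      then show "dist (eigfun x') (eigfun x) < e"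
        unfolding y(3,4) eigfun_pt[OF y(1)] eigfun_pt[OF y(2)] dist_real_def using m by linarith
    qed
  qed
qed

text \<open>On level \<open>Suc m\<close> the graph equation is exact with value
  \<open>lv m\<close>. The error is therefore the distance of \<open>rho n ^ Suc m * lv m\<close>
  from its limit times a bounded function, uniformly over the vertices.\<close>

lemma eigenvalue_exists:
  assumes z: "z \<in> verts 0" "f0 z \<noteq> 0"
  shows "rho n * psi n (X a1) \<in> vicsek_spectrum n"
proof -
  let ?\<mu> = "rho n * psi n (X a1)"
  obtain u where u: "uniformly_continuous_on (closure Vinf) u" "\<And>x. x \<in> Vinf \<Longrightarrow> eigfun x = u x"
    using uniformly_continuous_on_extension_on_closure[OF eigfun_uniformly_continuous] by metis
  obtain B where B: "B > 0" "\<And>m y. y \<in> verts (Suc m) \<Longrightarrow> \<bar>eig m y\<bar> \<le> B" using eig_bounded by blast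
  have up: "u (pt (Suc m) y) = eig m y" if "y \<in> verts (Suc m)" for m y
  proof -
    have "pt (Suc m) y \<in> Vinf" unfolding Vinf_def vicsek_V_eq using that by blast
    then show ?thesis using u(2) eigfun_pt[OF that] by simp
  qed
  have gl: "graph_laplacian n (Suc m) u (pt (Suc m) y) = - lv m * eig m y" if y: "y \<in> verts (Suc m)" for m y
  proof -
    have "Lam (cells (Suc m)) (lv m) (u \<circ> pt (Suc m)) y = Lam (cells (Suc m)) (lv m) (eig m) y"
      by (rule Lam_cong) (use up in \<open>auto simp: verts_def\<close>)
    also have "\<dots> = 0" by (rule eig_Lam[OF y])
    finally have "Lam (cells (Suc m)) 0 (u \<circ> pt (Suc m)) y = - 3 * lv m * eig m y * vdeg (Suc m) y"
      unfolding Lam_lam[of _ "lv m"] using up[OF y] by simp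
    then show ?thesis unfolding graph_laplacian_pt[OF y] using vdeg_pos[OF y] by simp
  qed
  have lim: "(\<lambda>m. rho n * (rho n ^ m * lv m)) \<longlonglongrightarrow> ?\<mu>"
    unfolding lv_def by (intro tendsto_mult_left psi_props(1)) (use X1 X1_pos in auto)
  have cont: "continuous_on (vicsek_set n) u"
    unfolding vicsek_set_eq by (rule uniformly_continuous_imp_continuous[OF u(1)])
  have "vicsek_laplacian n u (\<lambda>x. - ?\<mu> * u x)"
    unfolding vicsek_laplacian_def
  proof (intro conjI allI impI cont continuous_intros)
    fix e :: real assume e: "e > 0"
    have "\<forall>\<^sub>F m in sequentially. \<bar>rho n * (rho n ^ m * lv m) - ?\<mu>\<bar> < e / B"
      using tendstoD[OF lim, of "e / B"] e B(1) by (simp add: dist_real_def)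
    then have "\<forall>\<^sub>F m in sequentially. \<forall>x\<in>vicsek_V n (Suc m). \<bar>rho n ^ Suc m * graph_laplacian n (Suc m) u x - - ?\<mu> * u x\<bar> < e"
    proof eventually_elim
      case (elim m)
      show ?case
      proof
        fix x assume "x \<in> vicsek_V n (Suc m)"
        then obtain y where y: "y \<in> verts (Suc m)" "x = pt (Suc m) y" unfolding vicsek_V_eq by auto
        have "rho n ^ Suc m * graph_laplacian n (Suc m) u x - - ?\<mu> * u x = - (rho n * (rho n ^ m * lv m) - ?\<mu>) * eig m y"
          unfolding y(2) gl[OF y(1)] up[OF y(1)] by (simp add: algebra_simps)
        then have "\<bar>rho n ^ Suc m * graph_laplacian n (Suc m) u x - - ?\<mu> * u x\<bar> = \<bar>rho n * (rho n ^ m * lv m) - ?\<mu>\<bar> * \<bar>eig m y\<bar>"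
          by (simp only: abs_mult abs_minus_cancel)
        also have "\<dots> \<le> \<bar>rho n * (rho n ^ m * lv m) - ?\<mu>\<bar> * B" by (intro mult_left_mono B(2) y(1)) simp
        also have "\<dots> < e" using elim B(1) by (simp add: pos_less_divide_eq)
        finally show "\<bar>rho n ^ Suc m * graph_laplacian n (Suc m) u x - - ?\<mu> * u x\<bar> < e" .
      qed
    qed
    then show "\<forall>\<^sub>F m in sequentially. \<forall>x\<in>vicsek_V n m. \<bar>rho n ^ m * graph_laplacian n m u x - - ?\<mu> * u x\<bar> < e"
      by (rule eventually_sequentially_Suc[THEN iffD1])
  qed
  moreover have "u (pt (Suc 0) (refine z)) \<noteq> 0"
    using up[OF refine_verts[OF z(1)]] eig_refine(1)[OF z(1)] z(2) by simp
  moreover have "pt (Suc 0) (refine z) \<in> vicsek_set n"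
    unfolding vicsek_set_eq using closure_subset refine_verts[OF z(1)]
    by (auto simp: Vinf_def vicsek_V_eq simp del: pt_refine intro!: subsetD[OF closure_subset] exI[of _ "Suc 0"])
  ultimately show ?thesis unfolding vicsek_spectrum_def by blast
qed

end
end

section \<open>Exhaustion of the low spectrum\<close>

context vicsek begin

lemma zero_on_Vinf:
  assumes "continuous_on (vicsek_set n) u" "\<And>x. x \<in> Vinf \<Longrightarrow> u x = 0" "x \<in> vicsek_set n"
  shows "(u x :: real) = 0"
  using assms unfolding vicsek_set_eq by (intro continuous_constant_on_closure[of Vinf u 0 x])

lemma zero_in_spectrum: "0 \<in> vicsek_spectrum n"
proof -
  have "vicsek_laplacian n (\<lambda>_. 1) (\<lambda>x. - 0 * 1)"
    unfolding vicsek_laplacian_def by (simp add: graph_laplacian_def)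
  moreover obtain x where "x \<in> vicsek_set n" using Vinf_closure(2) unfolding vicsek_set_eq ex_in_conv[symmetric] by (elim exE)
  ultimately show ?thesis unfolding vicsek_spectrum_def
    by (cases x) (intro CollectI exI[of _ "\<lambda>_. 1"], auto)
qed

text \<open>A discrete maximum principle: at a vertex where \<open>\<bar>u\<bar>\<close> is largest
  the graph Laplacian is zero or opposite in sign to \<open>u\<close>, so for negative
  \<open>\<mu>\<close> the product \<open>- \<mu> * \<bar>u\<bar>\<close> is at most the error
  \<open>e\<close>.\<close>

lemma spectrum_nonneg:
  assumes "\<mu> \<in> vicsek_spectrum n" shows "0 \<le> \<mu>"
proof (rule ccontr)
  assume neg: "\<not> 0 \<le> \<mu>"
  obtain u x0 where u: "vicsek_laplacian n u (\<lambda>x. - \<mu> * u x)" and x0: "x0 \<in> vicsek_set n" "u x0 \<noteq> 0"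
    using assms unfolding vicsek_spectrum_def by auto
  have cont: "continuous_on (vicsek_set n) u" using u by (simp add: vicsek_laplacian_def)
  have small: "\<bar>u x\<bar> \<le> e / (- \<mu>)" if x: "x \<in> Vinf" and e: "e > 0" for x e
  proof -
    obtain k where k: "x \<in> vicsek_V n k" using x by (auto simp: Vinf_def)
    have "\<forall>\<^sub>F m in sequentially. (\<forall>x\<in>vicsek_V n m. \<bar>rho n ^ m * graph_laplacian n m u x - - \<mu> * u x\<bar> < e) \<and> m \<ge> k"
      using u e unfolding vicsek_laplacian_def by (intro eventually_conj eventually_ge_at_top) auto
    then obtain m where m: "m \<ge> k" "\<And>x. x \<in> vicsek_V n m \<Longrightarrow> \<bar>rho n ^ m * graph_laplacian n m u x - - \<mu> * u x\<bar> < e"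
      by (auto simp: eventually_sequentially)
    let ?g = "u \<circ> pt m"
    have ne: "verts m \<noteq> {}" using verts_nonempty by blast
    have "Max ((\<lambda>z. \<bar>?g z\<bar>) ` verts m) \<in> (\<lambda>z. \<bar>?g z\<bar>) ` verts m"
      using ne finite_verts by (intro Max_in) auto
    then obtain y where y: "y \<in> verts m" "Max ((\<lambda>z. \<bar>?g z\<bar>) ` verts m) = \<bar>?g y\<bar>" by blast
    have y: "y \<in> verts m" "\<And>z. z \<in> verts m \<Longrightarrow> \<bar>?g z\<bar> \<le> \<bar>?g y\<bar>"
      using y Max_ge[of "(\<lambda>z. \<bar>?g z\<bar>) ` verts m"] finite_verts by auto
    have corner: "z \<in> verts m" if "B \<in> cells m" "z \<in> corners B" for B z using that by (auto simp: verts_def)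
    let ?L = "rho n ^ m * (Lam (cells m) 0 ?g y / (3 * vdeg m y))"
    have "pt m y \<in> vicsek_V n m" using y(1) by (auto simp: vicsek_V_eq)
    from m(2)[OF this] have b: "\<bar>?L + \<mu> * ?g y\<bar> < e" unfolding graph_laplacian_pt[OF y(1)] by simp
    have pos: "0 < rho n ^ m" "0 < 3 * vdeg m y" using rho_ge vdeg_pos[OF y(1)] by auto
    have "- \<mu> * \<bar>?g y\<bar> \<le> e"
    proof (cases "?g y \<ge> 0")
      case True
      have "?g z \<le> ?g y" if "z \<in> verts m" for z using y(2)[OF that] True by linarith
      then have "Lam (cells m) 0 ?g y \<le> 0"
        unfolding Lam_def Lc_def using corner by (auto intro!: sum_nonpos)
      then have "?L \<le> 0" using pos by (intro mult_nonneg_nonpos divide_nonpos_pos) auto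
      then show ?thesis using b True by simp
    next
      case False
      have "?g z \<ge> ?g y" if "z \<in> verts m" for z using y(2)[OF that] False by linarith
      then have "Lam (cells m) 0 ?g y \<ge> 0"
        unfolding Lam_def Lc_def using corner by (auto intro!: sum_nonneg)
      then have "?L \<ge> 0" using pos by (intro mult_nonneg_nonneg divide_nonneg_pos) auto
      then show ?thesis using b False by simp
    qed
    then have gy: "\<bar>?g y\<bar> \<le> e / (- \<mu>)" using neg by (simp add: field_simps)
    have "x \<in> vicsek_V n m" using k m(1) vicsek_V_mono by blast
    then obtain z where "z \<in> verts m" "x = pt m z" by (auto simp: vicsek_V_eq)
    then show ?thesis using y(2)[of z] gy by simp
  qed
  have "u x = 0" if x: "x \<in> Vinf" for x
  proof -
    have "\<bar>u x\<bar> \<le> 0 + e" if "e > 0" for e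
      using small[OF x, of "e * (- \<mu>)"] that neg by (simp add: mult_pos_neg)
    then have "\<bar>u x\<bar> \<le> 0" by (rule field_le_epsilon)
    then show ?thesis by simp
  qed
  from zero_on_Vinf[OF cont this x0(1)] show False using x0(2) by blast
qed

text \<open>\<open>4/3 \<le> rho n * X (pi / 2)\<close> puts the threshold
  \<open>1 / (4 * rho n)\<close> below \<open>X (pi / 2)\<close>, so the angle belongs to the first
  branch and the slope estimates apply.\<close>

lemma small_X:
  assumes "0 < l" "l \<le> 1 / (4 * rho n)"
  obtains a where "0 < a" "a \<le> pi / 2" "X a = l" "l \<le> 1/4" "R_fun n l \<le> rho n * l" "rho n * l * (1 - 2 * R_fun n l) \<le> R_fun n l" "0 < R_fun n l"
proof -
  have r: "rho n > 0" using rho_ge by simp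
  have "4/3 \<le> rho n * X (pi / 2)" using rho_X_bounds(1)[of "pi / 2"] R_pi_half by simp
  then have "1 / (4 * rho n) \<le> X (pi / 2)" using r by (simp add: field_simps)
  then have lX: "l \<le> X (pi / 2)" using assms by simp
  have "l < 2/3"
  proof -
    have "1 / (4 * rho n) \<le> 1/4" using rho_ge by (simp add: field_simps)
    then show ?thesis using assms by linarith
  qed
  then obtain a where a: "0 \<le> a" "a < Nr * pi / 2" "X a = l" using X_surj[of l] assms by auto
  have "a \<noteq> 0" using a assms by auto
  then have a0: "0 < a" using a by simp
  have a1: "a \<le> pi / 2"
  proof (rule ccontr)
    assume "\<not> a \<le> pi / 2"
    then have "X (pi / 2) < X a" using a by (intro X_strict_mono) auto
    then show False using lX a by simp
  qed
  have l4: "l \<le> 1/4"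
  proof -
    have "1 / (4 * rho n) \<le> 1/4" using rho_ge by (simp add: field_simps)
    then show ?thesis using assms by linarith
  qed
  have "0 < R_fun n l" using R_X_strict_mono[of 0 a] a0 a1 a by simp
  then show thesis using that[OF a0 a1 a(3) l4] rho_X_bounds(1)[OF a(1) a1] rho_X_upper[OF a(1) a1] a(3) by simp
qed

lemma R_mono_small:
  assumes "0 < l" "l \<le> l'" "l' \<le> 1 / (4 * rho n)" shows "R_fun n l \<le> R_fun n l'"
proof -
  obtain a where a: "0 < a" "a \<le> pi / 2" "X a = l" using small_X[of l] assms by auto
  obtain b where b: "0 < b" "b \<le> pi / 2" "X b = l'" using small_X[of l'] assms by auto
  have "a \<le> b" using X_less_iff[of b a] a b assms pi_half_lt by auto
  then show ?thesis using R_X_strict_mono[of a b] a b by (cases "a = b") auto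
qed

section \<open>Descent of an approximate eigenvalue from level J to level k\<close>

context
  fixes \<mu> :: real and u :: "real \<times> real \<Rightarrow> real"
  assumes mu: "0 < \<mu>" "\<mu> \<le> rho n / 4"
    and u: "vicsek_laplacian n u (\<lambda>x. - \<mu> * u x)"
begin

text \<open>The rescaled value \<open>\<mu> / rho n ^ J\<close> of level \<open>J\<close>, carried
  down to level \<open>k\<close> by \<open>R_fun n\<close>. For \<open>J\<close> tending to infinity
  it becomes the exact graph eigenvalue \<open>lev k\<close>.\<close>

definition pull :: "nat \<Rightarrow> nat \<Rightarrow> real" where
  "pull J k = (R_fun n ^^ (J - k)) (\<mu> / rho n ^ J)"

lemma pull_top [simp]: "pull J J = \<mu> / rho n ^ J" by (simp add: pull_def)

lemma pull_step: "k < J \<Longrightarrow> pull J k = R_fun n (pull J (Suc k))"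
  by (simp add: pull_def Suc_diff_Suc[symmetric] del: Suc_diff_Suc)

text \<open>The reason for the bound \<open>rho n / 4\<close> and for starting at level 2: on level
  1 it gives only \<open>\<mu> / rho n \<le> 1/4\<close>, and the angle may exceed
  \<open>pi / 2\<close>.\<close>

lemma mu_small: "2 \<le> k \<Longrightarrow> \<mu> / rho n ^ k \<le> 1 / (4 * rho n)"
proof -
  assume k: "2 \<le> k"
  have r: "1 \<le> rho n" using rho_ge by simp
  have "rho n ^ 2 \<le> rho n ^ k" using k r by (intro power_increasing) auto
  then have "\<mu> / rho n ^ k \<le> \<mu> / rho n ^ 2" using mu r by (intro divide_left_mono) auto
  also have "\<dots> \<le> (rho n / 4) / rho n ^ 2" using mu r by (intro divide_right_mono) auto
  also have "\<dots> = 1 / (4 * rho n)" using r by (simp add: power2_eq_square)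
  finally show ?thesis .
qed

lemma pull_bounds:
  assumes "1 \<le> k" "k \<le> J"
  shows "0 < pull J k \<and> pull J k \<le> \<mu> / rho n ^ k"
  using assms(2,1)
proof (induction k rule: inc_induct)
  case base
  then show ?case using mu rho_ge by simp
next
  case (step k)
  have IH: "0 < pull J (Suc k)" "pull J (Suc k) \<le> \<mu> / rho n ^ Suc k" using step by auto
  then have "pull J (Suc k) \<le> 1 / (4 * rho n)" using mu_small[of "Suc k"] step.prems by simp
  then obtain "R_fun n (pull J (Suc k)) \<le> rho n * pull J (Suc k)" "0 < R_fun n (pull J (Suc k))"
    using small_X[OF IH(1)] by metis
  moreover have "rho n * pull J (Suc k) \<le> rho n * (\<mu> / rho n ^ Suc k)" using IH rho_ge by (intro mult_left_mono) auto
  moreover have "rho n * (\<mu> / rho n ^ Suc k) = \<mu> / rho n ^ k" using rho_ge by simp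
  ultimately show ?case using step by (simp add: pull_step)
qed

lemma pull_small:
  assumes "2 \<le> k" "k \<le> J" shows "0 < pull J k" "pull J k \<le> 1 / (4 * rho n)"
  using pull_bounds[of k J] mu_small[of k] assms by auto

text \<open>One more level replaces the top value by
  \<open>R_fun n (\<mu> / rho n ^ Suc J) \<le> \<mu> / rho n ^ J\<close>, and \<open>R_fun n\<close>
  is monotone on the way down.\<close>

lemma pull_decreasing:
  assumes "1 \<le> k" "k \<le> J" shows "pull (Suc J) k \<le> pull J k"
  using assms(2,1)
proof (induction k rule: inc_induct)
  case base
  then show ?case using pull_bounds[of J "Suc J"] by simp
next
  case (step k)
  have "R_fun n (pull (Suc J) (Suc k)) \<le> R_fun n (pull J (Suc k))"
    using step pull_small[of "Suc k"] by (intro R_mono_small) auto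
  then show ?case using step by (simp add: pull_step)
qed

text \<open>The relative loss in reaching level \<open>k\<close> is at most
  \<open>2 * pull J k \<le> 2 * \<mu> / rho n ^ k\<close>; summed over the levels these bounds form
  a geometric series of ratio at most 1/15.\<close>

lemma pull_lower:
  assumes "1 \<le> k" "k \<le> J"
  shows "\<mu> * (1 - 3 * \<mu> * (1 / rho n ^ k - 1 / rho n ^ J)) \<le> rho n ^ k * pull J k"
  using assms(2,1)
proof (induction k rule: inc_induct)
  case base
  then show ?case using rho_ge by simp
next
  case (step k)
  let ?r = "rho n"
  have r: "15 \<le> ?r" by (rule rho_ge)
  let ?p = "pull J (Suc k)"
  have p: "0 < ?p" "?p \<le> 1 / (4 * ?r)" using pull_small[of "Suc k" J] step by auto
  have up: "?r * ?p * (1 - 2 * pull J k) \<le> pull J k"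
    using small_X[OF p] step(2) by (metis pull_step)
  define x where "x = 1 / ?r ^ k"
  define y where "y = 1 / ?r ^ J"
  have x: "0 < x" using r by (simp add: x_def)
  have xs: "1 / ?r ^ Suc k = x / ?r" by (simp add: x_def)
  have y: "0 < y" "y \<le> x / ?r"
  proof -
    show "0 < y" using r by (simp add: y_def)
    have "?r ^ Suc k \<le> ?r ^ J" using step r by (intro power_increasing) auto
    then show "y \<le> x / ?r" unfolding xs[symmetric] y_def using r by (intro divide_left_mono) auto
  qed
  have pk: "pull J k \<le> \<mu> * x" "0 < pull J k" using pull_bounds[of k J] step by (auto simp: x_def)
  have IH: "\<mu> * (1 - 3 * \<mu> * (x / ?r - y)) \<le> ?r ^ Suc k * ?p" using step xs by (simp add: y_def)
  have mx: "\<mu> * x \<le> 1/4"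
  proof -
    have "?r ^ 1 \<le> ?r ^ k" using step r by (intro power_increasing) auto
    then have "\<mu> \<le> ?r ^ k / 4" using mu by simp
    then show ?thesis using r by (simp add: x_def field_simps)
  qed
  have xr: "x / ?r \<le> x / 15" using r x by (intro divide_left_mono) auto
  \<comment> \<open>The constant 3 closes the induction because
    \<open>3/15 + 2 \<le> 3\<close>.\<close>
  have AB: "1 - 3 * \<mu> * (x - y) \<le> (1 - 3 * \<mu> * (x / ?r - y)) * (1 - 2 * (\<mu> * x))"
  proof -
    have "0 \<le> (3 * \<mu> * (x / ?r - y)) * (2 * (\<mu> * x))" using mu x y by (intro mult_nonneg_nonneg) auto
    moreover have "3 * \<mu> * (x / ?r) + 2 * (\<mu> * x) \<le> 3 * \<mu> * x"
    proof -
      have "3 * \<mu> * (x / ?r) = 3 * (\<mu> * (x / ?r))" "3 * \<mu> * x = 3 * (\<mu> * x)" "\<mu> * (x / 15) = \<mu> * x / 15" by simp_all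
      moreover have "\<mu> * (x / ?r) \<le> \<mu> * (x / 15)" using xr mu by (intro mult_left_mono) auto
      moreover have "0 < \<mu> * x" using mu x by simp
      ultimately show ?thesis by linarith
    qed
    moreover have "(1 - p) * (1 - q) = 1 - p - q + p * q" for p q :: real by (simp add: algebra_simps)
    note this[of "3 * \<mu> * (x / ?r - y)" "2 * (\<mu> * x)"]
    moreover have "3 * \<mu> * (x / ?r - y) = 3 * \<mu> * (x / ?r) - 3 * \<mu> * y" "3 * \<mu> * (x - y) = 3 * \<mu> * x - 3 * \<mu> * y"
      by (simp_all only: right_diff_distrib)
    ultimately show ?thesis by linarith
  qed
  have "\<mu> * (1 - 3 * \<mu> * (x - y)) \<le> \<mu> * ((1 - 3 * \<mu> * (x / ?r - y)) * (1 - 2 * (\<mu> * x)))"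
    using AB mu by (intro mult_left_mono) auto
  also have "\<dots> = (\<mu> * (1 - 3 * \<mu> * (x / ?r - y))) * (1 - 2 * (\<mu> * x))" by simp
  also have "\<dots> \<le> (?r ^ Suc k * ?p) * (1 - 2 * (\<mu> * x))" using IH mx by (intro mult_right_mono) auto
  also have "\<dots> \<le> (?r ^ Suc k * ?p) * (1 - 2 * pull J k)" using pk p r by (intro mult_left_mono) auto
  also have "\<dots> = ?r ^ k * (?r * ?p * (1 - 2 * pull J k))" by simp
  also have "\<dots> \<le> ?r ^ k * pull J k" using up r by (intro mult_left_mono) auto
  finally show ?case by (simp add: x_def y_def)
qed

lemma pull_coarse:
  assumes "1 \<le> k" "k \<le> J" and e0: "0 \<le> e"
    and e: "\<And>y. y \<in> verts J \<Longrightarrow> \<bar>Lam (cells J) (\<mu> / rho n ^ J) (u \<circ> pt J) y\<bar> \<le> e * vdeg J y"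
  shows "\<forall>y\<in>verts k. \<bar>Lam (cells k) (pull J k) (u \<circ> pt k) y\<bar> \<le> rho n ^ (J - k) * e * vdeg k y"
  using assms(2,1)
proof (induction k rule: inc_induct)
  case base
  show ?case unfolding pull_top diff_self_eq_0 power_0 mult_1_left using e by blast
next
  case (step k)
  have p: "0 < pull J (Suc k)" "pull J (Suc k) \<le> 1 / (4 * rho n)" using pull_small[of "Suc k" J] step by auto
  obtain a where a: "0 < a" "a \<le> pi / 2" "X a = pull J (Suc k)" using small_X[OF p] by metis
  have IH: "\<bar>Lam (cells (Suc k)) (X a) (u \<circ> pt (Suc k)) y\<bar> \<le> (rho n ^ (J - Suc k) * e) * vdeg (Suc k) y"
    if "y \<in> verts (Suc k)" for y using step.IH[OF le_SucI[OF step.prems]] that unfolding a(3) by blast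
  have pr: "(u \<circ> pt (Suc k)) \<circ> refine = u \<circ> pt k" by (rule ext) simp
  have rr: "rho n * (rho n ^ (J - Suc k) * e) = rho n ^ (J - k) * e"
    using step(2) by (simp add: Suc_diff_Suc[symmetric] del: Suc_diff_Suc)
  show ?case
  proof
    fix z assume z: "z \<in> verts k"
    have "\<bar>Lam (cells k) (R_fun n (X a)) ((u \<circ> pt (Suc k)) \<circ> refine) z\<bar> \<le> rho n * (rho n ^ (J - Suc k) * e) * vdeg k z"
      by (rule coarse_error[OF a(1,2) IH z]) (use e0 rho_ge in auto)
    then show "\<bar>Lam (cells k) (pull J k) (u \<circ> pt k) z\<bar> \<le> rho n ^ (J - k) * e * vdeg k z"
      unfolding pr rr using step(2) a(3) by (simp add: pull_step)
  qed
qed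

definition lev :: "nat \<Rightarrow> real" where "lev k = lim (\<lambda>J. pull (k + J) k)"

lemma lev_lim:
  assumes "1 \<le> k" shows "(\<lambda>J. pull (k + J) k) \<longlonglongrightarrow> lev k"
proof -
  have dec: "decseq (\<lambda>J. pull (k + J) k)" using pull_decreasing[of k] assms by (intro decseq_SucI) auto
  have "convergent (\<lambda>J. pull (k + J) k)"
  proof (rule Bseq_monoseq_convergent)
    have "norm (pull (k + J) k) \<le> \<mu> / rho n ^ k" for J using pull_bounds[of k "k + J"] assms by auto
    then show "Bseq (\<lambda>J. pull (k + J) k)" by (rule BseqI')
    show "monoseq (\<lambda>J. pull (k + J) k)" using dec by (simp add: monoseq_iff)
  qed
  then show ?thesis by (simp add: lev_def convergent_LIMSEQ_iff)
qed

lemma lev_bounds: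
  assumes "1 \<le> k" shows "\<mu> * (1 - 3 * \<mu> / rho n ^ k) \<le> rho n ^ k * lev k" "lev k \<le> \<mu> / rho n ^ k" "0 < lev k"
proof -
  have r: "0 < rho n" using rho_ge by simp
  have low: "\<mu> * (1 - 3 * \<mu> / rho n ^ k) \<le> rho n ^ k * pull (k + J) k" for J
  proof -
    have "\<mu> * (1 - 3 * \<mu> / rho n ^ k) \<le> \<mu> * (1 - 3 * \<mu> * (1 / rho n ^ k - 1 / rho n ^ (k + J)))"
      using mu r by (intro mult_left_mono) (auto simp: right_diff_distrib)
    then show ?thesis using pull_lower[of k "k + J"] assms by simp
  qed
  show l1: "\<mu> * (1 - 3 * \<mu> / rho n ^ k) \<le> rho n ^ k * lev k"
    by (rule LIMSEQ_le_const[OF tendsto_mult_left[OF lev_lim[OF assms]]]) (use low in auto)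
  show "lev k \<le> \<mu> / rho n ^ k"
    by (rule LIMSEQ_le_const2[OF lev_lim[OF assms]]) (use pull_bounds[of k] assms in auto)
  have "rho n ^ 1 \<le> rho n ^ k" using assms rho_ge by (intro power_increasing) auto
  then have "\<mu> \<le> rho n ^ k / 4" using mu by simp
  then have "3 * \<mu> < rho n ^ k" using mu by linarith
  then have "0 < 1 - 3 * \<mu> / rho n ^ k" using r by simp
  then have "0 < rho n ^ k * lev k" using l1 mu by (smt (verit) mult_pos_pos)
  then show "0 < lev k" using r by (simp add: zero_less_mult_iff)
qed

lemma lev_R:
  assumes "1 \<le> k" shows "R_fun n (lev (Suc k)) = lev k"
proof -
  have "isCont (R_fun n) (lev (Suc k))" using R_continuous[of UNIV] by (simp add: continuous_on_eq_continuous_at)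
  from isCont_tendsto_compose[OF this lev_lim]
  have "(\<lambda>J. R_fun n (pull (Suc k + J) (Suc k))) \<longlonglongrightarrow> R_fun n (lev (Suc k))" by simp
  moreover have "R_fun n (pull (Suc k + J) (Suc k)) = pull (k + Suc J) k" for J
    by (simp add: pull_step)
  moreover have "(\<lambda>J. pull (k + Suc J) k) \<longlonglongrightarrow> lev k" using lev_lim[OF assms] by (rule LIMSEQ_Suc)
  ultimately show ?thesis using LIMSEQ_unique by auto
qed

lemma lev_angle:
  assumes "2 \<le> k" obtains a where "0 < a" "a \<le> pi / 2" "X a = lev k"
  using small_X[of "lev k"] lev_bounds(2,3)[of k] mu_small[OF assms] assms by (metis One_nat_def Suc_1 Suc_leD order_trans)

text \<open>The defining limit makes the error on level \<open>k + J\<close> an arbitrarily small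
  multiple of \<open>1 / rho n ^ (k + J)\<close>. The descent multiplies it by
  \<open>rho n ^ J\<close>, so on level \<open>k\<close> it still tends to 0 with growing
  \<open>J\<close>, and the equation is exact there.\<close>

lemma lev_Lam:
  assumes k: "1 \<le> k" and z: "z \<in> verts k" shows "Lam (cells k) (lev k) (u \<circ> pt k) z = 0"
proof -
  let ?L = "\<lambda>J. Lam (cells k) (pull (k + J) k) (u \<circ> pt k) z"
  have r: "0 < rho n" using rho_ge by simp
  have "?L \<longlonglongrightarrow> Lam (cells k) (lev k) (u \<circ> pt k) z"
    unfolding Lam_lam[of k "pull _ k"] Lam_lam[of k "lev k"] by (intro tendsto_intros lev_lim k)
  moreover have "?L \<longlonglongrightarrow> 0"
  proof (rule LIMSEQ_I)
    fix e :: real assume e: "0 < e"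
    \<comment> \<open>Sized so that \<open>3 * d / rho n ^ k * vdeg k z < e\<close>; the 3 undoes
      the normalization by the degree \<open>3 * vdeg\<close>.\<close>
    define d where "d = e / (1 + vdeg k z) * rho n ^ k / 3"
    have v: "0 \<le> vdeg k z" by (simp add: vdeg_def)
    have d: "d > 0" unfolding d_def using e r v by (intro divide_pos_pos mult_pos_pos) auto
    have "\<forall>\<^sub>F m in sequentially. \<forall>x\<in>vicsek_V n m. \<bar>rho n ^ m * graph_laplacian n m u x - - \<mu> * u x\<bar> < d"
      using u d unfolding vicsek_laplacian_def by blast
    then obtain m0 where m0: "\<And>m x. m \<ge> m0 \<Longrightarrow> x \<in> vicsek_V n m \<Longrightarrow> \<bar>rho n ^ m * graph_laplacian n m u x - - \<mu> * u x\<bar> < d"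
      by (auto simp: eventually_sequentially)
    show "\<exists>no. \<forall>J\<ge>no. norm (?L J - 0) < e"
    proof (intro exI[of _ m0] allI impI)
      fix J assume J: "J \<ge> m0"
      let ?m = "k + J"
      have bd: "\<bar>Lam (cells ?m) (\<mu> / rho n ^ ?m) (u \<circ> pt ?m) y\<bar> \<le> (3 * d / rho n ^ ?m) * vdeg ?m y" if y: "y \<in> verts ?m" for y
      proof -
        let ?l = "Lam (cells ?m) 0 (u \<circ> pt ?m) y" and ?v = "vdeg ?m y"
        have v: "?v > 0" by (rule vdeg_pos[OF y])
        have "pt ?m y \<in> vicsek_V n ?m" using y by (auto simp: vicsek_V_eq)
        then have b: "\<bar>rho n ^ ?m * (?l / (3 * ?v)) + \<mu> * u (pt ?m y)\<bar> < d"
          using m0[of ?m "pt ?m y"] J by (simp add: graph_laplacian_pt[OF y])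
        have eq: "Lam (cells ?m) (\<mu> / rho n ^ ?m) (u \<circ> pt ?m) y
            = (rho n ^ ?m * (?l / (3 * ?v)) + \<mu> * u (pt ?m y)) * (3 * ?v / rho n ^ ?m)"
          unfolding Lam_lam[of _ "\<mu> / rho n ^ ?m"] using v r by (simp add: field_simps)
        have "\<bar>Lam (cells ?m) (\<mu> / rho n ^ ?m) (u \<circ> pt ?m) y\<bar> \<le> d * (3 * ?v / rho n ^ ?m)"
          unfolding eq abs_mult using b v r d by (intro mult_mono) auto
        then show ?thesis by (simp add: mult_ac)
      qed
      have "\<bar>?L J\<bar> \<le> rho n ^ (?m - k) * (3 * d / rho n ^ ?m) * vdeg k z"
        using pull_coarse[OF k _ _ bd] d r z by simp
      also have "\<dots> = 3 * d / rho n ^ k * vdeg k z" using r by (simp add: power_add)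
      also have "\<dots> = e * (vdeg k z / (1 + vdeg k z))" 
      proof -
        have "3 * (x * p / 3) / p * w = x * w" if "p > 0" for x p w :: real using that by simp
        from this[of "rho n ^ k" "e / (1 + vdeg k z)" "vdeg k z"] show ?thesis using r by (simp add: d_def)
      qed
      also have "\<dots> < e * 1" using e v by (intro mult_strict_left_mono) auto
      finally show "norm (?L J - 0) < e" by simp
    qed
  qed
  ultimately show ?thesis by (rule LIMSEQ_unique)
qed

text \<open>If \<open>u\<close> vanished on level 1, \<open>fine_zero\<close> would carry the zero
  to all levels, and continuity to the whole set. So level 1 has a nonzero exact solution, to which
  \<open>level1_angle\<close> applies.\<close>

lemma spectrum_angle_aux:
  assumes x0: "x0 \<in> vicsek_set n" "u x0 \<noteq> 0"
  shows "\<exists>a. 0 < a \<and> a < Nr * pi / 2 \<and> (cos a = 0 \<or> sin (gam a) = 0) \<and> X a \<le> \<mu> / rho n \<and> \<mu> = rho n * psi n (X a)"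
proof -
  have r: "15 \<le> rho n" by (rule rho_ge)
  have l1: "0 < lev 1" "lev 1 \<le> \<mu> / rho n" using lev_bounds[of 1] by auto
  have "\<mu> / rho n \<le> (rho n / 4) / rho n" using mu r by (intro divide_right_mono) auto
  moreover have "(rho n / 4) / rho n = 1/4" using r by simp
  ultimately have l4: "lev 1 \<le> 1/4" using l1 by linarith
  obtain a where a: "0 \<le> a" "a < Nr * pi / 2" "X a = lev 1" using X_surj[of "lev 1"] l1 l4 by auto
  have a0: "0 < a" using a l1 by (cases "a = 0") auto
  have "\<exists>y\<in>verts 1. (u \<circ> pt 1) y \<noteq> 0"
  proof (rule ccontr)
    assume "\<not> ?thesis"
    then have z1: "(u \<circ> pt 1) y = 0" if "y \<in> verts 1" for y using that by blast
    have z: "\<forall>y\<in>verts (Suc k). (u \<circ> pt (Suc k)) y = 0" for k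
    proof (induction k)
      case 0
      then show ?case using z1 by simp
    next
      case (Suc k)
      obtain b where b: "0 < b" "b \<le> pi / 2" "X b = lev (Suc (Suc k))" using lev_angle[of "Suc (Suc k)"] by auto
      show ?case
      proof
        fix y assume y: "y \<in> verts (Suc (Suc k))"
        show "(u \<circ> pt (Suc (Suc k))) y = 0"
        proof (rule fine_zero[OF b(1,2) _ _ y])
          show "Lam (cells (Suc (Suc k))) (X b) (u \<circ> pt (Suc (Suc k))) y = 0" if "y \<in> verts (Suc (Suc k))" for y
            unfolding b(3) using that by (intro lev_Lam) auto
          show "(u \<circ> pt (Suc (Suc k))) (refine z) = 0" if "z \<in> verts (Suc k)" for z using Suc that by simp
        qed
      qed
    qed
    have "u x = 0" if x: "x \<in> Vinf" for x
    proof -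
      obtain k where "x \<in> vicsek_V n k" using x by (auto simp: Vinf_def)
      then have "x \<in> vicsek_V n (Suc k)" using subsetD[OF vicsek_V_mono[of k "Suc k"]] by (simp del: vicsek_V.simps)
      then show ?thesis using z[of k] unfolding vicsek_V_eq by auto
    qed
    moreover have "continuous_on (vicsek_set n) u" using u by (simp add: vicsek_laplacian_def)
    ultimately show False using zero_on_Vinf x0 by blast
  qed
  then obtain y where y: "y \<in> verts 1" "(u \<circ> pt 1) y \<noteq> 0" by blast
  have ang: "cos a = 0 \<or> sin (gam a) = 0"
    by (rule level1_angle[where g = "u \<circ> pt 1", OF a0 a(2) _ y]) (use lev_Lam[of 1] a(3) in simp)
  \<comment> \<open>From level 2 on the angles are at most \<open>pi / 2\<close>, so
    \<open>lev\<close> follows the first branch.\<close>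
  have it: "(phi n 1 ^^ m) (lev 1) = lev (Suc m)" for m
  proof (induction m)
    case (Suc m)
    obtain b where b: "0 < b" "b \<le> pi / 2" "X b = lev (Suc (Suc m))" using lev_angle[of "Suc (Suc m)"] by auto
    have "R_fun n (X b) = lev (Suc m)" using lev_R[of "Suc m"] b by simp
    then have "phi n 1 (lev (Suc m)) = lev (Suc (Suc m))" using phi_1_X[of b] b by simp
    then show ?case using Suc by simp
  qed simp
  have "(\<lambda>m. rho n * (rho n ^ m * (phi n 1 ^^ m) (lev 1))) \<longlonglongrightarrow> rho n * psi n (lev 1)"
    by (intro tendsto_mult_left psi_props(1)) (use l1 l4 in auto)
  then have lim: "(\<lambda>m. rho n ^ Suc m * lev (Suc m)) \<longlonglongrightarrow> rho n * psi n (lev 1)" unfolding it by (simp add: mult.assoc)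
  have "(\<lambda>m. rho n ^ Suc m * lev (Suc m)) \<longlonglongrightarrow> \<mu>"
  proof (rule tendsto_sandwich)
    have "(\<lambda>m. (1 / rho n) ^ Suc m) \<longlonglongrightarrow> 0" by (rule LIMSEQ_Suc[OF LIMSEQ_power_zero]) (use r in simp)
    then have "(\<lambda>m. \<mu> * (1 - 3 * \<mu> * (1 / rho n) ^ Suc m)) \<longlonglongrightarrow> \<mu> * (1 - 3 * \<mu> * 0)" by (intro tendsto_intros)
    then show "(\<lambda>m. \<mu> * (1 - 3 * \<mu> / rho n ^ Suc m)) \<longlonglongrightarrow> \<mu>" by (simp add: power_divide)
    show "\<forall>\<^sub>F m in sequentially. \<mu> * (1 - 3 * \<mu> / rho n ^ Suc m) \<le> rho n ^ Suc m * lev (Suc m)"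
      by (intro always_eventually allI lev_bounds(1)) simp
    show "\<forall>\<^sub>F m in sequentially. rho n ^ Suc m * lev (Suc m) \<le> \<mu>"
    proof (intro always_eventually allI)
      fix m
      have "rho n ^ Suc m * lev (Suc m) \<le> rho n ^ Suc m * (\<mu> / rho n ^ Suc m)"
        using lev_bounds(2)[of "Suc m"] r by (intro mult_left_mono) auto
      then show "rho n ^ Suc m * lev (Suc m) \<le> \<mu>" using r by simp
    qed
  qed simp
  then have "\<mu> = rho n * psi n (X a)" using LIMSEQ_unique[OF lim] a(3) by simp
  then show ?thesis using a0 a ang l1 by auto
qed

end

lemma spectrum_angle:
  assumes "\<mu> \<in> vicsek_spectrum n" "0 < \<mu>" "\<mu> \<le> rho n / 4"
  shows "\<exists>a. 0 < a \<and> a < Nr * pi / 2 \<and> (cos a = 0 \<or> sin (gam a) = 0) \<and> X a \<le> \<mu> / rho n \<and> \<mu> = rho n * psi n (X a)"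
  using assms spectrum_angle_aux unfolding vicsek_spectrum_def by blast

end

section \<open>The limit\<close>

context vicsek begin

text \<open>For large \<open>n\<close>, even \<open>l\<close> gives the angle of
  \<open>phi n (l + 1) 0\<close> and odd \<open>l\<close> that of
  \<open>phi n l (4/3)\<close>.\<close>

definition low_angle :: "nat \<Rightarrow> real" where
  "low_angle l = (if even l then E (real l * pi / 2) else real l * pi / 2)"

definition low :: "nat \<Rightarrow> real" where "low l = rho n * psi n (X (low_angle l))"

text \<open>\<open>a\<close> and \<open>gam a\<close> differ by \<open>delta a\<close>, strictly
  between 0 and \<open>pi / 2\<close>. So when \<open>sin (gam a)\<close> or \<open>cos a\<close>
  vanishes, \<open>sin a\<close> and \<open>cos (gam a)\<close> do not.\<close>

lemma low_angle_props:
  assumes "3 * real l < Nr" "l \<ge> 1"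
  shows "regular (low_angle l)" "R_fun n (X (low_angle l)) = (if even l then 0 else 4/3)"
proof -
  have lt: "3 * (real l * pi / 2) < Nr * pi / 2" using assms(1) by simp
  have l0: "0 < real l * pi / 2" using assms(2) by simp
  have "regular (low_angle l) \<and> R_fun n (X (low_angle l)) = (if even l then 0 else 4/3)"
  proof (cases "even l")
    case True
    let ?a = "E (real l * pi / 2)"
    have a: "0 < ?a" "?a < Nr * pi / 2" "gam ?a = real l * pi / 2"
      using E_props[of "real l * pi / 2"] E_bounds(4)[of "real l * pi / 2"] lt l0 by auto
    obtain k where k: "l = 2 * k" using True by auto
    have g: "sin (gam ?a) = 0" using a(3) by (simp add: k)
    have c: "cos (gam ?a) \<noteq> 0" using g sin_cos_squared_add[of "gam ?a"] by auto
    have d: "0 < delta ?a" "delta ?a < pi / 2" using delta_pos[OF a(1,2)] delta_bounds[of ?a] a by auto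
    have "sin ?a = sin (gam ?a + delta ?a)" by (simp add: gam_def)
    also have "\<dots> = cos (gam ?a) * sin (delta ?a)" using g by (simp add: sin_add)
    finally have "sin ?a \<noteq> 0" using c d sin_gt_zero[of "delta ?a"] by auto
    then show ?thesis using a c g R_X(1)[of ?a] True by (simp add: regular_def low_angle_def)
  next
    case False
    let ?a = "real l * pi / 2"
    have a: "0 < ?a" "?a < Nr * pi / 2" using l0 lt by linarith+
    obtain k where k: "l = 2 * k + 1" using False oddE by blast
    have "?a = pi / 2 + real k * pi" unfolding k by (simp add: algebra_simps)
    then have ca: "cos ?a = 0" using cos_eq_0_nonneg[of ?a] a by auto
    then have sa: "sin ?a \<noteq> 0" using sin_cos_squared_add[of ?a] by auto
    have d: "0 < delta ?a" "delta ?a < pi / 2" using delta_pos[OF a] delta_bounds[of ?a] a by auto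
    have "cos (gam ?a) = sin ?a * sin (delta ?a)" using ca by (simp add: gam_def cos_diff)
    then have "cos (gam ?a) \<noteq> 0" using sa d sin_gt_zero[of "delta ?a"] by auto
    then show ?thesis using a ca sa R_X(2)[of ?a] False by (simp add: regular_def low_angle_def)
  qed
  then show "regular (low_angle l)" "R_fun n (X (low_angle l)) = (if even l then 0 else 4/3)" by auto
qed

lemma low_0: "low 0 = 0"
proof -
  have "psi n 0 = 0" using psi_props(2,3)[of 0] by simp
  then show ?thesis by (simp add: low_def low_angle_def E_0)
qed

lemma low_in_spectrum:
  assumes "3 * real l < Nr" "X (low_angle l) \<le> 1/10"
  shows "low l \<in> vicsek_spectrum n"
proof (cases "l = 0")
  case False
  then have l: "l \<ge> 1" by simp
  note p = low_angle_props[OF assms(1) l]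
  \<comment> \<open>Level 0 is the complete graph on four vertices: constants have eigenvalue 0,
    functions of sum zero have eigenvalue 4/3.\<close>
  define f :: "int \<times> int \<Rightarrow> real" where
    "f = (if even l then (\<lambda>_. 1) else (\<lambda>y. if y = (0, 0) then 1 else if y = (1, 1) then - 1 else 0))"
  have S: "{B \<in> cells 0. y \<in> corners B} = {(0, 0)}" if "y \<in> verts 0" for y using that by (auto simp: verts_def)
  have "Lam (cells 0) (R_fun n (X (low_angle l))) f y = 0" if y: "y \<in> verts 0" for y
    unfolding p(2) Lam_def S[OF y] by (simp add: Lc_def f_def sum_subtractf sum_corners)
  moreover have "(0, 0) \<in> verts 0" by (rule verts_nonempty)
  moreover have "f (0, 0) \<noteq> 0" by (simp add: f_def)
  ultimately show ?thesis unfolding low_def by (rule eigenvalue_exists[OF p(1) assms(2)])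
qed (simp add: low_0 zero_in_spectrum)

text \<open>\<open>X a \<le> \<mu> / rho n\<close> bounds the angle from above, and
  \<open>real l * pi / 2 \<le> a\<close> holds for both parities because
  \<open>gam a \<le> a\<close>. The cutoff \<open>c\<close> thus leaves only the indices up to
  \<open>L\<close>.\<close>

lemma spectrum_low:
  assumes \<mu>: "\<mu> \<in> vicsek_spectrum n" "\<mu> \<le> c" and c: "c \<le> rho n / 4" "c < rho n * X (real (Suc L) * pi / 2)"
    and L: "3 * real (Suc L) < Nr"
  shows "\<exists>l\<le>L. \<mu> = low l"
proof (cases "\<mu> = 0")
  case False
  then have mu0: "0 < \<mu>" using spectrum_nonneg[OF \<mu>(1)] by simp
  obtain a where a: "0 < a" "a < Nr * pi / 2" "cos a = 0 \<or> sin (gam a) = 0" "X a \<le> \<mu> / rho n" "\<mu> = rho n * psi n (X a)"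
    using spectrum_angle[OF \<mu>(1) mu0] \<mu>(2) c(1) by auto
  have r: "15 \<le> rho n" by (rule rho_ge)
  have g: "0 \<le> gam a" "gam a \<le> a" using gam_bounds[of a] a by auto
  have "\<exists>l. (if even l then gam a = real l * pi / 2 else a = real l * pi / 2)"
  proof (cases "cos a = 0")
    case True
    then obtain i :: nat where "a = pi / 2 + i * pi" using cos_eq_0_nonneg[of a] a by auto
    then show ?thesis by (intro exI[of _ "2 * i + 1"]) (simp add: algebra_simps)
  next
    case False
    then obtain i :: nat where "gam a = i * pi" using a(3) sin_eq_0_nonneg[OF g(1)] by auto
    then show ?thesis by (intro exI[of _ "2 * i"]) simp
  qed
  then obtain l where l: "if even l then gam a = real l * pi / 2 else a = real l * pi / 2" by blast
  have al: "real l * pi / 2 \<le> a" using l g by (auto split: if_splits)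
  have "l \<le> L"
  proof (rule ccontr)
    assume "\<not> l \<le> L"
    then have "real (Suc L) * pi / 2 \<le> real l * pi / 2" by simp
    then have "real (Suc L) * pi / 2 \<le> a" using al by (rule order_trans)
    then have "X (real (Suc L) * pi / 2) \<le> X a" using a by (intro X_mono) auto
    then have "rho n * X (real (Suc L) * pi / 2) \<le> rho n * X a" using r by (intro mult_left_mono) auto
    also have "\<dots> \<le> \<mu>" using a(4) r by (simp add: field_simps)
    finally show False using c \<mu>(2)
      by linarith
  qed
  moreover have "a = low_angle l"
  proof (cases "even l")
    case True
    have "3 * real l < Nr" using \<open>l \<le> L\<close> L by simp
    then have "3 * (real l * pi / 2) < Nr * pi / 2" by simp
    then show ?thesis using E_props[of "real l * pi / 2"] gam_inj[of a "E (real l * pi / 2)"] a l True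
      by (simp add: low_angle_def)
  qed (use l in \<open>simp add: low_angle_def\<close>)
  ultimately show ?thesis using a(5) by (intro exI[of _ l]) (simp add: low_def)
qed (use low_0 in auto)

end

text \<open>The elements of \<open>S\<close> below \<open>b L\<close> are counted once through
  \<open>lam\<close> and once through \<open>b\<close>.\<close>

lemma strict_mono_enumeration:
  fixes lam b :: "nat \<Rightarrow> real"
  assumes lam: "strict_mono lam" "range lam = S"
    and b: "\<And>i j. i < j \<Longrightarrow> j \<le> L \<Longrightarrow> b i < b j"
      "\<And>i. i \<le> L \<Longrightarrow> b i \<in> S" "\<And>s. s \<in> S \<Longrightarrow> s \<le> b L \<Longrightarrow> \<exists>l\<le>L. s = b l"
  shows "lam L = b L"
proof -
  obtain i where i: "b L = lam i" using b(2)[of L] lam(2) by auto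
  have "{s \<in> S. s < b L} = lam ` {..<i}"
    using lam by (auto simp: i strict_mono_less)
  then have "card {s \<in> S. s < b L} = i"
    using lam(1) by (simp add: card_image strict_mono_imp_inj_on)
  moreover have "{s \<in> S. s < b L} = b ` {..<L}"
  proof (intro set_eqI iffI)
    fix s assume s: "s \<in> {s \<in> S. s < b L}"
    then obtain l where "l \<le> L" "s = b l" using b(3)[of s] by auto
    moreover from this have "l \<noteq> L" using s by auto
    ultimately show "s \<in> b ` {..<L}" by auto
  qed (use b in auto)
  moreover have "inj_on b {..<L}"
  proof (rule inj_onI)
    fix i j assume ij: "i \<in> {..<L}" "j \<in> {..<L}" "b i = b j"
    then show "i = j" using b(1)[of i j] b(1)[of j i] by (cases i j rule: linorder_cases) auto
  qed
  ultimately have "i = L" by (simp add: card_image)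
  then show ?thesis using i by simp
qed

lemma low_limit: "(\<lambda>n. vicsek.low n l) \<longlonglongrightarrow> 4/3 * (real l * pi / 2)\<^sup>2"
  and low_X_limit: "(\<lambda>n. vicsek.X n (vicsek.low_angle n l)) \<longlonglongrightarrow> 0"
proof -
  have ev: "\<forall>\<^sub>F n in sequentially. n \<ge> (2::nat)" by (rule eventually_ge_at_top)
  have e1: "\<forall>\<^sub>F n in sequentially. (if even l then vicsek.E n (real l * pi / 2) else real l * pi / 2) = vicsek.low_angle n l"
    using ev by eventually_elim (simp add: vicsek.low_angle_def vicsek_def)
  have lim: "(\<lambda>n. vicsek.low_angle n l) \<longlonglongrightarrow> real l * pi / 2"
    by (rule Lim_transform_eventually[OF _ e1], cases "even l")
      (use E_limit(1)[of "real l * pi / 2"] in simp_all)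
  have nn: "\<forall>\<^sub>F n in sequentially. 0 \<le> vicsek.low_angle n l"
  proof -
    have l0: "0 \<le> real l * pi / 2" by simp
    show ?thesis using e1 E_limit(2)[OF l0]
    proof eventually_elim
      case (elim n)
      show ?case unfolding elim(1)[symmetric] using elim(2) l0 by simp
    qed
  qed
  show "(\<lambda>n. vicsek.X n (vicsek.low_angle n l)) \<longlonglongrightarrow> 0" by (rule rho_psi_X_limit(2)[OF lim nn])
  have e2: "\<forall>\<^sub>F n in sequentially. rho n * psi n (vicsek.X n (vicsek.low_angle n l)) = vicsek.low n l"
    using ev by eventually_elim (simp add: vicsek.low_def vicsek_def)
  show "(\<lambda>n. vicsek.low n l) \<longlonglongrightarrow> 4/3 * (real l * pi / 2)\<^sup>2"
    by (rule Lim_transform_eventually[OF rho_psi_X_limit(1)[OF lim nn] e2])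
qed

text \<open>Needed for the cutoff, which involves no \<open>psi\<close>; the two-sided bound on
  \<open>psi\<close> is turned around.\<close>

lemma rho_X_limit:
  assumes "0 \<le> c" shows "(\<lambda>n. rho n * vicsek.X n c) \<longlonglongrightarrow> 4/3 * c\<^sup>2"
proof -
  have nn: "\<forall>\<^sub>F n::nat in sequentially. 0 \<le> c" using assms by simp
  have x: "(\<lambda>n. vicsek.X n c) \<longlonglongrightarrow> 0" by (rule rho_psi_X_limit(2)[OF tendsto_const nn])
  have p: "(\<lambda>n. rho n * psi n (vicsek.X n c)) \<longlonglongrightarrow> 4/3 * c\<^sup>2" by (rule rho_psi_X_limit(1)[OF tendsto_const nn])
  have ev: "\<forall>\<^sub>F n in sequentially. n \<ge> (2::nat) \<and> vicsek.X n c < 1/4"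
    using order_tendstoD(2)[OF x, of "1/4"] by (intro eventually_conj eventually_ge_at_top) simp
  show ?thesis
  proof (rule tendsto_sandwich[OF _ _ _ p])
    show "\<forall>\<^sub>F n in sequentially. rho n * psi n (vicsek.X n c) * (1 - 3 * vicsek.X n c) \<le> rho n * vicsek.X n c"
      using ev
    proof eventually_elim
      case (elim n)
      then interpret vicsek n by unfold_locales auto
      have "rho n * (psi n (X c) * (1 - 3 * X c)) \<le> rho n * X c"
        using psi_props(3)[of "X c"] X_range[of c] elim rho_ge by (intro mult_left_mono) auto
      then show ?case by (simp add: mult.assoc)
    qed
    show "\<forall>\<^sub>F n in sequentially. rho n * vicsek.X n c \<le> rho n * psi n (vicsek.X n c)"
      using ev
    proof eventually_elim
      case (elim n)
      then interpret vicsek n by unfold_locales auto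
      show ?case using psi_props(2)[of "X c"] X_range[of c] elim rho_ge by (intro mult_left_mono) auto
    qed
    have "(\<lambda>n. rho n * psi n (vicsek.X n c) * (1 - 3 * vicsek.X n c)) \<longlonglongrightarrow> 4/3 * c\<^sup>2 * (1 - 3 * 0)"
      by (intro tendsto_intros p x)
    then show "(\<lambda>n. rho n * psi n (vicsek.X n c) * (1 - 3 * vicsek.X n c)) \<longlonglongrightarrow> 4/3 * c\<^sup>2" by simp
  qed
qed

text \<open>Consecutive limits differ by at least \<open>pi\<^sup>2 / 3 \<ge> 3\<close>. Errors
  below 1 therefore keep the candidates in order and leave room for the cutoff
  \<open>t L + 1\<close> between \<open>low L\<close> and
  \<open>rho n * X (real (Suc L) * pi / 2)\<close>.\<close>

lemma eventually_eigenvalue_low: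
  assumes lam: "\<And>n. n \<ge> 2 \<Longrightarrow> strict_mono (lam n) \<and> range (lam n) = vicsek_spectrum n"
  shows "\<forall>\<^sub>F n in sequentially. lam n L = vicsek.low n L"
proof -
  define t where "t l = 4/3 * (real l * pi / 2)\<^sup>2" for l :: nat
  have gap: "t i + 3 \<le> t j" if "i < j" for i j
  proof -
    have p: "9 \<le> pi\<^sup>2" using power_mono[of 3 pi 2] pi_gt3 by simp
    have "real i + 1 \<le> real j" using that by simp
    then have "(real i + 1)\<^sup>2 \<le> (real j)\<^sup>2" by (intro power_mono) auto
    then have "(real i)\<^sup>2 + 1 \<le> (real j)\<^sup>2" by (simp add: power2_sum)
    then have "pi\<^sup>2 * ((real i)\<^sup>2 + 1) \<le> pi\<^sup>2 * (real j)\<^sup>2" by (intro mult_left_mono) auto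
    then have pp: "pi\<^sup>2 * (real i)\<^sup>2 + pi\<^sup>2 \<le> pi\<^sup>2 * (real j)\<^sup>2" by (simp add: distrib_left)
    have t3: "t l * 3 = pi\<^sup>2 * (real l)\<^sup>2" for l by (simp add: t_def power_mult_distrib power_divide)
    show ?thesis using pp p t3[of i] t3[of j] by linarith
  qed
  have e1: "\<forall>\<^sub>F n in sequentially. \<forall>l\<in>{..L}. \<bar>vicsek.low n l - t l\<bar> < 1 \<and> vicsek.X n (vicsek.low_angle n l) < 1/10"
  proof (intro eventually_ball_finite ballI eventually_conj)
    fix l
    show "\<forall>\<^sub>F n in sequentially. \<bar>vicsek.low n l - t l\<bar> < 1"
      using tendstoD[OF low_limit[of l], of 1] by (simp add: t_def dist_real_def)
    show "\<forall>\<^sub>F n in sequentially. vicsek.X n (vicsek.low_angle n l) < 1/10"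
      using order_tendstoD(2)[OF low_X_limit[of l], of "1/10"] by simp
  qed simp
  have e2: "\<forall>\<^sub>F n in sequentially. t (Suc L) - 1 < rho n * vicsek.X n (real (Suc L) * pi / 2)"
    using order_tendstoD(1)[OF rho_X_limit[of "real (Suc L) * pi / 2"], of "t (Suc L) - 1"] by (simp add: t_def)
  have e3: "\<forall>\<^sub>F n in sequentially. (t L + 1) * 4 < rho n"
  proof -
    have "filterlim rho at_top sequentially" unfolding rho_def[abs_def] by real_asymp
    then show ?thesis unfolding filterlim_at_top_dense by blast
  qed
  have e4: "\<forall>\<^sub>F n in sequentially. 3 * real (Suc L) < 2 * real n - 1"
  proof -
    have "filterlim (\<lambda>n::nat. 2 * real n - 1) at_top sequentially" by real_asymp
    then show ?thesis unfolding filterlim_at_top_dense by blast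
  qed
  have "\<forall>\<^sub>F n in sequentially. n \<ge> (2::nat)" by (rule eventually_ge_at_top)
  then show ?thesis using e1 e2 e3 e4
  proof eventually_elim
    case (elim n)
    interpret vicsek n by unfold_locales (rule elim(1))
    have near: "\<bar>low l - t l\<bar> < 1" "X (low_angle l) < 1/10" if "l \<le> L" for l using elim(2) that by auto
    have Nr: "3 * real (Suc L) < Nr" using elim(5) by (simp add: Nr_def)
    show ?case
    proof (rule strict_mono_enumeration)
      show "strict_mono (lam n)" "range (lam n) = vicsek_spectrum n" using lam elim(1) by auto
      show "low i < low j" if "i < j" "j \<le> L" for i j
        using near[of i] near[of j] gap[of i j] that by force
      show "low i \<in> vicsek_spectrum n" if "i \<le> L" for i
        using low_in_spectrum[of i] near[of i] Nr that by auto
      show "\<exists>l\<le>L. s = low l" if "s \<in> vicsek_spectrum n" "s \<le> low L" for s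
      proof (rule spectrum_low[OF that(1) _ _ _ Nr])
        show "s \<le> t L + 1" using that(2) near[of L] by auto
        show "t L + 1 \<le> rho n / 4" using elim(4) by simp
        show "t L + 1 < rho n * X (real (Suc L) * pi / 2)" using elim(3) gap[of L "Suc L"] by simp
      qed
    qed
  qed
qed

lemma eigenvalue_limits:
  assumes lam: "\<And>n. n \<ge> 2 \<Longrightarrow> strict_mono (lam n) \<and> range (lam n) = vicsek_spectrum n"
  shows "(\<lambda>n. lam n l) \<longlonglongrightarrow> 4/3 * (real l * pi / 2)\<^sup>2" "n \<ge> 2 \<Longrightarrow> lam n 0 = 0"
proof -
  have "\<forall>\<^sub>F n in sequentially. lam n l = vicsek.low n l"
    by (rule eventually_eigenvalue_low) (rule lam)
  then have "\<forall>\<^sub>F n in sequentially. vicsek.low n l = lam n l" by (rule eventually_mono) (rule sym)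
  then show "(\<lambda>n. lam n l) \<longlonglongrightarrow> 4/3 * (real l * pi / 2)\<^sup>2"
    by (rule Lim_transform_eventually[OF low_limit])
  assume n: "n \<ge> 2"
  then interpret vicsek n by unfold_locales
  obtain i where i: "lam n i = 0" using zero_in_spectrum lam[OF n] by (metis rangeE)
  have "lam n 0 \<in> vicsek_spectrum n" using lam[OF n] by blast
  then have "0 \<le> lam n 0" by (rule spectrum_nonneg)
  moreover have "lam n 0 \<le> lam n i" using lam[OF n] by (simp add: strict_mono_less_eq)
  ultimately show "lam n 0 = 0" using i by simp
qed

lemma phi_limit_0:
  assumes "j \<ge> 1"
  shows "(\<lambda>n. rho n * psi n (phi n (2 * j - 1) 0)) \<longlonglongrightarrow> 4 * pi\<^sup>2 / 3 * (real j - 1)\<^sup>2"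
proof -
  define k where "k = j - 1"
  have k: "2 * j - 1 = 2 * k + 1" "real j - 1 = real k" using assms by (auto simp: k_def)
  have "\<forall>\<^sub>F n in sequentially. n \<ge> (2::nat) \<and> 6 * real k < 2 * real n - 1"
  proof (rule eventually_conj[OF eventually_ge_at_top])
    have "filterlim (\<lambda>n::nat. 2 * real n - 1) at_top sequentially" by real_asymp
    then show "\<forall>\<^sub>F n in sequentially. 6 * real k < 2 * real n - 1" unfolding filterlim_at_top_dense by blast
  qed
  then have e: "\<forall>\<^sub>F n in sequentially. rho n * psi n (vicsek.X n (vicsek.E n (real k * pi))) = rho n * psi n (phi n (2 * j - 1) 0)"
  proof eventually_elim
    case (elim n)
    then interpret vicsek n by unfold_locales auto
    show ?case using phi_odd_0[of k] elim unfolding k(1) by (simp add: Nr_def)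
  qed
  have "(\<lambda>n. rho n * psi n (vicsek.X n (vicsek.E n (real k * pi)))) \<longlonglongrightarrow> 4/3 * (real k * pi)\<^sup>2"
    by (rule rho_psi_X_limit(1)[OF E_limit]) auto
  from Lim_transform_eventually[OF this e] show ?thesis unfolding k(2) by (simp add: power_mult_distrib mult_ac)
qed

lemma phi_limit_43:
  assumes "j \<ge> 1"
  shows "(\<lambda>n. rho n * psi n (phi n (2 * j - 1) (4/3))) \<longlonglongrightarrow> 4 * pi\<^sup>2 / 3 * (real j - 1/2)\<^sup>2"
proof -
  define k where "k = j - 1"
  have k: "2 * j - 1 = 2 * k + 1" "real j - 1/2 = real k + 1/2" using assms by (auto simp: k_def of_nat_diff)
  have "\<forall>\<^sub>F n in sequentially. n \<ge> (2::nat) \<and> 6 * real k + 3 < 2 * real n - 1"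
  proof (rule eventually_conj[OF eventually_ge_at_top])
    have "filterlim (\<lambda>n::nat. 2 * real n - 1) at_top sequentially" by real_asymp
    then show "\<forall>\<^sub>F n in sequentially. 6 * real k + 3 < 2 * real n - 1" unfolding filterlim_at_top_dense by blast
  qed
  then have e: "\<forall>\<^sub>F n in sequentially. rho n * psi n (vicsek.X n (pi / 2 + real k * pi)) = rho n * psi n (phi n (2 * j - 1) (4/3))"
  proof eventually_elim
    case (elim n)
    then interpret vicsek n by unfold_locales auto
    show ?case using phi_odd_43[of k] elim unfolding k(1) by (simp add: Nr_def)
  qed
  have "(\<lambda>n. rho n * psi n (vicsek.X n (pi / 2 + real k * pi))) \<longlonglongrightarrow> 4/3 * (pi / 2 + real k * pi)\<^sup>2"
    by (rule rho_psi_X_limit(1)[OF tendsto_const]) simp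
  moreover have "pi / 2 + real k * pi = pi * (real j - 1/2)" unfolding k(2) by (simp add: algebra_simps)
  ultimately show ?thesis using Lim_transform_eventually[OF _ e] by (simp add: power_mult_distrib mult_ac)
qed

section \<open>Spectrum of the cross\<close>

lemma constant_on_unit_interval:
  fixes f :: "real \<Rightarrow> real"
  assumes "\<And>t. t \<in> {0..1} \<Longrightarrow> (f has_real_derivative 0) (at t within {0..1})" "t \<in> {0..1}"
  shows "f t = f 1"
  using has_field_derivative_zero_constant[OF convex_real_interval(5) assms(1)] assms(2) by force

text \<open>\<open>p\<close> and \<open>q\<close> are phase plane coordinates that rotate with the
  motion, hence constant; the Neumann condition at 1 makes \<open>q\<close> zero.\<close>

lemma segment_trig:
  assumes "\<And>t. t \<in> {0..1} \<Longrightarrow> (u has_real_derivative u' t) (at t within {0..1})"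
    "\<And>t. t \<in> {0..1} \<Longrightarrow> (u' has_real_derivative - (w\<^sup>2) * u t) (at t within {0..1})"
    "u' 1 = 0" "w \<noteq> 0" "t \<in> {0..1}"
  shows "u t = u 1 * cos (w * (1 - t))" "u' t = w * u 1 * sin (w * (1 - t))"
proof -
  define p where "p t = w * u t * cos (w * (1 - t)) + u' t * sin (w * (1 - t))" for t
  define q where "q t = w * u t * sin (w * (1 - t)) - u' t * cos (w * (1 - t))" for t
  have "p t = p 1"
  proof (rule constant_on_unit_interval[OF _ assms(5)])
    fix t :: real assume t: "t \<in> {0..1}"
    show "(p has_real_derivative 0) (at t within {0..1})" unfolding p_def[abs_def]
      by (rule derivative_eq_intros assms(1)[OF t] assms(2)[OF t] refl)+ (simp add: power2_eq_square algebra_simps)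
  qed
  then have p: "p t = w * u 1" by (simp add: p_def)
  have "q t = q 1"
  proof (rule constant_on_unit_interval[OF _ assms(5)])
    fix t :: real assume t: "t \<in> {0..1}"
    show "(q has_real_derivative 0) (at t within {0..1})" unfolding q_def[abs_def]
      by (rule derivative_eq_intros assms(1)[OF t] assms(2)[OF t] refl)+ (simp add: power2_eq_square algebra_simps)
  qed
  then have q: "q t = 0" using assms(3) by (simp add: q_def)
  define c s where "c = cos (w * (1 - t))" "s = sin (w * (1 - t))"
  have cs: "c * c + s * s = 1" using sin_cos_squared_add2[of "w * (1 - t)"] by (simp add: c_s_def power2_eq_square)
  have pq: "p t = w * u t * c + u' t * s" "q t = w * u t * s - u' t * c" by (simp_all add: p_def q_def c_s_def)
  have "w * u t * (c * c + s * s) = p t * c + q t * s" unfolding pq by (simp add: algebra_simps)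
  then show "u t = u 1 * cos (w * (1 - t))" unfolding cs p q using assms(4) by (simp add: c_s_def)
  have "u' t * (c * c + s * s) = p t * s - q t * c" unfolding pq by (simp add: algebra_simps)
  then show "u' t = w * u 1 * sin (w * (1 - t))" unfolding cs p q by (simp add: c_s_def)
qed

lemma segment_hyp:
  assumes "\<And>t. t \<in> {0..1} \<Longrightarrow> (u has_real_derivative u' t) (at t within {0..1})"
    "\<And>t. t \<in> {0..1} \<Longrightarrow> (u' has_real_derivative w\<^sup>2 * u t) (at t within {0..1})"
    "u' 1 = 0" "w \<noteq> 0" "t \<in> {0..1}"
  shows "u t = u 1 * cosh (w * (1 - t))" "u' t = - w * u 1 * sinh (w * (1 - t))"
proof -
  define p where "p t = w * u t * cosh (w * (1 - t)) + u' t * sinh (w * (1 - t))" for t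
  define q where "q t = w * u t * sinh (w * (1 - t)) + u' t * cosh (w * (1 - t))" for t
  have "p t = p 1"
  proof (rule constant_on_unit_interval[OF _ assms(5)])
    fix t :: real assume t: "t \<in> {0..1}"
    show "(p has_real_derivative 0) (at t within {0..1})" unfolding p_def[abs_def]
      by (rule derivative_eq_intros assms(1)[OF t] assms(2)[OF t] refl)+ (simp add: power2_eq_square algebra_simps)
  qed
  then have p: "p t = w * u 1" by (simp add: p_def)
  have "q t = q 1"
  proof (rule constant_on_unit_interval[OF _ assms(5)])
    fix t :: real assume t: "t \<in> {0..1}"
    show "(q has_real_derivative 0) (at t within {0..1})" unfolding q_def[abs_def]
      by (rule derivative_eq_intros assms(1)[OF t] assms(2)[OF t] refl)+ (simp add: power2_eq_square algebra_simps)
  qed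
  then have q: "q t = 0" using assms(3) by (simp add: q_def)
  define c s where "c = cosh (w * (1 - t))" "s = sinh (w * (1 - t))"
  have cs: "c * c - s * s = 1" using cosh_square_eq[of "w * (1 - t)"] by (simp add: c_s_def power2_eq_square)
  have pq: "p t = w * u t * c + u' t * s" "q t = w * u t * s + u' t * c" by (simp_all add: p_def q_def c_s_def)
  have "w * u t * (c * c - s * s) = p t * c - q t * s" unfolding pq by (simp add: algebra_simps)
  then show "u t = u 1 * cosh (w * (1 - t))" unfolding cs p q using assms(4) by (simp add: c_s_def)
  have "u' t * (c * c - s * s) = q t * c - p t * s" unfolding pq by (simp add: algebra_simps)
  then show "u' t = - w * u 1 * sinh (w * (1 - t))" unfolding cs p q by (simp add: c_s_def)
qed

text \<open>All segments carry the same profile. For positive \<open>\<kappa>\<close> either it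
  vanishes at the center, \<open>cos w = 0\<close>, or continuity makes the amplitudes equal and the
  derivative condition gives \<open>sin w = 0\<close>; both say \<open>sin (2 * w) = 0\<close>. For
  negative \<open>\<kappa>\<close> the profile is \<open>cosh\<close>, and \<open>sinh w\<close> has
  no zero.\<close>

lemma cross_spectrum_subset: "cross_spectrum \<subseteq> range (\<lambda>l::nat. (real l * pi / 2)\<^sup>2)"
proof
  fix \<kappa> assume "\<kappa> \<in> cross_spectrum"
  then obtain u i0 t0 where u: "cross_laplacian u (\<lambda>i t. - \<kappa> * u i t)" and nz: "i0 < 4" "t0 \<in> {0..1}" "u i0 t0 \<noteq> 0"
    unfolding cross_spectrum_def by auto
  obtain u' where du: "\<And>i t. i < 4 \<Longrightarrow> t \<in> {0..1} \<Longrightarrow> (u i has_real_derivative u' i t) (at t within {0..1})"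
      "\<And>i t. i < 4 \<Longrightarrow> t \<in> {0..1} \<Longrightarrow> (u' i has_real_derivative - \<kappa> * u i t) (at t within {0..1})"
    and bc: "\<And>i. i < 4 \<Longrightarrow> u i 0 = u 0 0" "(\<Sum>i<4. u' i 0) = 0" "\<And>i. i < 4 \<Longrightarrow> u' i 1 = 0"
    using u unfolding cross_laplacian_def by blast
  consider "\<kappa> = 0" | "\<kappa> < 0" | "\<kappa> > 0" by linarith
  then show "\<kappa> \<in> range (\<lambda>l::nat. (real l * pi / 2)\<^sup>2)"
  proof cases
    case 1
    then show ?thesis by (intro image_eqI[of _ _ 0]) auto
  next
    case 2
    define w where "w = sqrt (- \<kappa>)"
    have w: "w > 0" "w\<^sup>2 = - \<kappa>" using 2 by (auto simp: w_def)
    have sol: "u i t = u i 1 * cosh (w * (1 - t))" "u' i t = - w * u i 1 * sinh (w * (1 - t))" if "i < 4" "t \<in> {0..1}" for i t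
      using segment_hyp[of "u i" "u' i" w t] du bc(3) that w by auto
    have eq: "u i 1 = u 0 1" if "i < 4" for i
    proof -
      have "u i 1 * cosh w = u 0 1 * cosh w" using bc(1)[OF that] sol(1)[of i 0] sol(1)[of 0 0] that by simp
      then show ?thesis by simp
    qed
    have "u' i 0 = - w * u 0 1 * sinh w" if "i < 4" for i using sol(2)[OF that, of 0] eq[OF that] by simp
    then have "(\<Sum>i<4. u' i 0) = (\<Sum>i<(4::nat). - w * u 0 1 * sinh w)" by (intro sum.cong) auto
    then have "u 0 1 * sinh w = 0" using bc(2) w by simp
    then have "u 0 1 = 0" using w by simp
    then have "u i0 t0 = 0" using sol(1)[OF nz(1,2)] eq[OF nz(1)] by simp
    then show ?thesis using nz(3) by simp
  next
    case 3
    define w where "w = sqrt \<kappa>"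
    have w: "w > 0" "w\<^sup>2 = \<kappa>" using 3 by (auto simp: w_def)
    have sol: "u i t = u i 1 * cos (w * (1 - t))" "u' i t = w * u i 1 * sin (w * (1 - t))" if "i < 4" "t \<in> {0..1}" for i t
      using segment_trig[of "u i" "u' i" w t] du bc(3) that w by auto
    have "sin (2 * w) = 0"
    proof (cases "cos w = 0")
      case True
      then show ?thesis by (simp add: sin_double)
    next
      case False
      have eq: "u i 1 = u 0 1" if "i < 4" for i
      proof -
        have "u i 1 * cos w = u 0 1 * cos w" using bc(1)[OF that] sol(1)[of i 0] sol(1)[of 0 0] that by simp
        then show ?thesis using False by simp
      qed
      have "u' i 0 = w * u 0 1 * sin w" if "i < 4" for i using sol(2)[OF that, of 0] eq[OF that] by simp
      then have "(\<Sum>i<4. u' i 0) = (\<Sum>i<(4::nat). w * u 0 1 * sin w)" by (intro sum.cong) auto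
      then have "u 0 1 = 0 \<or> sin w = 0" using bc(2) w by auto
      moreover have "u 0 1 \<noteq> 0" using sol(1)[OF nz(1,2)] eq[OF nz(1)] nz(3) by auto
      ultimately show ?thesis by (simp add: sin_double)
    qed
    then obtain i :: int where "2 * w = of_int i * pi" by (auto simp: sin_zero_iff_int2)
    then have i: "w = of_int i * pi / 2" by simp
    then have "0 < of_int i * pi" using w by simp
    then have "i > 0" by (simp add: zero_less_mult_iff)
    then have "w = real (nat i) * pi / 2" using i by simp
    then have "\<kappa> = (real (nat i) * pi / 2)\<^sup>2" using w(2)[symmetric] by (simp only:)
    then show ?thesis by (rule range_eqI)
  qed
qed

lemma cross_spectrum_eq: "cross_spectrum = range (\<lambda>l::nat. (real l * pi / 2)\<^sup>2)"
proof (intro equalityI cross_spectrum_subset subsetI)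
  fix \<kappa> assume "\<kappa> \<in> range (\<lambda>l::nat. (real l * pi / 2)\<^sup>2)"
  then obtain l :: nat where l: "\<kappa> = (real l * pi / 2)\<^sup>2" by auto
  define w where "w = real l * pi / 2"
  \<comment> \<open>For odd \<open>l\<close> the profile vanishes at the center, so amplitudes of
    sum zero satisfy all conditions; for even \<open>l\<close> its derivative vanishes there, and
    equal amplitudes do.\<close>
  define c :: "nat \<Rightarrow> real" where "c i = (if even l then 1 else if i = 0 then 1 else if i = 1 then - 1 else 0)" for i
  define u where "u i t = c i * cos (w * (1 - t))" for i t
  define u' where "u' i t = c i * w * sin (w * (1 - t))" for i t
  have cw: "cos w = 0" if "odd l"
  proof -
    obtain k where "l = 2 * k + 1" using \<open>odd l\<close> oddE by blast
    then have "w = pi / 2 + real k * pi" by (simp add: w_def algebra_simps)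
    then show ?thesis by (simp add: cos_add)
  qed
  have sw: "sin w = 0" if "even l" using that by (auto simp: w_def elim: evenE)
  have "cross_laplacian u (\<lambda>i t. - \<kappa> * u i t)"
    unfolding cross_laplacian_def
  proof (intro exI[of _ u'] conjI allI impI ballI)
    fix i :: nat and t :: real
    show "(u i has_real_derivative u' i t) (at t within {0..1})" unfolding u_def[abs_def] u'_def
      by (auto intro!: derivative_eq_intros)
    show "(u' i has_real_derivative - \<kappa> * u i t) (at t within {0..1})" unfolding u_def u'_def[abs_def] l w_def[symmetric]
      by (auto intro!: derivative_eq_intros simp: power2_eq_square)
    show "u i 0 = u 0 0" using cw by (cases "even l") (auto simp: u_def c_def)
    show "u' i 1 = 0" by (simp add: u'_def)
  next
    show "(\<Sum>i<4. u' i 0) = 0" using sw by (cases "even l") (auto simp: u'_def c_def numeral_eq_Suc)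
  qed
  moreover have "u 0 1 \<noteq> 0" by (simp add: u_def c_def)
  ultimately show "\<kappa> \<in> cross_spectrum" unfolding cross_spectrum_def
    by (intro CollectI exI[of _ u] conjI exI[of _ 0] bexI[of _ 1]) auto
qed

theorem mainTheorem8:
  shows "(\<forall>j\<ge>1. (\<lambda>n. rho n * psi n (phi n (2 * j - 1) 0))
                \<longlonglongrightarrow> 4 * pi\<^sup>2 / 3 * (real j - 1)\<^sup>2)
    \<and> (\<forall>j\<ge>1. (\<lambda>n. rho n * psi n (phi n (2 * j - 1) (4/3)))
                \<longlonglongrightarrow> 4 * pi\<^sup>2 / 3 * (real j - 1/2)\<^sup>2)
    \<and> (\<forall>lam :: nat \<Rightarrow> nat \<Rightarrow> real.
         (\<forall>n\<ge>2. strict_mono (lam n) \<and> range (lam n) = vicsek_spectrum n) \<longrightarrow>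
           (\<forall>n\<ge>2. lam n 0 = 0)
         \<and> (\<forall>l. (\<lambda>n. lam n l) \<longlonglongrightarrow> 4/3 * (real l * pi / 2)\<^sup>2))
    \<and> cross_spectrum = range (\<lambda>l::nat. (real l * pi / 2)\<^sup>2)"
proof (intro conjI allI impI cross_spectrum_eq)
  fix lam :: "nat \<Rightarrow> nat \<Rightarrow> real"
  assume lam: "\<forall>n\<ge>2. strict_mono (lam n) \<and> range (lam n) = vicsek_spectrum n"
  show "lam n 0 = 0" if "n \<ge> 2" for n by (rule eigenvalue_limits(2)[OF _ that]) (use lam in blast)
  show "(\<lambda>n. lam n l) \<longlonglongrightarrow> 4/3 * (real l * pi / 2)\<^sup>2" for l
    by (rule eigenvalue_limits(1)) (use lam in blast)
qed (fact phi_limit_0 phi_limit_43)+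

end
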